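(* Let $V\in\mathcal I_{P_1}(\mathcal K)$, and let $T_V,\mathfrak h_V,P_V,U_V,W_V$ be the objects associated with $V$ as in the context (the definition of $U_V$ and $W_V$ depends on the choice of an orthonormal basis in $\mathfrak h_V$). Then: (1) $P_V$ belongs to $\mathfrak P_{P_1}$ and satisfies $V^*P_VV=P_1$. It is chosen such that $\ker (P_V)_{11}$ and $\|(P_V)_{21}{(P_V)_{11}}^{-1}\|_{HS}$ are minimal, in the following sense: every $P\in\mathfrak P_{P_1}$ with $V^*PV=P_1$ satisfies $\ker(P_V)_{11}=\mathfrak h_V\subset\ker P_{11}$, and every such $P$ with $\ker P_{11}=\mathfrak h_V$ satisfies $\|(P_V)_{21}{(P_V)_{11}}^{-1}\|_{HS}\le\|P_{21}{P_{11}}^{-1}\|_{HS}$. (2) $U_V\in\mathcal I_{HS}(\mathcal K)$ and $W_V\in\mathcal I_{diag}(\mathcal K)$, and $$M_{U_V}=0,\quad T_{U_V}=T_V,\quad \mathfrak h_{U_V}=\mathfrak h_V,\quad P_{U_V}=P_V;$$ $$M_{W_V}=M_V,\quad T_{W_V}=0,\quad \mathfrak h_{W_V}=\{0\},\quad P_{W_V}=P_1;$$ $$W_V=\begin{pmatrix}(P_1+T_V^*T_V)^{1/2}V_{11}-\overline{u_{\mathfrak h_V}}V_{21} & 0 \\ 0 & (P_2+T_VT_V^* )^{1/2}V_{22}-u_{\mathfrak h_V}V_{12}\end{pmatrix},\qquad V=U_VW_V .$$ (3) If $M_V=0$, then $$U_V=\begin{pmatrix}|V_{11}^*| & V_{12}v_{22}^*-\overline{u_{\mathfrak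 h_V}} \\ V_{21}v_{11}^*-u_{\mathfrak h_V} & |V_{22}^*|\end{pmatrix},\qquad W_V=\begin{pmatrix}v_{11}-\overline{u_{\mathfrak h_V}}V_{21} & 0 \\ 0 & v_{22}-u_{\mathfrak h_V}V_{12}\end{pmatrix},$$ where $v_{11},v_{22}$ are the partial isometries in the polar decompositions $V_{11}=v_{11}|V_{11}|$, $V_{22}=v_{22}|V_{22}|$. (4) If $V\in\mathcal I_{diag}(\mathcal K)$, then $U_V=\mathbf 1$ and $W_V=V$.
   Context: Let $\mathcal K$ be an infinite-dimensional separable complex Hilbert space (inner product linear in the second argument) with a complex conjugation $f\mapsto f^*$ (an antiunitary involution). For bounded $A$ put $\overline{A}f=(A(f^* ))^*$ and $A^\tau=\overline{A^*}$; $A$ is antisymmetric if $A^\tau=-A$. A basis projection is an orthogonal projection $P$ with $P+\overline P=\mathbf 1$. Fix a basis projection $P_1$, put $P_2=\mathbf 1-P_1=\overline{P_1}$, $\mathcal K_n=P_n(\mathcal K)$, $A_{mn}=P_mAP_n:\mathcal K_n\to\mathcal K_m$, and write operators as $2\times2$ matrices with respect to $\mathcal K=\mathcal K_1\oplus\mathcal K_2$. For a closed subspace $\mathcal H$ let $p_{\mathcal H}$ be the orthogonal projection onto $\mathcal H$, and $\mathcal H^*=\{f^*:f\in\mathcal H\}$. $\mathcal I(\mathcal K)=\{V\in\mathfrak B(\mathcal K):V^*V=\mathbf 1,\overline V=V\}$ (Bogoliubov operators); $M_V=-\tfrac12\operatorname{ind}V=\tfrac12\dim\ker V^*$; $\mathcal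 I_{P_1}(\mathcal K)=\{V\in\mathcal I(\mathcal K):V_{12}\text{ Hilbert–Schmidt}\}$; $\mathcal I_{HS}(\mathcal K)=\{U\in\mathcal I(\mathcal K):U-\mathbf 1\text{ Hilbert–Schmidt}\}$; $\mathcal I_{diag}(\mathcal K)=\{W\in\mathcal I(\mathcal K):[P_1,W]=0\}$. $\mathfrak P_{P_1}$ is the set of basis projections $P$ with $P_1-P$ Hilbert–Schmidt; for such $P$, $\ker P_{11}$ is finite-dimensional, $\operatorname{ran}P_{11}$ is closed and ${P_{11}}^{-1}$ denotes the inverse of $P_{11}$ on $\operatorname{ran}P_{11}$, extended by zero on $\ker P_{11}$. For $V\in\mathcal I_{P_1}(\mathcal K)$, $V_{11}$ and $V_{22}$ have closed range. Let ${V_{11}}^{-1}$ be the inverse of $V_{11}$ on $\operatorname{ran}V_{11}$ (with range $\operatorname{ran}{V_{11}}^*$), extended by zero on $\ker{V_{11}}^*$; similarly ${V_{22}}^{-1}$, and ${V_{22}}^{-1*}=({V_{22}}^{-1})^*$. Define $$T_V=V_{21}{V_{11}}^{-1}-{V_{22}}^{-1*}{V_{12}}^*p_{\ker{V_{11}}^*},\qquad \mathfrak h_V=V_{12}(\ker V_{22})\subset\mathcal K_1 .$$ $T_V$ is an antisymmetric Hilbert–Schmidt operator from $\mathcal K_1$ to $\mathcal K_2$, $\mathfrak h_V$ is finite-dimensional and contained in $\ker T_V$. For an antisymmetric Hilbert–Schmidt operator $T:\mathcal K_1\to\mathcal K_2$ let $P_T=(P_1+T)(P_1+T^*T)^{-1}(P_1+T^*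 )$ and $U_T=(P_1+T)(P_1+T^*T)^{-1/2}+(P_2-T^* )(P_2+TT^* )^{-1/2}$. For a finite-dimensional subspace $\mathfrak h\subset\mathcal K_1$ with chosen orthonormal basis $\{e_1,\dots,e_L\}$ let $u_{\mathfrak h}=\sum_{r=1}^Le_r^*\langle e_r,\cdot\rangle$ (a partial isometry with initial space $\mathfrak h$ and final space $\mathfrak h^*$) and $U_{\mathfrak h}=\mathbf 1-\begin{pmatrix}p_{\mathfrak h} & \overline{u_{\mathfrak h}} \\ u_{\mathfrak h} & \overline{p_{\mathfrak h}}\end{pmatrix}$. Finally $$P_V=P_{T_V}-p_{\mathfrak h_V}+\overline{p_{\mathfrak h_V}},\qquad U_V=U_{T_V}U_{\mathfrak h_V},\qquad W_V=U_V^*V .$$ *)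

theory Defs
  imports "HOL-Analysis.Analysis"
begin

section \<open>Complex Hilbert spaces\<close>

text \<open>The real inner product and norm of the library are tied to the complex structure by
  the last axiom, so that \<^term>\<open>norm x\<close> is the norm given by \<^term>\<open>cinner x x\<close>.\<close>

class complex_hilbert_space = real_inner + complete_space +
  fixes scaleC :: "complex \<Rightarrow> 'a \<Rightarrow> 'a"  (infixr \<open>*\<^sub>C\<close> 75)
    and cinner :: "'a \<Rightarrow> 'a \<Rightarrow> complex"
  assumes scaleC_add_right: "c *\<^sub>C (x + y) = c *\<^sub>C x + c *\<^sub>C y"
    and scaleC_add_left: "(c + d) *\<^sub>C x = c *\<^sub>C x + d *\<^sub>C x"
    and scaleC_scaleC: "c *\<^sub>C d *\<^sub>C x = (c * d) *\<^sub>C x"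
    and scaleC_of_real: "complex_of_real r *\<^sub>C x = r *\<^sub>R x"
    and cinner_commute: "cinner x y = cnj (cinner y x)"
    and cinner_add_right: "cinner x (y + z) = cinner x y + cinner x z"
    and cinner_scaleC_right: "cinner x (c *\<^sub>C y) = c * cinner x y"
    and inner_eq_Re_cinner: "x \<bullet> y = Re (cinner x y)"

global_interpretation complex_vector: vector_space
  "scaleC :: complex \<Rightarrow> 'a \<Rightarrow> 'a::complex_hilbert_space"
proof
  show "1 *\<^sub>C x = x" for x :: 'a
    using scaleC_of_real[of 1 x] by simp
qed (simp_all add: scaleC_add_right scaleC_add_left scaleC_scaleC)

definition complex_dimension :: "'a::complex_hilbert_space set \<Rightarrow> enat" where
  "complex_dimension S =
     (if \<exists>B. finite B \<and> S \<subseteq> complex_vector.span B then enat (complex_vector.dim S) else \<infinity>)"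

text \<open>Orthonormal basis in the Hilbert space sense of a closed subspace \<open>H\<close>.\<close>

definition onb_of :: "'a::complex_hilbert_space set \<Rightarrow> 'a set \<Rightarrow> bool" where
  "onb_of H E \<longleftrightarrow>
     (\<forall>e\<in>E. \<forall>f\<in>E. cinner e f = (if e = f then 1 else 0)) \<and> closure (complex_vector.span E) = H"

text \<open>\<open>f \<mapsto> f\<^sup>*\<close> as an antiunitary involution.\<close>

definition complex_conjugation :: "('a::complex_hilbert_space \<Rightarrow> 'a) \<Rightarrow> bool" where
  "complex_conjugation J \<longleftrightarrow>
     (\<forall>f g. J (f + g) = J f + J g) \<and> (\<forall>c f. J (c *\<^sub>C f) = cnj c *\<^sub>C J f) \<and>
     (\<forall>f g. cinner (J f) (J g) = cinner g f) \<and> (\<forall>f. J (J f) = f)"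


section \<open>Bounded operators\<close>

text \<open>Bounded operators are elements of the library type of real-linear bounded maps that
  satisfy \<open>clinear_op\<close>.  The operators below that are given by a definite
  description are unique; the existence of the generalised inverse needs a closed range.\<close>

notation blinfun_compose (infixl \<open>\<cdot>\<close> 70)

type_synonym 'a op = "'a \<Rightarrow>\<^sub>L 'a"

definition clinear_op :: "'a::complex_hilbert_space op \<Rightarrow> bool" where
  "clinear_op A \<longleftrightarrow> (\<forall>c x. A (c *\<^sub>C x) = c *\<^sub>C A x)"

definition adj :: "'a::complex_hilbert_space op \<Rightarrow> 'a op"  (\<open>_\<^sup>\<dagger>\<close> [1000] 1000) where
  "A\<^sup>\<dagger> = (THE B :: 'a op. \<forall>x y. cinner (B x) y = cinner x (A y))"

definition op_conj :: "('a::complex_hilbert_space \<Rightarrow> 'a) \<Rightarrow> 'a op \<Rightarrow> 'a op" where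
  "op_conj J A = Blinfun (\<lambda>f. J (A (J f)))"

definition positive_op :: "'a::complex_hilbert_space op \<Rightarrow> bool" where
  "positive_op A \<longleftrightarrow> clinear_op A \<and> (\<forall>x. cinner x (A x) \<in> \<real>\<^sub>\<ge>\<^sub>0)"

definition op_sqrt :: "'a::complex_hilbert_space op \<Rightarrow> 'a op" where
  "op_sqrt A = (THE B :: 'a op. positive_op B \<and> B \<cdot> B = A)"

definition op_abs :: "'a::complex_hilbert_space op \<Rightarrow> 'a op" where
  "op_abs A = op_sqrt (A\<^sup>\<dagger> \<cdot> A)"

definition partial_isometry :: "'a::complex_hilbert_space op \<Rightarrow> bool" where
  "partial_isometry v \<longleftrightarrow>
     clinear_op v \<and> (\<forall>x. (\<forall>y. v y = 0 \<longrightarrow> cinner y x = 0) \<longrightarrow> norm (v x) = norm x)"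

definition polar_isometry :: "'a::complex_hilbert_space op \<Rightarrow> 'a op" where
  "polar_isometry A = (THE v :: 'a op. partial_isometry v \<and> A = v \<cdot> op_abs A \<and> (\<forall>x. v x = 0 \<longleftrightarrow> A x = 0))"

text \<open>The inverse of \<open>A\<close> on its range, with values in the range of \<open>A\<^sup>\<dagger>\<close>,
  extended by zero on the kernel of \<open>A\<^sup>\<dagger>\<close>.  If \<open>A\<close> is an operator between two closed subspaces,
  extended by zero to the whole space, then so is this inverse (in the opposite direction).\<close>

definition gen_inv :: "'a::complex_hilbert_space op \<Rightarrow> 'a op" where
  "gen_inv A = (THE B :: 'a op. (\<forall>x\<in>range (A\<^sup>\<dagger>). B (A x) = x) \<and> (\<forall>y. A\<^sup>\<dagger> y = 0 \<longrightarrow> B y = 0))"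

definition orth_projection :: "'a::complex_hilbert_space op \<Rightarrow> bool" where
  "orth_projection P \<longleftrightarrow> clinear_op P \<and> P \<cdot> P = P \<and> P\<^sup>\<dagger> = P"

definition proj_on :: "'a::complex_hilbert_space set \<Rightarrow> 'a op" where
  "proj_on H = (THE P :: 'a op. orth_projection P \<and> range P = H)"

definition hilbert_schmidt :: "'a::complex_hilbert_space op \<Rightarrow> bool" where
  "hilbert_schmidt A \<longleftrightarrow>
     clinear_op A \<and> (\<exists>E. onb_of UNIV E \<and> (\<lambda>e. (norm (A e))\<^sup>2) summable_on E)"

text \<open>The sum does not depend on the orthonormal basis.\<close>

definition hs_norm :: "'a::complex_hilbert_space op \<Rightarrow> real" where
  "hs_norm A = sqrt (\<Sum>\<^sub>\<infinity>e\<in>(SOME E. onb_of UNIV E). (norm (A e))\<^sup>2)"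


section \<open>Basis projections and Bogoliubov operators\<close>

definition basis_projection :: "('a::complex_hilbert_space \<Rightarrow> 'a) \<Rightarrow> 'a op \<Rightarrow> bool" where
  "basis_projection J P \<longleftrightarrow> orth_projection P \<and> P + op_conj J P = id_blinfun"

definition compl_proj :: "'a::complex_hilbert_space op \<Rightarrow> 'a op" where
  "compl_proj P1 = id_blinfun - P1"

text \<open>The components \<open>A\<^sub>m\<^sub>n : K\<^sub>n \<rightarrow> K\<^sub>m\<close> with respect to \<open>K\<^sub>1 = range P1\<close> and
  \<open>K\<^sub>2 = range (compl_proj P1)\<close> are regarded as operators on the whole space, extended by
  zero; a matrix of such operators is then the sum of its entries.  Kernels of components
  have to be taken inside \<open>K\<^sub>1\<close> resp. \<open>K\<^sub>2\<close>.\<close>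

definition op11 :: "'a::complex_hilbert_space op \<Rightarrow> 'a op \<Rightarrow> 'a op" where
  "op11 P1 A = P1 \<cdot> A \<cdot> P1"
definition op12 :: "'a::complex_hilbert_space op \<Rightarrow> 'a op \<Rightarrow> 'a op" where
  "op12 P1 A = P1 \<cdot> A \<cdot> compl_proj P1"
definition op21 :: "'a::complex_hilbert_space op \<Rightarrow> 'a op \<Rightarrow> 'a op" where
  "op21 P1 A = compl_proj P1 \<cdot> A \<cdot> P1"
definition op22 :: "'a::complex_hilbert_space op \<Rightarrow> 'a op \<Rightarrow> 'a op" where
  "op22 P1 A = compl_proj P1 \<cdot> A \<cdot> compl_proj P1"

definition op_matrix :: "'a::complex_hilbert_space op \<Rightarrow> 'a op \<Rightarrow> 'a op \<Rightarrow> 'a op \<Rightarrow> 'a op" where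
  "op_matrix A11 A12 A21 A22 = A11 + A12 + A21 + A22"

definition ker1 :: "'a::complex_hilbert_space op \<Rightarrow> 'a op \<Rightarrow> 'a set" where
  "ker1 P1 A = {f \<in> range P1. A f = 0}"

definition ker2 :: "'a::complex_hilbert_space op \<Rightarrow> 'a op \<Rightarrow> 'a set" where
  "ker2 P1 A = {f \<in> range (compl_proj P1). A f = 0}"

definition Bogoliubov :: "('a::complex_hilbert_space \<Rightarrow> 'a) \<Rightarrow> 'a op set" where
  "Bogoliubov J = {V. clinear_op V \<and> V\<^sup>\<dagger> \<cdot> V = id_blinfun \<and> op_conj J V = V}"

definition Bogoliubov_P1 :: "('a::complex_hilbert_space \<Rightarrow> 'a) \<Rightarrow> 'a op \<Rightarrow> 'a op set" where
  "Bogoliubov_P1 J P1 = {V \<in> Bogoliubov J. hilbert_schmidt (op12 P1 V)}"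

definition Bogoliubov_HS :: "('a::complex_hilbert_space \<Rightarrow> 'a) \<Rightarrow> 'a op set" where
  "Bogoliubov_HS J = {U \<in> Bogoliubov J. hilbert_schmidt (U - id_blinfun)}"

definition Bogoliubov_diag :: "('a::complex_hilbert_space \<Rightarrow> 'a) \<Rightarrow> 'a op \<Rightarrow> 'a op set" where
  "Bogoliubov_diag J P1 = {W \<in> Bogoliubov J. P1 \<cdot> W - W \<cdot> P1 = 0}"

definition basis_projections_HS :: "('a::complex_hilbert_space \<Rightarrow> 'a) \<Rightarrow> 'a op \<Rightarrow> 'a op set" where
  "basis_projections_HS J P1 = {P. basis_projection J P \<and> hilbert_schmidt (P1 - P)}"

text \<open>\<open>M\<^sub>V\<close> may be infinite or half-integral, hence the extended non-negative reals.\<close>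

definition M_of :: "'a::complex_hilbert_space op \<Rightarrow> ennreal" where
  "M_of V = ennreal_of_enat (complex_dimension {f. V\<^sup>\<dagger> f = 0}) / 2"

definition T_of :: "'a::complex_hilbert_space op \<Rightarrow> 'a op \<Rightarrow> 'a op" where
  "T_of P1 V = op21 P1 V \<cdot> gen_inv (op11 P1 V)
     - (gen_inv (op22 P1 V))\<^sup>\<dagger> \<cdot> (op12 P1 V)\<^sup>\<dagger> \<cdot> proj_on (ker1 P1 ((op11 P1 V)\<^sup>\<dagger>))"

definition h_of :: "'a::complex_hilbert_space op \<Rightarrow> 'a op \<Rightarrow> 'a set" where
  "h_of P1 V = op12 P1 V ` ker2 P1 (op22 P1 V)"

text \<open>For \<open>T : K\<^sub>1 \<rightarrow> K\<^sub>2\<close> (extended by zero), \<open>P1 + T\<^sup>\<dagger>T\<close> and its square root vanish on \<open>K\<^sub>2\<close> and are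
  invertible on \<open>K\<^sub>1\<close>, and \<open>gen_inv\<close> is their inverse on \<open>K\<^sub>1\<close>; similarly on \<open>K\<^sub>2\<close>.\<close>

definition proj_T :: "'a::complex_hilbert_space op \<Rightarrow> 'a op \<Rightarrow> 'a op" where
  "proj_T P1 T = (P1 + T) \<cdot> gen_inv (P1 + T\<^sup>\<dagger> \<cdot> T) \<cdot> (P1 + T\<^sup>\<dagger>)"

definition unitary_T :: "'a::complex_hilbert_space op \<Rightarrow> 'a op \<Rightarrow> 'a op" where
  "unitary_T P1 T =
     (P1 + T) \<cdot> gen_inv (op_sqrt (P1 + T\<^sup>\<dagger> \<cdot> T))
     + (compl_proj P1 - T\<^sup>\<dagger>) \<cdot> gen_inv (op_sqrt (compl_proj P1 + T \<cdot> T\<^sup>\<dagger>))"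

text \<open>\<open>E\<close> is the chosen orthonormal basis of the finite-dimensional subspace.\<close>

definition u_of :: "('a::complex_hilbert_space \<Rightarrow> 'a) \<Rightarrow> 'a set \<Rightarrow> 'a op" where
  "u_of J E = (\<Sum>e\<in>E. Blinfun (\<lambda>f. cinner e f *\<^sub>C J e))"

definition unitary_h :: "('a::complex_hilbert_space \<Rightarrow> 'a) \<Rightarrow> 'a set \<Rightarrow> 'a set \<Rightarrow> 'a op" where
  "unitary_h J H E = id_blinfun
     - op_matrix (proj_on H) (op_conj J (u_of J E))
                 (u_of J E)  (op_conj J (proj_on H))"

definition P_of :: "('a::complex_hilbert_space \<Rightarrow> 'a) \<Rightarrow> 'a op \<Rightarrow> 'a op \<Rightarrow> 'a op" where
  "P_of J P1 V =
     proj_T P1 (T_of P1 V) - proj_on (h_of P1 V) + op_conj J (proj_on (h_of P1 V))"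

definition U_of :: "('a::complex_hilbert_space \<Rightarrow> 'a) \<Rightarrow> 'a op \<Rightarrow> 'a set \<Rightarrow> 'a op \<Rightarrow> 'a op" where
  "U_of J P1 E V = unitary_T P1 (T_of P1 V) \<cdot> unitary_h J (h_of P1 V) E"

definition W_of :: "('a::complex_hilbert_space \<Rightarrow> 'a) \<Rightarrow> 'a op \<Rightarrow> 'a set \<Rightarrow> 'a op \<Rightarrow> 'a op" where
  "W_of J P1 E V = (U_of J P1 E V)\<^sup>\<dagger> \<cdot> V"

end

theory Submission
  imports Defs
begin

text \<open>
  Write \<open>P\<close> for the fixed basis projection, \<open>Q = 1 - P\<close>, and \<open>a, b, c, d\<close> for the components
  \<open>V\<^sub>1\<^sub>1, V\<^sub>1\<^sub>2, V\<^sub>2\<^sub>1, V\<^sub>2\<^sub>2\<close> of \<open>V\<close>.  All statements concern one geometric fact: a basis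
  projection close to \<open>P\<close> is a graph up to a finite-dimensional defect.  If \<open>R\<close> is a basis
  projection with \<open>P - R\<close> Hilbert-Schmidt and \<open>h = ker R\<^sub>1\<^sub>1\<close>, then the range of \<open>R\<close> consists of the
  vectors \<open>f + S f\<close> with \<open>f \<in> K\<^sub>1\<close> orthogonal to \<open>h\<close>, together with \<open>h\<^sup>*\<close>; here
  \<open>S = R\<^sub>2\<^sub>1 R\<^sub>1\<^sub>1\<^sup>-\<^sup>1\<close>, and \<open>S\<close> is antisymmetric because the range of \<open>R\<close> is orthogonal to its conjugate.

  The condition \<open>V\<^sup>* R V = P\<close> is equivalent to \<open>R V = V P\<close> (\<open>intertwining\<close>): the range of \<open>R\<close>
  contains the vectors \<open>V f = a f + c f\<close>, \<open>f \<in> K\<^sub>1\<close>.  For \<open>f \<in> ker a\<close> these lie in \<open>K\<^sub>2\<close>; they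
  form the conjugate of \<open>h\<^sub>V\<close>, so \<open>h\<^sub>V\<close> is contained in \<open>ker R\<^sub>1\<^sub>1\<close>.  If this kernel is not larger,
  the remaining vectors say that \<open>S (a f) = c f\<close> for \<open>f\<close> orthogonal to \<open>ker a\<close>.  So \<open>S\<close> is prescribed
  on \<open>ran a\<close>, and antisymmetry leaves only the block of \<open>S\<close> from \<open>ker a\<^sup>*\<close> to its conjugate free.
  \<open>T\<^sub>V\<close> is the choice of \<open>S\<close> in which this block is zero, and any other choice adds an orthogonal
  term, which is the minimality of the Hilbert-Schmidt norm (\<open>hs_norm_minimal\<close>).  That \<open>P\<^sub>V\<close> solves
  the equation is \<open>graph_proj_V\<close>.

  For the unitaries put \<open>Z = 1 + T\<^sup>*T + TT\<^sup>*\<close> and \<open>G = 1 + T - T\<^sup>*\<close>.  As \<open>T\<^sup>2 = 0\<close>, both \<open>G G\<^sup>*\<close> and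
  \<open>G\<^sup>* G\<close> are \<open>Z\<close>, and \<open>Z\<close> commutes with \<open>T\<close> and \<open>P\<close>; so \<open>U\<^sub>T = Z\<^sup>-\<^sup>1\<^sup>/\<^sup>2 G\<close> is unitary, and
  this single square root replaces the two square roots on \<open>K\<^sub>1\<close> and \<open>K\<^sub>2\<close>.  The factor \<open>U\<^sub>h\<close>
  exchanges \<open>h\<close> and its conjugate, whence \<open>U\<^sub>V P U\<^sub>V\<^sup>* = P\<^sub>V\<close> (\<open>graph_U_conj_P\<close>).  Together with
  \<open>P\<^sub>V V = V P\<close> this shows that \<open>W\<^sub>V = U\<^sub>V\<^sup>* V\<close> commutes with \<open>P\<close>.  If \<open>M\<^sub>V = 0\<close>, then
  \<open>V\<close> is unitary and \<open>P\<^sub>V = V P V\<^sup>*\<close>; the components of this identity are \<open>a a\<^sup>* = Z\<^sup>-\<^sup>1 P - p\<close> and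
  \<open>c a\<^sup>* = Z\<^sup>-\<^sup>1 T\<close>, with \<open>p\<close> the projection onto \<open>h\<^sub>V\<close>, and they determine the polar
  decompositions: \<open>|a\<^sup>*| = Z\<^sup>-\<^sup>1\<^sup>/\<^sup>2 P - p\<close> and \<open>v\<^sub>1\<^sub>1 = Z\<^sup>1\<^sup>/\<^sup>2 a\<close>.

  The analysis below this algebra consists of four facts about bounded operators: existence of
  adjoints and of generalised inverses, both from a variational problem on a closed subspace
  (\<open>weak_solution_on_closed_subspace\<close>); existence and uniqueness of positive square roots; closed
  range of an operator that is bounded below up to a Hilbert-Schmidt operator
  (\<open>moore_penrose_exists_mod_hilbert_schmidt\<close>), which provides \<open>a\<^sup>-\<^sup>1\<close> and \<open>R\<^sub>1\<^sub>1\<^sup>-\<^sup>1\<close>; and the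
  independence of Hilbert-Schmidt sums of the basis (\<open>has_sum_norm_sq_adj\<close>).
\<close>

section \<open>Complex inner products\<close>

instance complex_hilbert_space \<subseteq> banach ..

lemma cinner_add_left: "cinner (x + y) z = cinner x z + cinner y z"
  by (metis cinner_add_right cinner_commute complex_cnj_add)

lemma cinner_scaleC_left [simp]: "cinner (c *\<^sub>C x) y = cnj c * cinner x y"
  by (metis cinner_commute cinner_scaleC_right complex_cnj_mult)

declare cinner_scaleC_right [simp]

lemma cinner_scaleR_right [simp]: "cinner x (r *\<^sub>R y) = of_real r * cinner x y"
  by (metis cinner_scaleC_right scaleC_of_real)

lemma cinner_scaleR_left [simp]: "cinner (r *\<^sub>R x) y = of_real r * cinner x y"
  by (metis cinner_scaleC_left complex_cnj_complex_of_real scaleC_of_real)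

lemma cinner_zero_right [simp]: "cinner x 0 = 0"
  using cinner_add_right[of x 0 0] by simp

lemma cinner_zero_left [simp]: "cinner 0 x = 0"
  using cinner_add_left[of 0 0 x] by simp

lemma cinner_minus_right [simp]: "cinner x (- y) = - cinner x y"
  using cinner_scaleR_right[of x "-1" y] by simp

lemma cinner_minus_left [simp]: "cinner (- x) y = - cinner x y"
  using cinner_scaleR_left[of "-1" x y] by simp

lemma cinner_diff_right: "cinner x (y - z) = cinner x y - cinner x z"
  using cinner_add_right[of x y "- z"] by simp

lemma cinner_diff_left: "cinner (x - y) z = cinner x z - cinner y z"
  using cinner_add_left[of x "- y" z] by simp

lemma cinner_sum_right: "cinner x (\<Sum>i\<in>I. f i) = (\<Sum>i\<in>I. cinner x (f i))"
  by (induction I rule: infinite_finite_induct) (simp_all add: cinner_add_right)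

lemma cinner_sum_left: "cinner (\<Sum>i\<in>I. f i) x = (\<Sum>i\<in>I. cinner (f i) x)"
  by (induction I rule: infinite_finite_induct) (simp_all add: cinner_add_left)

lemma cinner_self: "cinner x x = complex_of_real ((norm x)\<^sup>2)"
proof (rule complex_eqI)
  show "Re (cinner x x) = Re (complex_of_real ((norm x)\<^sup>2))"
    by (metis Re_complex_of_real inner_eq_Re_cinner power2_norm_eq_inner)
  show "Im (cinner x x) = Im (complex_of_real ((norm x)\<^sup>2))"
    using cinner_commute[of x x] by (metis Im_complex_of_real Reals_cnj_iff complex_is_Real_iff)
qed

lemma cinner_self_eq_0 [simp]: "cinner x x = 0 \<longleftrightarrow> x = 0"
  by (simp add: cinner_self)

lemma norm_scaleC [simp]: "norm (c *\<^sub>C x) = cmod c * norm x"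
proof -
  have "complex_of_real ((norm (c *\<^sub>C x))\<^sup>2) = (c * cnj c) * cinner x x"
    unfolding cinner_self[symmetric] by simp
  also have "\<dots> = of_real ((cmod c * norm x)\<^sup>2)"
    by (simp only: cinner_self complex_norm_square[symmetric] power_mult_distrib of_real_mult)
  finally have "complex_of_real ((norm (c *\<^sub>C x))\<^sup>2) = of_real ((cmod c * norm x)\<^sup>2)" .
  then have "(norm (c *\<^sub>C x))\<^sup>2 = (cmod c * norm x)\<^sup>2"
    using of_real_eq_iff by blast
  then show ?thesis by (simp add: power2_eq_iff_nonneg)
qed

text \<open>The real part of a complex-linear functional determines the functional; this transfers
  statements about the real inner product to the complex one.\<close>

lemma cinner_eq_of_Re:
  assumes "\<And>c. Re (cinner x (c *\<^sub>C y)) = Re (cinner u (c *\<^sub>C v))"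
  shows "cinner x y = cinner u v"
proof (rule complex_eqI)
  show "Re (cinner x y) = Re (cinner u v)"
    using assms[of 1] by simp
  show "Im (cinner x y) = Im (cinner u v)"
    using assms[of "\<i>"] by simp
qed

lemma cinner_ext:
  assumes "\<And>z. cinner x z = cinner y z"
  shows "x = y"
proof -
  have "cinner (x - y) (x - y) = 0"
    using assms by (simp add: cinner_diff_left)
  then show ?thesis by simp
qed

lemma Cauchy_Schwarz_cinner: "cmod (cinner x y) \<le> norm x * norm y"
proof (cases "cinner x y = 0")
  case False
  define c where "c = cnj (cinner x y) / cmod (cinner x y)"
  have "cmod (cinner x y) = Re (c * cinner x y)"
    using False unfolding c_def
    by (simp add: complex_norm_square[symmetric] mult.commute power2_eq_square flip: of_real_mult)
  also have "\<dots> = x \<bullet> (c *\<^sub>C y)"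
    by (simp add: inner_eq_Re_cinner)
  also have "\<dots> \<le> norm x * norm (c *\<^sub>C y)"
    by (rule norm_cauchy_schwarz)
  also have "cmod c = 1"
    using False by (simp add: c_def norm_divide)
  ultimately show ?thesis by simp
qed simp

lemma bounded_linear_cinner_right: "bounded_linear (cinner x)"
  by (rule bounded_linear_intro[where K="norm x"])
    (simp_all add: cinner_add_right scaleR_conv_of_real, metis Cauchy_Schwarz_cinner mult.commute)

lemmas tendsto_cinner_right = bounded_linear.tendsto[OF bounded_linear_cinner_right]

lemma norm_add_sq_orthogonal:
  fixes x y :: "'a::complex_hilbert_space"
  assumes "cinner x y = 0"
  shows "(norm (x + y))\<^sup>2 = (norm x)\<^sup>2 + (norm y)\<^sup>2"
proof -
  have "cinner y x = 0" using assms cinner_commute[of y x] by simp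
  then have "complex_of_real ((norm (x + y))\<^sup>2) = of_real ((norm x)\<^sup>2 + (norm y)\<^sup>2)"
    using assms by (simp add: cinner_add_left cinner_add_right flip: cinner_self of_real_power)
  then show ?thesis using of_real_eq_iff by blast
qed

section \<open>Weak equations on closed subspaces\<close>

text \<open>The first variation vanishes at a minimum of a quadratic functional.\<close>

lemma linear_coefficient_eq_0:
  fixes A B :: real
  assumes "\<And>t. 0 \<le> t\<^sup>2 * A + 2 * t * B" and "0 \<le> A"
  shows "B = 0"
proof (cases "A = 0")
  case True
  then show ?thesis using assms(1)[of "- B"] by (auto simp: mult_le_0_iff)
next
  case False
  have "0 \<le> (B/A)\<^sup>2 * A - 2 * (B/A) * B" using assms(1)[of "- (B / A)"] by simp
  also have "\<dots> = - (B\<^sup>2 / A)" using False by (simp add: power2_eq_square field_simps)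
  finally have "B\<^sup>2 / A \<le> 0" by simp
  then have "B\<^sup>2 \<le> 0" using False assms(2) by (simp add: divide_le_0_iff)
  then show ?thesis by simp
qed

text \<open>The quadratic functional \<open>\<parallel>A s\<parallel>\<^sup>2 - 2 \<phi> s\<close> is bounded below on \<open>S\<close>, and by the parallelogram
  identity its minimising sequences are Cauchy; the equation is the vanishing of the first
  variation at the minimum.  With \<open>A\<close> the identity this gives the Riesz representation (\<open>S\<close> the
  whole space) and the orthogonal projection onto \<open>S\<close> (\<open>\<phi> = x \<bullet> _\<close>); for general \<open>A\<close> it gives least
  squares solutions, hence generalised inverses.\<close>

lemma weak_solution_on_closed_subspace:
  fixes A :: "'a::{real_inner,complete_space} \<Rightarrow>\<^sub>L 'b::real_inner" and \<phi> :: "'a \<Rightarrow> real"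
  assumes S: "closed S" "subspace S" and "c > 0" and below: "\<And>s. s \<in> S \<Longrightarrow> c * norm s \<le> norm (A s)"
    and \<phi>: "bounded_linear \<phi>"
  shows "\<exists>x\<in>S. \<forall>s\<in>S. A x \<bullet> A s = \<phi> s"
proof -
  define Q where "Q s = (norm (A s))\<^sup>2 - 2 * \<phi> s" for s
  obtain K where K: "\<And>s. \<bar>\<phi> s\<bar> \<le> norm s * K" "K > 0"
    using bounded_linear.pos_bounded[OF \<phi>] by (auto simp: real_norm_def)
  interpret \<phi>: bounded_linear \<phi> by fact
  have Q_below: "- (K / c)\<^sup>2 \<le> Q s" if "s \<in> S" for s
  proof -
    have "\<phi> s \<le> norm s * K" using K(1)[of s] by simp
    then have "\<phi> s \<le> (K / c) * (c * norm s)" using \<open>c > 0\<close> by (simp add: field_simps)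
    also have "\<dots> \<le> (K / c) * norm (A s)"
      using below[OF that] K \<open>c > 0\<close> by (intro mult_left_mono) auto
    finally have "2 * \<phi> s \<le> 2 * (K / c) * norm (A s)" by simp
    also have "\<dots> \<le> (norm (A s))\<^sup>2 + (K / c)\<^sup>2"
      using sum_squares_bound[of "K / c" "norm (A s)"] by linarith
    finally show ?thesis by (simp add: Q_def)
  qed
  have bdd: "bdd_below (Q ` S)" using Q_below by (auto intro!: bdd_belowI2)
  define m where "m = Inf (Q ` S)"
  have "S \<noteq> {}" using S(2) subspace_0 by blast
  have m: "m \<le> Q s" if "s \<in> S" for s
    unfolding m_def using that bdd by (intro cInf_lower) auto
  have "\<exists>s\<in>S. Q s < m + 1 / Suc n" for n
    using cInf_lessD[of "Q ` S" "m + 1 / Suc n"] \<open>S \<noteq> {}\<close> unfolding m_def by auto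
  then obtain x where x: "\<And>n. x n \<in> S" "\<And>n. Q (x n) < m + 1 / Suc n" by metis
  have parallelogram: "(norm (A (s - t)))\<^sup>2 = 2 * Q s + 2 * Q t - 4 * Q ((1/2) *\<^sub>R (s + t))" for s t
    unfolding Q_def power2_norm_eq_inner
    by (simp add: blinfun.bilinear_simps \<phi>.add \<phi>.scaleR algebra_simps inner_commute)
  \<comment> \<open>Both values are close to the infimum, and the value at the midpoint is not below it.\<close>
  have close: "(c * norm (x i - x j))\<^sup>2 \<le> 2 / Suc i + 2 / Suc j" for i j
  proof -
    have mem: "x i - x j \<in> S" "(1/2) *\<^sub>R (x i + x j) \<in> S"
      using S(2) x(1) by (auto intro!: subspace_diff subspace_scale subspace_add)
    have "(c * norm (x i - x j))\<^sup>2 \<le> (norm (A (x i - x j)))\<^sup>2"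
      using below[OF mem(1)] \<open>c > 0\<close> by (intro power_mono) auto
    also have "\<dots> \<le> 2 / Suc i + 2 / Suc j"
      unfolding parallelogram using x(2)[of i] x(2)[of j] m[OF mem(2)] by simp
    finally show ?thesis .
  qed
  have "Cauchy x"
  proof (rule metric_CauchyI)
    fix e :: real assume "e > 0"
    then have "(c * e)\<^sup>2 > 0" using \<open>c > 0\<close> by simp
    then obtain N where N: "4 / (c * e)\<^sup>2 < real N" using reals_Archimedean2 by blast
    have N': "4 < real N * (c * e)\<^sup>2" using N \<open>(c * e)\<^sup>2 > 0\<close> by (simp add: pos_divide_less_eq)
    show "\<exists>M. \<forall>i\<ge>M. \<forall>j\<ge>M. dist (x i) (x j) < e"
    proof (intro exI allI impI)
      fix i j assume "N \<le> i" "N \<le> j"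
      have tail: "2 / real (Suc k) < (c * e)\<^sup>2 / 2" if "N \<le> k" for k
      proof -
        have "4 < real (Suc k) * (c * e)\<^sup>2"
          using N' that \<open>(c * e)\<^sup>2 > 0\<close>
          by (smt (verit) mult_right_mono of_nat_mono le_SucI)
        then show ?thesis by (simp add: field_simps del: of_nat_Suc)
      qed
      have "(c * norm (x i - x j))\<^sup>2 < (c * e)\<^sup>2"
        using close[of i j] tail[OF \<open>N \<le> i\<close>] tail[OF \<open>N \<le> j\<close>] by linarith
      then have "c * norm (x i - x j) < c * e"
        by (rule power2_less_imp_less) (use \<open>c > 0\<close> \<open>e > 0\<close> in simp)
      then show "dist (x i) (x j) < e" using \<open>c > 0\<close> by (simp add: dist_norm)
    qed
  qed
  then obtain y where y: "x \<longlonglongrightarrow> y" using Cauchy_convergent_iff convergent_def by blast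
  have "y \<in> S" using closed_sequentially[OF S(1)] x(1) y by blast
  have "(\<lambda>n. Q (x n)) \<longlonglongrightarrow> Q y"
    unfolding Q_def by (intro tendsto_intros y \<phi>.tendsto)
  moreover have "(\<lambda>n. m + 1 / real (Suc n)) \<longlonglongrightarrow> m + 0"
    by (intro tendsto_intros LIMSEQ_Suc[OF lim_1_over_n])
  ultimately have "Q y \<le> m + 0"
    by (rule LIMSEQ_le) (use x(2) less_imp_le in blast)
  have "A y \<bullet> A s = \<phi> s" if "s \<in> S" for s
  proof -
    have "0 \<le> t\<^sup>2 * (norm (A s))\<^sup>2 + 2 * t * (A y \<bullet> A s - \<phi> s)" for t
    proof -
      have "y + t *\<^sub>R s \<in> S" using S(2) \<open>y \<in> S\<close> that by (intro subspace_add subspace_scale)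
      then have "Q y \<le> Q (y + t *\<^sub>R s)" using m \<open>Q y \<le> m + 0\<close> by fastforce
      then show ?thesis unfolding Q_def power2_norm_eq_inner
        by (simp add: blinfun.bilinear_simps \<phi>.add \<phi>.scaleR algebra_simps inner_commute power2_eq_square)
    qed
    then show ?thesis using linear_coefficient_eq_0[of "(norm (A s))\<^sup>2" "A y \<bullet> A s - \<phi> s"] by simp
  qed
  then show ?thesis using \<open>y \<in> S\<close> by blast
qed

section \<open>Adjoints\<close>

lemma clinear_opD: "clinear_op A \<Longrightarrow> A (c *\<^sub>C x) = c *\<^sub>C A x"
  by (simp add: clinear_op_def)

lemma clinear_op_zero [simp]: "clinear_op 0"
  and clinear_op_id [simp]: "clinear_op id_blinfun"
  by (simp_all add: clinear_op_def)

lemma clinear_op_add [simp]: "clinear_op A \<Longrightarrow> clinear_op B \<Longrightarrow> clinear_op (A + B)"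
  and clinear_op_diff [simp]: "clinear_op A \<Longrightarrow> clinear_op B \<Longrightarrow> clinear_op (A - B)"
  and clinear_op_minus [simp]: "clinear_op A \<Longrightarrow> clinear_op (- A)"
  and clinear_op_scaleR [simp]: "clinear_op A \<Longrightarrow> clinear_op (r *\<^sub>R A)"
  and clinear_op_comp [simp]: "clinear_op A \<Longrightarrow> clinear_op B \<Longrightarrow> clinear_op (A \<cdot> B)"
  by (simp_all add: clinear_op_def blinfun.bilinear_simps scaleC_add_right
      complex_vector.scale_right_diff_distrib complex_vector.scale_minus_right
      scaleC_scaleC mult.commute flip: scaleC_of_real)

lemma adjI:
  fixes A B :: "'a::complex_hilbert_space op"
  assumes "\<And>x y. cinner (B x) y = cinner x (A y)"
  shows "A\<^sup>\<dagger> = B"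
  unfolding adj_def
proof (rule the_equality)
  fix C :: "'a op" assume "\<forall>x y. cinner (C x) y = cinner x (A y)"
  then show "C = B" using assms by (intro blinfun_eqI cinner_ext) metis
qed (use assms in simp)

lemma adjoint_exists:
  fixes A :: "'a::complex_hilbert_space op"
  assumes "clinear_op A"
  shows "\<exists>B :: 'a op. \<forall>x y. cinner (B x) y = cinner x (A y)"
proof -
  have "\<exists>z. \<forall>y. cinner z y = cinner x (A y)" for x
  proof -
    have "bounded_linear (\<lambda>y. x \<bullet> A y)"
      by (rule bounded_linear_compose[OF bounded_linear_inner_right blinfun.bounded_linear_right])
    then obtain z where z: "\<And>y. z \<bullet> y = x \<bullet> A y"
      using weak_solution_on_closed_subspace[of UNIV 1 id_blinfun "\<lambda>y. x \<bullet> A y"] by auto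
    have "cinner z y = cinner x (A y)" for y
    proof (rule cinner_eq_of_Re)
      show "Re (cinner z (c *\<^sub>C y)) = Re (cinner x (c *\<^sub>C A y))" for c
        using z[of "c *\<^sub>C y"] by (simp only: inner_eq_Re_cinner clinear_opD[OF assms])
    qed
    then show ?thesis by blast
  qed
  then obtain B where B: "\<And>x y. cinner (B x) y = cinner x (A y)" by metis
  have "bounded_linear B"
  proof (rule bounded_linear_intro[where K="norm A"])
    show "B (x + y) = B x + B y" for x y
      by (rule cinner_ext) (simp add: B cinner_add_left)
    show "B (r *\<^sub>R x) = r *\<^sub>R B x" for r x
      by (rule cinner_ext) (simp add: B)
    show "norm (B x) \<le> norm x * norm A" for x
    proof (cases "B x = 0")
      case False
      have "norm (B x) * norm (B x) = cmod (cinner (B x) (B x))"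
        by (simp add: cinner_self power2_eq_square norm_mult)
      also have "\<dots> \<le> norm x * norm (A (B x))"
        unfolding B by (rule Cauchy_Schwarz_cinner)
      also have "\<dots> \<le> norm x * (norm A * norm (B x))"
        by (intro mult_left_mono norm_blinfun) auto
      finally have "norm (B x) * norm (B x) \<le> (norm x * norm A) * norm (B x)" by (simp add: mult.assoc)
      then show ?thesis using False by (simp add: mult_le_cancel_right)
    qed simp
  qed
  then show ?thesis using B by (intro exI[of _ "Blinfun B"]) (simp add: bounded_linear_Blinfun_apply)
qed

lemma cinner_adj_left: "clinear_op A \<Longrightarrow> cinner (A\<^sup>\<dagger> x) y = cinner x (A y)"
  using adjoint_exists adjI by metis

lemma cinner_adj_right: "clinear_op A \<Longrightarrow> cinner x (A\<^sup>\<dagger> y) = cinner (A x) y"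
  by (metis cinner_adj_left cinner_commute)

lemma clinear_op_adj [simp]: "clinear_op A \<Longrightarrow> clinear_op (A\<^sup>\<dagger>)"
  unfolding clinear_op_def[of "A\<^sup>\<dagger>"] by (intro allI cinner_ext) (simp add: cinner_adj_left)

lemma adj_adj [simp]: "clinear_op A \<Longrightarrow> A\<^sup>\<dagger>\<^sup>\<dagger> = A"
  by (rule adjI) (simp add: cinner_adj_right)

lemma adj_zero [simp]: "(0 :: 'a::complex_hilbert_space op)\<^sup>\<dagger> = 0"
  and adj_id [simp]: "(id_blinfun :: 'a::complex_hilbert_space op)\<^sup>\<dagger> = id_blinfun"
  by (rule adjI; simp)+

lemma adj_add [simp]: "clinear_op A \<Longrightarrow> clinear_op B \<Longrightarrow> (A + B)\<^sup>\<dagger> = A\<^sup>\<dagger> + B\<^sup>\<dagger>"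
  and adj_diff [simp]: "clinear_op A \<Longrightarrow> clinear_op B \<Longrightarrow> (A - B)\<^sup>\<dagger> = A\<^sup>\<dagger> - B\<^sup>\<dagger>"
  and adj_minus [simp]: "clinear_op A \<Longrightarrow> (- A)\<^sup>\<dagger> = - A\<^sup>\<dagger>"
  and adj_scaleR [simp]: "clinear_op A \<Longrightarrow> (r *\<^sub>R A)\<^sup>\<dagger> = r *\<^sub>R A\<^sup>\<dagger>"
  and adj_comp [simp]: "clinear_op A \<Longrightarrow> clinear_op B \<Longrightarrow> (A \<cdot> B)\<^sup>\<dagger> = B\<^sup>\<dagger> \<cdot> A\<^sup>\<dagger>"
  by (rule adjI; simp add: cinner_adj_left cinner_adj_right blinfun.bilinear_simps cinner_add_left cinner_add_right
      cinner_diff_left cinner_diff_right)+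

lemma norm_sq_adj_comp: "clinear_op A \<Longrightarrow> complex_of_real ((norm (A x))\<^sup>2) = cinner x ((A\<^sup>\<dagger> \<cdot> A) x)"
  by (simp add: cinner_adj_right cinner_self)

lemma adj_comp_self_eq_0_iff:
  assumes "clinear_op A"
  shows "A\<^sup>\<dagger> \<cdot> A = 0 \<longleftrightarrow> A = 0"
proof
  assume "A\<^sup>\<dagger> \<cdot> A = 0"
  then have "A x = 0" for x
    using norm_sq_adj_comp[OF assms, of x] by simp
  then show "A = 0" by (intro blinfun_eqI) simp
qed simp

section \<open>Operator algebra\<close>

interpretation op_comp: bounded_bilinear
  "blinfun_compose :: 'b::real_normed_vector \<Rightarrow>\<^sub>L 'c::real_normed_vector \<Rightarrow> 'a::real_normed_vector \<Rightarrow>\<^sub>L 'b \<Rightarrow> 'a \<Rightarrow>\<^sub>L 'c"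
  by (rule bounded_bilinear_blinfun_compose)

lemmas op_simps =
  op_comp.add_left op_comp.add_right
  op_comp.diff_left op_comp.diff_right
  op_comp.minus_left op_comp.minus_right
  op_comp.scaleR_left op_comp.scaleR_right

lemmas op_apply = blinfun_apply_blinfun_compose

lemma comp_assoc: "A \<cdot> B \<cdot> C = A \<cdot> (B \<cdot> C)"
  by (rule blinfun_eqI) simp

lemma id_comp [simp]: "id_blinfun \<cdot> A = A" "A \<cdot> id_blinfun = A"
  by (rule blinfun_eqI; simp)+

text \<open>In normal forms of operator products, composition is associated to the right.  A rule for a
  product \<open>A \<cdot> B\<close> then has to be applied also in front of a further factor; this lemma yields the
  second form, so that lists of such rules act as a rewrite system for the operator algebra.\<close>

lemma comp_extend: "A \<cdot> B = C \<Longrightarrow> A \<cdot> (B \<cdot> X) = C \<cdot> X"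
  by (metis comp_assoc)

lemma range_eq_of_factors:
  assumes "A = B \<cdot> C" "B = A \<cdot> D"
  shows "range A = range B"
proof (intro equalityI subsetI)
  fix f assume "f \<in> range A"
  then obtain g where "f = A g" by blast
  also have "A g = B (C g)" by (subst assms(1)) simp
  finally show "f \<in> range B" by simp
next
  fix f assume "f \<in> range B"
  then obtain g where "f = B g" by blast
  also have "B g = A (D g)" by (subst assms(2)) simp
  finally show "f \<in> range A" by simp
qed

section \<open>Positive operators and square roots\<close>

lemma positive_opI:
  assumes "clinear_op A" "A\<^sup>\<dagger> = A" "\<And>x. 0 \<le> Re (cinner x (A x))"
  shows "positive_op A"
proof -
  have "cnj (cinner x (A x)) = cinner x (A x)" for x
    using cinner_adj_left[OF assms(1), of x x] assms(2) cinner_commute[of "A x" x] by simp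
  then have "Im (cinner x (A x)) = 0" for x
    by (metis Reals_cnj_iff complex_is_Real_iff)
  then show ?thesis using assms by (simp add: positive_op_def complex_nonneg_Reals_iff)
qed

lemma positive_op_clinear: "positive_op A \<Longrightarrow> clinear_op A"
  by (simp add: positive_op_def)

lemma positive_op_Re: "positive_op A \<Longrightarrow> 0 \<le> Re (cinner x (A x))"
  by (simp add: positive_op_def complex_nonneg_Reals_iff)

text \<open>The form \<open>\<langle>x, A y\<rangle> - \<langle>A x, y\<rangle>\<close> vanishes on the diagonal, hence everywhere by complex
  polarisation.\<close>

lemma positive_op_self_adjoint:
  assumes "positive_op A"
  shows "A\<^sup>\<dagger> = A"
proof (rule adjI)
  fix x y
  have A: "clinear_op A" using assms by (rule positive_op_clinear)
  define d where "d x y = cinner x (A y) - cinner (A x) y" for x y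
  have diag: "d x x = 0" for x
  proof -
    have "Im (cinner x (A x)) = 0"
      using assms by (simp add: positive_op_def complex_nonneg_Reals_iff)
    then have "cnj (cinner x (A x)) = cinner x (A x)"
      using Reals_cnj_iff complex_is_Real_iff by blast
    then show ?thesis using cinner_commute[of "A x" x] by (simp add: d_def)
  qed
  have "d (x + y) (x + y) = d x x + d y y + d x y + d y x" for x y
    by (simp add: d_def blinfun.bilinear_simps cinner_add_left cinner_add_right)
  then have antisym: "d x y + d y x = 0" for x y using diag by simp
  have "d (\<i> *\<^sub>C x) y = - \<i> * d x y" "d y (\<i> *\<^sub>C x) = \<i> * d y x"
    by (simp_all add: d_def clinear_opD[OF A] algebra_simps)
  then have "- \<i> * d x y + \<i> * d y x = 0"
    using antisym[of "\<i> *\<^sub>C x" y] by simp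
  then have "\<i> * (d y x - d x y) = 0" by (simp add: algebra_simps)
  then have "d y x = d x y" by simp
  then have "d x y = 0" using antisym[of x y] by simp
  then show "cinner (A x) y = cinner x (A y)" by (simp add: d_def)
qed

lemma positive_op_sandwich:
  assumes "positive_op A" "clinear_op B"
  shows "positive_op (B\<^sup>\<dagger> \<cdot> A \<cdot> B)"
  using assms unfolding positive_op_def by (auto simp: cinner_adj_right)

lemma positive_op_id [simp]: "positive_op id_blinfun"
  by (rule positive_opI) (simp_all add: cinner_self)

lemma positive_op_gram: "clinear_op B \<Longrightarrow> positive_op (B\<^sup>\<dagger> \<cdot> B)"
  using positive_op_sandwich[OF positive_op_id] by simp

lemma positive_op_add [simp]: "positive_op A \<Longrightarrow> positive_op B \<Longrightarrow> positive_op (A + B)"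
  unfolding positive_op_def by (auto simp: blinfun.bilinear_simps cinner_add_right)

lemma positive_op_scaleR: "positive_op A \<Longrightarrow> 0 \<le> r \<Longrightarrow> positive_op (r *\<^sub>R A)"
  unfolding positive_op_def by (auto simp: blinfun.bilinear_simps)

lemma Re_cinner_le:
  fixes A :: "'a::complex_hilbert_space op"
  shows "Re (cinner x (A x)) \<le> norm A * (norm x)\<^sup>2"
proof -
  have "Re (cinner x (A x)) \<le> norm x * norm (A x)"
    using Cauchy_Schwarz_cinner[of x "A x"] complex_Re_le_cmod order_trans by blast
  also have "\<dots> \<le> norm x * (norm A * norm x)" by (intro mult_left_mono norm_blinfun) auto
  finally show ?thesis by (simp add: power2_eq_square algebra_simps)
qed

text \<open>For \<open>0 \<le> B \<le> 1\<close> the difference \<open>B - B\<^sup>2 = B (1 - B) B + (1 - B) B (1 - B)\<close> is a sum of positive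
  operators, so \<open>B\<^sup>2 \<le> B\<close>.\<close>

lemma norm_sq_le_of_contraction:
  assumes B: "positive_op B" and le1: "\<And>x. Re (cinner x (B x)) \<le> (norm x)\<^sup>2"
  shows "(norm (B x))\<^sup>2 \<le> Re (cinner x (B x))"
proof -
  have cl: "clinear_op B" and sa: "B\<^sup>\<dagger> = B"
    using B by (simp_all add: positive_op_clinear positive_op_self_adjoint)
  define D where "D = id_blinfun - B"
  have D: "positive_op D"
    unfolding D_def by (rule positive_opI) (simp_all add: cl sa blinfun.bilinear_simps cinner_diff_right cinner_self le1)
  have "B - B \<cdot> B = B\<^sup>\<dagger> \<cdot> D \<cdot> B + D\<^sup>\<dagger> \<cdot> B \<cdot> D"
    unfolding positive_op_self_adjoint[OF D] sa by (simp add: D_def op_simps comp_assoc)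
  then have "positive_op (B - B \<cdot> B)"
    using positive_op_sandwich[OF D cl] positive_op_sandwich[OF B] D
    by (simp add: positive_op_clinear)
  then have "0 \<le> Re (cinner x ((B - B \<cdot> B) x))" by (rule positive_op_Re)
  moreover have "cinner x (B (B x)) = (norm (B x))\<^sup>2"
    using cinner_adj_left[OF cl, of x "B x"] sa by (simp add: cinner_self)
  ultimately show ?thesis by (simp add: blinfun.bilinear_simps cinner_diff_right)
qed

lemma scaled_contraction:
  fixes A :: "'a::complex_hilbert_space op"
  shows "Re (cinner z (((1 / (norm A + 1)) *\<^sub>R A) z)) \<le> (norm z)\<^sup>2"
proof -
  have "norm A + 1 > 0" by (simp add: add_nonneg_pos)
  have "Re (cinner z (A z)) \<le> (norm A + 1) * (norm z)\<^sup>2"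
    using Re_cinner_le[of z A] by (simp add: algebra_simps add_increasing)
  then show ?thesis using \<open>norm A + 1 > 0\<close> by (simp add: blinfun.bilinear_simps field_simps)
qed

lemma norm_le_add_positive:
  assumes "positive_op B"
  shows "norm z \<le> norm (z + B z)"
proof (cases "z = 0")
  case False
  have "norm z * norm z \<le> Re (cinner z (z + B z))"
    using positive_op_Re[OF assms, of z]
    by (simp add: cinner_add_right cinner_self power2_eq_square flip: of_real_mult)
  also have "\<dots> \<le> norm z * norm (z + B z)"
    using Cauchy_Schwarz_cinner complex_Re_le_cmod order_trans by blast
  finally show ?thesis using False by (simp add: mult_le_cancel_left)
qed simp

lemma positive_op_null:
  assumes B: "positive_op B" and "Re (cinner x (B x)) = 0"
  shows "B x = 0"
proof -
  define K where "K = norm B + 1"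
  have "K > 0" by (simp add: K_def add_nonneg_pos)
  have "Re (cinner z (((1/K) *\<^sub>R B) z)) \<le> (norm z)\<^sup>2" for z
    unfolding K_def by (rule scaled_contraction)
  then have "(norm (((1/K) *\<^sub>R B) x))\<^sup>2 \<le> Re (cinner x (((1/K) *\<^sub>R B) x))"
    using norm_sq_le_of_contraction[of "(1/K) *\<^sub>R B" x] positive_op_scaleR[OF B] \<open>K > 0\<close> by simp
  also have "\<dots> = 0" using assms(2) by (simp add: blinfun.bilinear_simps)
  finally show ?thesis using \<open>K > 0\<close> by (simp add: blinfun.bilinear_simps)
qed

text \<open>With \<open>B = 1 - A\<close>, the iteration \<open>Y\<^sub>n\<^sub>+\<^sub>1 = (B + Y\<^sub>n\<^sup>2) / 2\<close> converges to a solution \<open>Z\<close> of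
  \<open>2 Z = B + Z\<^sup>2\<close>, that is \<open>(1 - Z)\<^sup>2 = A\<close>.  Convergence is in norm: since \<open>\<parallel>B\<parallel> \<le> 1\<close> and the \<open>Y\<^sub>n\<close>
  commute, their increments are bounded by those of the scalar iteration with \<open>B\<close> replaced by \<open>1\<close>,
  which increases and is bounded by \<open>1\<close>.  As a limit of polynomials in \<open>A\<close>, the root commutes with
  everything that commutes with \<open>A\<close>.\<close>

lemma sqrt_contraction_exists:
  fixes A :: "'a::complex_hilbert_space op"
  assumes A: "positive_op A" and le1: "\<And>x. Re (cinner x (A x)) \<le> (norm x)\<^sup>2"
  shows "\<exists>S. positive_op S \<and> S \<cdot> S = A \<and> (\<forall>C :: 'a op. C \<cdot> A = A \<cdot> C \<longrightarrow> C \<cdot> S = S \<cdot> C)"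
proof -
  define B where "B = id_blinfun - A"
  have cl: "clinear_op B" and sa: "B\<^sup>\<dagger> = B"
    using A by (simp_all add: B_def positive_op_clinear positive_op_self_adjoint)
  have B: "positive_op B"
    by (rule positive_opI[OF cl sa]) (simp add: B_def blinfun.bilinear_simps cinner_diff_right cinner_self le1)
  have nB: "norm B \<le> 1"
  proof (rule norm_blinfun_bound)
    fix x
    have le: "Re (cinner z (B z)) \<le> (norm z)\<^sup>2" for z
      using positive_op_Re[OF A, of z]
      by (simp add: B_def blinfun.bilinear_simps cinner_diff_right cinner_self)
    have "(norm (B x))\<^sup>2 \<le> (norm x)\<^sup>2"
      using norm_sq_le_of_contraction[OF B le, of x] le[of x] by linarith
    then show "norm (B x) \<le> 1 * norm x" by (simp add: power2_le_iff_abs_le)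
  qed simp
  define Y where "Y = rec_nat (0::'a op) (\<lambda>_ Z. (1/2) *\<^sub>R (B + Z \<cdot> Z))"
  define y where "y = rec_nat (0::real) (\<lambda>_ z. (1/2) * (1 + z * z))"
  have Y: "Y 0 = 0" "Y (Suc n) = (1/2) *\<^sub>R (B + Y n \<cdot> Y n)" for n by (simp_all add: Y_def)
  have y: "y 0 = 0" "y (Suc n) = (1/2) * (1 + y n * y n)" for n by (simp_all add: y_def)
  have comm: "C \<cdot> Y n = Y n \<cdot> C" if "C \<cdot> B = B \<cdot> C" for C n
  proof (induction n)
    case (Suc n)
    have "C \<cdot> (Y n \<cdot> Y n) = Y n \<cdot> Y n \<cdot> C"
      by (metis Suc comp_assoc)
    then show ?case by (simp add: Y op_simps that)
  qed (simp add: Y)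
  have YB: "Y n \<cdot> B = B \<cdot> Y n" for n using comm[of B n] by simp
  have YY: "Y m \<cdot> Y n = Y n \<cdot> Y m" for m n using comm[of "Y m" n] YB by simp
  have y01: "0 \<le> y n \<and> y n \<le> 1" for n
  proof (induction n)
    case (Suc n)
    then have "y n * y n \<le> 1" by (simp add: mult_le_one)
    then show ?case using Suc by (simp add: y)
  qed (simp add: y)
  have ymono: "y n \<le> y (Suc n)" for n
    using zero_le_power2[of "y n - 1"] by (simp add: y power2_eq_square algebra_simps)
  have nY: "norm (Y n) \<le> y n" for n
  proof (induction n)
    case (Suc n)
    have "norm (Y n \<cdot> Y n) \<le> norm (Y n) * norm (Y n)" by (rule norm_blinfun_compose)
    also have "\<dots> \<le> y n * y n" using Suc y01[of n] by (intro mult_mono) auto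
    finally have "norm (B + Y n \<cdot> Y n) \<le> 1 + y n * y n"
      using nB norm_triangle_ineq[of B "Y n \<cdot> Y n"] by linarith
    then show ?case by (simp add: Y y)
  qed (simp add: Y y)
  have step: "norm (Y (Suc n) - Y n) \<le> y (Suc n) - y n" for n
  proof (induction n)
    case 0
    show ?case using nB by (simp add: Y y)
  next
    case (Suc n)
    have eq: "Y (Suc (Suc n)) - Y (Suc n) = (1/2) *\<^sub>R ((Y (Suc n) - Y n) \<cdot> (Y (Suc n) + Y n))"
    proof -
      have "Y (Suc (Suc n)) - Y (Suc n) = (1/2) *\<^sub>R (Y (Suc n) \<cdot> Y (Suc n) - Y n \<cdot> Y n)"
        unfolding Y(2)[of "Suc n"] unfolding Y(2)[of n] by (simp add: scaleR_diff_right scaleR_add_right)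
      also have "Y (Suc n) \<cdot> Y (Suc n) - Y n \<cdot> Y n = (Y (Suc n) - Y n) \<cdot> (Y (Suc n) + Y n)"
        by (simp add: op_simps YY[of n "Suc n"])
      finally show ?thesis .
    qed
    have "norm ((Y (Suc n) - Y n) \<cdot> (Y (Suc n) + Y n))
          \<le> norm (Y (Suc n) - Y n) * norm (Y (Suc n) + Y n)" by (rule norm_blinfun_compose)
    also have "\<dots> \<le> (y (Suc n) - y n) * (y (Suc n) + y n)"
      using Suc nY[of n] nY[of "Suc n"] norm_triangle_ineq[of "Y (Suc n)" "Y n"] ymono[of n]
      by (intro mult_mono) auto
    also have "\<dots> = y (Suc n) * y (Suc n) - y n * y n" by (simp add: algebra_simps)
    also have "\<dots> = 2 * (y (Suc (Suc n)) - y (Suc n))"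
    proof -
      have "p - q = 2 * (a - b)" if "a = 1/2 * (1 + p)" "b = 1/2 * (1 + q)" for a b p q :: real
        using that by simp
      then show ?thesis using y(2) by blast
    qed
    finally show ?case unfolding eq by simp
  qed
  have gap: "norm (Y (n + k) - Y n) \<le> y (n + k) - y n" for n k
  proof (induction k)
    case (Suc k)
    have "norm (Y (n + Suc k) - Y n) \<le> norm (Y (n + Suc k) - Y (n + k)) + norm (Y (n + k) - Y n)"
      using norm_triangle_ineq[of "Y (n + Suc k) - Y (n + k)" "Y (n + k) - Y n"] by simp
    then show ?case using Suc step[of "n + k"] by simp
  qed simp
  have "convergent y"
  proof (rule Bseq_mono_convergent)
    show "Bseq y" by (rule BseqI'[where K=1]) (use y01 in simp)
    show "\<forall>m. \<forall>n\<ge>m. y m \<le> y n" using lift_Suc_mono_le[of y] ymono by blast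
  qed
  then have "Cauchy y" by (rule convergent_Cauchy)
  have "Cauchy Y"
  proof (rule CauchyI')
    fix e :: real assume "e > 0"
    then obtain M where M: "\<And>m n. m \<ge> M \<Longrightarrow> n \<ge> M \<Longrightarrow> norm (y m - y n) < e"
      using CauchyD[OF \<open>Cauchy y\<close>] by blast
    have "dist (Y m) (Y n) < e" if "m \<ge> M" "n > m" for m n
      using gap[of m "n - m"] M[of n m] that by (simp add: dist_norm norm_minus_commute)
    then show "\<exists>M. \<forall>m\<ge>M. \<forall>n>m. dist (Y m) (Y n) < e" by blast
  qed
  then obtain Z where Z: "Y \<longlonglongrightarrow> Z" using Cauchy_convergent_iff convergent_def by blast
  have clY: "clinear_op (Y n)" for n by (induction n) (simp_all add: Y cl)
  have saY: "(Y n)\<^sup>\<dagger> = Y n" for n by (induction n) (simp_all add: Y cl sa clY)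
  have Zx: "(\<lambda>n. Y n x) \<longlonglongrightarrow> Z x" for x by (intro tendsto_intros Z)
  have clZ: "clinear_op Z"
    unfolding clinear_op_def
  proof (intro allI)
    fix c x
    have "bounded_linear ((*\<^sub>C) c :: 'a \<Rightarrow> 'a)"
      by (rule bounded_linear_intro[where K="cmod c"])
        (simp_all add: scaleC_add_right scaleC_scaleC mult.commute flip: scaleC_of_real)
    then have "(\<lambda>n. c *\<^sub>C Y n x) \<longlonglongrightarrow> c *\<^sub>C Z x" by (rule bounded_linear.tendsto[OF _ Zx])
    then show "Z (c *\<^sub>C x) = c *\<^sub>C Z x"
      using Zx[of "c *\<^sub>C x"] clinear_opD[OF clY] LIMSEQ_unique by (simp add: LIMSEQ_unique)
  qed
  have saZ: "Z\<^sup>\<dagger> = Z"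
  proof (rule adjI)
    fix x w
    have "(\<lambda>n. cinner x (Y n w)) \<longlonglongrightarrow> cinner x (Z w)" by (intro tendsto_cinner_right Zx)
    moreover have "(\<lambda>n. cnj (cinner w (Y n x))) \<longlonglongrightarrow> cnj (cinner w (Z x))"
      by (intro tendsto_cnj tendsto_cinner_right Zx)
    moreover have "cinner x (Y n w) = cnj (cinner w (Y n x))" for n
      using cinner_adj_left[OF clY, of n x w] saY cinner_commute[of "Y n x" w] by simp
    ultimately show "cinner (Z x) w = cinner x (Z w)"
      using LIMSEQ_unique cinner_commute[of "Z x" w] by simp
  qed
  have "norm Z \<le> 1"
    by (rule LIMSEQ_le_const2[OF tendsto_norm[OF Z]]) (use nY y01 order_trans in blast)
  have fix_eq: "Z = (1/2) *\<^sub>R (B + Z \<cdot> Z)"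
  proof (rule LIMSEQ_unique)
    show "(\<lambda>n. Y (Suc n)) \<longlonglongrightarrow> Z" using Z by (rule LIMSEQ_Suc)
    show "(\<lambda>n. Y (Suc n)) \<longlonglongrightarrow> (1/2) *\<^sub>R (B + Z \<cdot> Z)"
      unfolding Y by (intro tendsto_intros Z op_comp.tendsto)
  qed
  define S where "S = id_blinfun - Z"
  have "positive_op S"
  proof (rule positive_opI)
    show "0 \<le> Re (cinner x (S x))" for x
    proof -
      have "norm Z * (norm x)\<^sup>2 \<le> 1 * (norm x)\<^sup>2" using \<open>norm Z \<le> 1\<close> by (rule mult_right_mono) simp
      then show ?thesis using Re_cinner_le[of x Z]
        by (simp add: S_def blinfun.bilinear_simps cinner_diff_right cinner_self)
    qed
  qed (simp_all add: S_def clZ saZ)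
  moreover have "S \<cdot> S = A"
  proof -
    have "Z + Z = B + Z \<cdot> Z"
      by (subst (1 2) fix_eq) (simp flip: scaleR_add_left)
    then show ?thesis unfolding S_def by (simp add: op_simps B_def algebra_simps)
  qed
  moreover have "C \<cdot> S = S \<cdot> C" if C: "C \<cdot> A = A \<cdot> C" for C :: "'a op"
  proof -
    have "C \<cdot> B = B \<cdot> C" using C by (simp add: B_def op_simps)
    then have "(\<lambda>n. C \<cdot> Y n) = (\<lambda>n. Y n \<cdot> C)" using comm by blast
    moreover have "(\<lambda>n. C \<cdot> Y n) \<longlonglongrightarrow> C \<cdot> Z" "(\<lambda>n. Y n \<cdot> C) \<longlonglongrightarrow> Z \<cdot> C"
      by (intro op_comp.tendsto Z tendsto_const)+
    ultimately have "C \<cdot> Z = Z \<cdot> C" using LIMSEQ_unique by metis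
    then show ?thesis by (simp add: S_def op_simps)
  qed
  ultimately show ?thesis by blast
qed

lemma sqrt_exists:
  fixes A :: "'a::complex_hilbert_space op"
  assumes A: "positive_op A"
  shows "\<exists>S. positive_op S \<and> S \<cdot> S = A \<and> (\<forall>C :: 'a op. C \<cdot> A = A \<cdot> C \<longrightarrow> C \<cdot> S = S \<cdot> C)"
proof -
  define K where "K = norm A + 1"
  have "K > 0" by (simp add: K_def add_nonneg_pos)
  have "Re (cinner z (((1/K) *\<^sub>R A) z)) \<le> (norm z)\<^sup>2" for z
    unfolding K_def by (rule scaled_contraction)
  then obtain S where S: "positive_op S" "S \<cdot> S = (1/K) *\<^sub>R A"
      "\<And>C :: 'a op. C \<cdot> ((1/K) *\<^sub>R A) = ((1/K) *\<^sub>R A) \<cdot> C \<Longrightarrow> C \<cdot> S = S \<cdot> C"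
    using sqrt_contraction_exists[OF positive_op_scaleR[OF A]] \<open>K > 0\<close> by (metis less_imp_le zero_le_divide_1_iff)
  show ?thesis
  proof (intro exI[of _ "sqrt K *\<^sub>R S"] conjI allI impI)
    show "positive_op (sqrt K *\<^sub>R S)" using S(1) \<open>K > 0\<close> by (simp add: positive_op_scaleR)
    show "sqrt K *\<^sub>R S \<cdot> (sqrt K *\<^sub>R S) = A" using \<open>K > 0\<close> by (simp add: op_simps S(2))
    show "C \<cdot> (sqrt K *\<^sub>R S) = sqrt K *\<^sub>R S \<cdot> C" if "C \<cdot> A = A \<cdot> C" for C :: "'a op"
      using S(3)[of C] that by (simp add: op_simps)
  qed
qed

text \<open>With \<open>D = S - R\<close> one has \<open>D S D + D R D = (S\<^sup>2 - R\<^sup>2) D = 0\<close>, a sum of positive operators.  Hence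
  \<open>S\<close> and \<open>R\<close> annihilate the range of \<open>D\<close>, so \<open>D\<^sup>2 = 0\<close> and \<open>D = 0\<close>.\<close>

lemma positive_sqrt_unique:
  fixes S R :: "'a::complex_hilbert_space op"
  assumes S: "positive_op S" and R: "positive_op R" and eq: "S \<cdot> S = R \<cdot> R"
    and comm: "S \<cdot> R = R \<cdot> S"
  shows "S = R"
proof -
  define D where "D = S - R"
  have clD: "clinear_op D" and saD: "D\<^sup>\<dagger> = D"
    using S R by (simp_all add: D_def positive_op_clinear positive_op_self_adjoint)
  have 0: "D \<cdot> S \<cdot> D + D \<cdot> R \<cdot> D = 0"
  proof -
    have "D \<cdot> S \<cdot> D + D \<cdot> R \<cdot> D = D \<cdot> ((S + R) \<cdot> D)" by (simp add: op_simps comp_assoc)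
    also have "(S + R) \<cdot> D = 0" by (simp add: D_def op_simps eq comm)
    finally show ?thesis by simp
  qed
  have "D (D x) = 0" for x
  proof -
    have "cinner x ((D \<cdot> S \<cdot> D + D \<cdot> R \<cdot> D) x) = cinner (D x) (S (D x)) + cinner (D x) (R (D x))"
      using cinner_adj_left[OF clD] by (simp add: blinfun.bilinear_simps cinner_add_right saD)
    then have "Re (cinner (D x) (S (D x))) + Re (cinner (D x) (R (D x))) = 0"
      using 0 by (metis blinfun.zero_left cinner_zero_right plus_complex.sel(1) zero_complex.sel(1))
    then have "S (D x) = 0" "R (D x) = 0"
      using positive_op_Re[OF S, of "D x"] positive_op_Re[OF R, of "D x"]
      by (auto intro!: positive_op_null S R)
    then show ?thesis by (simp add: D_def blinfun.bilinear_simps)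
  qed
  then have "D\<^sup>\<dagger> \<cdot> D = 0" unfolding saD by (intro blinfun_eqI) simp
  then show ?thesis using adj_comp_self_eq_0_iff[OF clD] by (simp add: D_def)
qed

lemma op_sqrt_eqI:
  fixes A S :: "'a::complex_hilbert_space op"
  assumes S: "positive_op S" "S \<cdot> S = A"
  shows "op_sqrt A = S"
proof -
  have "A = S\<^sup>\<dagger> \<cdot> S" using S positive_op_self_adjoint by metis
  then have "positive_op A" using S(1) positive_op_gram positive_op_clinear by blast
  then obtain R where R: "positive_op R" "R \<cdot> R = A" "\<And>C :: 'a op. C \<cdot> A = A \<cdot> C \<Longrightarrow> C \<cdot> R = R \<cdot> C"
    using sqrt_exists by blast
  have "B = R" if "positive_op B" "B \<cdot> B = A" for B
  proof (rule positive_sqrt_unique)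
    have "B \<cdot> A = A \<cdot> B" unfolding that(2)[symmetric] by (simp add: comp_assoc)
    then show "B \<cdot> R = R \<cdot> B" by (rule R(3))
  qed (simp_all add: that R(1,2))
  then show ?thesis unfolding op_sqrt_def using S by (intro the_equality) auto
qed

lemma
  fixes A C :: "'a::complex_hilbert_space op"
  assumes "positive_op A"
  shows positive_op_sqrt: "positive_op (op_sqrt A)"
    and op_sqrt_square: "op_sqrt A \<cdot> op_sqrt A = A"
    and op_sqrt_commute: "C \<cdot> A = A \<cdot> C \<Longrightarrow> C \<cdot> op_sqrt A = op_sqrt A \<cdot> C"
  using sqrt_exists[OF assms] op_sqrt_eqI by metis+

section \<open>Generalised inverses\<close>

text \<open>The generalised inverse characterised by identities rather than by ranges.  Such identities are
  stable under adjoints and conjugation and can be verified by computation.\<close>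

definition moore_penrose :: "'a::complex_hilbert_space op \<Rightarrow> 'a op \<Rightarrow> bool" where
  "moore_penrose A B \<longleftrightarrow> clinear_op A \<and> clinear_op B \<and> A \<cdot> (B \<cdot> A) = A \<and> B \<cdot> (A \<cdot> B) = B \<and>
     (A \<cdot> B)\<^sup>\<dagger> = A \<cdot> B \<and> (B \<cdot> A)\<^sup>\<dagger> = B \<cdot> A"

lemma moore_penrose_adj:
  assumes "moore_penrose A B"
  shows "moore_penrose (A\<^sup>\<dagger>) (B\<^sup>\<dagger>)"
proof -
  have cl: "clinear_op A" "clinear_op B" and ABA: "A \<cdot> (B \<cdot> A) = A" and BAB: "B \<cdot> (A \<cdot> B) = B"
    and AB: "(A \<cdot> B)\<^sup>\<dagger> = A \<cdot> B" and BA: "(B \<cdot> A)\<^sup>\<dagger> = B \<cdot> A"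
    using assms by (simp_all add: moore_penrose_def)
  have "A\<^sup>\<dagger> \<cdot> (B\<^sup>\<dagger> \<cdot> A\<^sup>\<dagger>) = A\<^sup>\<dagger>"
    "B\<^sup>\<dagger> \<cdot> (A\<^sup>\<dagger> \<cdot> B\<^sup>\<dagger>) = B\<^sup>\<dagger>"
    using arg_cong[OF ABA, of adj] arg_cong[OF BAB, of adj] cl by (simp_all add: comp_assoc)
  moreover have "B\<^sup>\<dagger> \<cdot> A\<^sup>\<dagger> = A \<cdot> B" "A\<^sup>\<dagger> \<cdot> B\<^sup>\<dagger> = B \<cdot> A"
    using AB BA cl by simp_all
  ultimately show ?thesis using cl by (simp add: moore_penrose_def)
qed

text \<open>\<open>A B\<close> is the orthogonal projection onto the range of \<open>A\<close>, and \<open>B A\<close> the one onto the range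
  of \<open>A\<^sup>\<dagger>\<close>; every vector is the sum of its image under \<open>A B\<close> and an element of the kernel of \<open>A\<^sup>\<dagger>\<close>,
  so the two defining conditions of the inverse determine it.\<close>

lemma gen_inv_eq:
  fixes A B :: "'a::complex_hilbert_space op"
  assumes "moore_penrose A B"
  shows "gen_inv A = B"
proof -
  have cl: "clinear_op A" "clinear_op B" and ABA: "A \<cdot> (B \<cdot> A) = A" and BAB: "B \<cdot> (A \<cdot> B) = B"
    and AB: "(A \<cdot> B)\<^sup>\<dagger> = A \<cdot> B" and BA: "(B \<cdot> A)\<^sup>\<dagger> = B \<cdot> A"
    using assms by (simp_all add: moore_penrose_def)
  have l: "A\<^sup>\<dagger> \<cdot> (A \<cdot> B) = A\<^sup>\<dagger>"
    using arg_cong[OF ABA, of adj] AB cl by (simp add: comp_assoc)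
  have r: "B \<cdot> (A \<cdot> A\<^sup>\<dagger>) = A\<^sup>\<dagger>"
    using arg_cong[OF ABA, of adj] BA cl by (metis adj_comp clinear_op_comp comp_assoc)
  have BB: "B = A\<^sup>\<dagger> \<cdot> (B\<^sup>\<dagger> \<cdot> B)"
    using BAB BA cl by (metis adj_comp comp_assoc)
  show ?thesis
    unfolding gen_inv_def
  proof (rule the_equality)
    have "B (A (A\<^sup>\<dagger> z)) = A\<^sup>\<dagger> z" for z
      using r by (metis op_apply)
    moreover have "B y = 0" if "A\<^sup>\<dagger> y = 0" for y
    proof -
      have "A (B y) = B\<^sup>\<dagger> (A\<^sup>\<dagger> y)" using AB cl by (metis adj_comp op_apply)
      then have "A (B y) = 0" using that by simp
      then show ?thesis using BAB by (metis blinfun.zero_right op_apply)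
    qed
    ultimately show "(\<forall>x\<in>range (A\<^sup>\<dagger>). B (A x) = x) \<and> (\<forall>y. A\<^sup>\<dagger> y = 0 \<longrightarrow> B y = 0)" by auto
  next
    fix C :: "'a op"
    assume C: "(\<forall>x\<in>range (A\<^sup>\<dagger>). C (A x) = x) \<and> (\<forall>y. A\<^sup>\<dagger> y = 0 \<longrightarrow> C y = 0)"
    show "C = B"
    proof (rule blinfun_eqI)
      fix y
      have "A\<^sup>\<dagger> (y - A (B y)) = 0"
        using l by (metis blinfun.diff_right op_apply right_minus_eq)
      then have "C (y - A (B y)) = 0" using C by blast
      then have "C y = C (A (B y))" by (simp add: blinfun.bilinear_simps)
      also have "\<dots> = B y"
        using C BB by (metis op_apply rangeI)
      finally show "C y = B y" .
    qed
  qed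
qed

definition orth_complement_ker :: "'a::complex_hilbert_space op \<Rightarrow> 'a set" where
  "orth_complement_ker A = {x. \<forall>y. A y = 0 \<longrightarrow> cinner y x = 0}"

lemma orth_complement_ker_subspace:
  fixes A :: "'a::complex_hilbert_space op"
  shows "subspace (orth_complement_ker A)"
  by (auto simp: orth_complement_ker_def subspace_def cinner_add_right)

lemma orth_complement_ker_closed:
  fixes A :: "'a::complex_hilbert_space op"
  shows "closed (orth_complement_ker A)"
proof -
  have "orth_complement_ker A = (\<Inter>y\<in>{y. A y = 0}. {x. cinner y x = 0})"
    by (auto simp: orth_complement_ker_def)
  moreover have "closed {x. cinner y x = 0}" for y :: 'a
    using bounded_linear_cinner_right[THEN linear_continuous_on, of UNIV y]
    by (intro closed_Collect_eq) auto
  ultimately show ?thesis by auto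
qed

text \<open>\<open>B y\<close> is the least squares solution of \<open>A x = y\<close> that is orthogonal to the kernel of \<open>A\<close>.\<close>

lemma moore_penrose_exists:
  fixes A :: "'a::complex_hilbert_space op"
  assumes cl: "clinear_op A" and "c > 0"
    and below: "\<And>x. x \<in> orth_complement_ker A \<Longrightarrow> c * norm x \<le> norm (A x)"
  shows "\<exists>B. moore_penrose A B"
proof -
  define S where "S = orth_complement_ker A"
  note S = orth_complement_ker_closed[of A, folded S_def] orth_complement_ker_subspace[of A, folded S_def]
  have inj: "x = y" if "x \<in> S" "y \<in> S" "A x = A y" for x y
  proof -
    have "c * norm (x - y) \<le> norm (A (x - y))"
      using that S(2) below[of "x - y"] by (simp add: S_def subspace_diff)
    then show ?thesis using that(3) \<open>c > 0\<close> by (simp add: blinfun.bilinear_simps mult_le_0_iff)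
  qed
  have decomp: "\<exists>n. A n = 0 \<and> z - n \<in> S" for z
  proof -
    have N: "closed {n. A n = 0}" "subspace {n. A n = 0}"
      by (auto intro!: closed_Collect_eq continuous_intros
          simp: subspace_def blinfun.bilinear_simps)
    obtain n where n: "A n = 0" "\<And>m. A m = 0 \<Longrightarrow> n \<bullet> m = z \<bullet> m"
      using weak_solution_on_closed_subspace[OF N, of 1 id_blinfun "\<lambda>m. z \<bullet> m"] bounded_linear_inner_right
      by auto
    have "cinner y (z - n) = cinner 0 (0::'a)" if "A y = 0" for y
    proof (subst (1 2) cinner_commute, rule arg_cong[where f=cnj], rule cinner_eq_of_Re)
      fix c
      have "A (c *\<^sub>C y) = 0" using that by (simp add: clinear_opD[OF cl])
      then show "Re (cinner (z - n) (c *\<^sub>C y)) = Re (cinner 0 (c *\<^sub>C (0::'a)))"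
        using n(2)[of "c *\<^sub>C y"] by (simp add: inner_eq_Re_cinner cinner_diff_left right_diff_distrib)
    qed
    then show ?thesis using n(1) by (auto simp: S_def orth_complement_ker_def)
  qed
  have "\<exists>x\<in>S. \<forall>s. cinner (A x) (A s) = cinner y (A s)" for y
  proof -
    have bl: "bounded_linear (\<lambda>s. y \<bullet> A s)"
      by (rule bounded_linear_compose[OF bounded_linear_inner_right blinfun.bounded_linear_right])
    obtain x where x: "x \<in> S" "\<And>s. s \<in> S \<Longrightarrow> A x \<bullet> A s = y \<bullet> A s"
      using weak_solution_on_closed_subspace[OF S \<open>c > 0\<close> below bl] by (auto simp: S_def)
    have x2: "A x \<bullet> A s = y \<bullet> A s" for s
    proof -
      obtain n where n: "A n = 0" "s - n \<in> S" using decomp by blast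
      then show ?thesis using x(2)[OF n(2)] by (simp add: blinfun.bilinear_simps)
    qed
    have "cinner (A x) (A s) = cinner y (A s)" for s
    proof (rule cinner_eq_of_Re)
      show "Re (cinner (A x) (c *\<^sub>C A s)) = Re (cinner y (c *\<^sub>C A s))" for c
        using x2[of "c *\<^sub>C s"] by (simp only: inner_eq_Re_cinner clinear_opD[OF cl])
    qed
    then show ?thesis using x(1) by blast
  qed
  then obtain b where bS: "\<And>y. b y \<in> S" and b: "\<And>y s. cinner (A (b y)) (A s) = cinner y (A s)"
    by metis
  have bI: "b y = x" if "x \<in> S" "\<And>s. cinner (A x) (A s) = cinner y (A s)" for x y
  proof (rule inj[OF bS that(1)])
    have "cinner (A (b y) - A x) (A (b y - x)) = 0"
      unfolding cinner_diff_left b that(2) by simp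
    then show "A (b y) = A x" by (simp add: blinfun.bilinear_simps)
  qed
  have "bounded_linear b"
  proof (rule bounded_linear_intro[where K="1 / c"])
    show "b (y + z) = b y + b z" for y z
      by (rule bI) (auto simp: S(2) bS subspace_add blinfun.bilinear_simps cinner_add_left b)
    show "b (r *\<^sub>R y) = r *\<^sub>R b y" for r y
      by (rule bI) (auto simp: S(2) bS subspace_scale blinfun.bilinear_simps b)
    show "norm (b y) \<le> norm y * (1 / c)" for y
    proof -
      have "norm (A (b y)) * norm (A (b y)) = cmod (cinner (A (b y)) (A (b y)))"
        by (simp add: cinner_self power2_eq_square norm_mult)
      also have "\<dots> \<le> norm y * norm (A (b y))"
        unfolding b by (rule Cauchy_Schwarz_cinner)
      finally have "norm (A (b y)) \<le> norm y"
        by (cases "A (b y) = 0") (auto simp: mult_le_cancel_right)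
      then have "c * norm (b y) \<le> norm y" using below[of "b y"] bS by (simp add: S_def)
      then show ?thesis using \<open>c > 0\<close> by (simp add: field_simps)
    qed
  qed
  then obtain B :: "'a op" where B: "\<And>y. B y = b y" by (metis bounded_linear_Blinfun_apply)
  have clB: "clinear_op B"
    unfolding clinear_op_def B
    by (intro allI bI) (use bS in \<open>auto simp: S_def orth_complement_ker_def clinear_opD[OF cl] b\<close>)
  have ABA: "A (B (A x)) = A x" for x
  proof -
    have "cinner (A (b (A x)) - A x) (A (b (A x) - x)) = 0"
      unfolding cinner_diff_left b by simp
    then show ?thesis by (simp add: blinfun.bilinear_simps B)
  qed
  have "moore_penrose A B"
    unfolding moore_penrose_def
  proof (intro conjI cl clB)
    show "A \<cdot> (B \<cdot> A) = A" by (rule blinfun_eqI) (simp add: ABA)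
    show "B \<cdot> (A \<cdot> B) = B"
      by (rule blinfun_eqI) (simp, simp add: B, rule inj, use bS ABA B in auto)
    show "(A \<cdot> B)\<^sup>\<dagger> = A \<cdot> B"
    proof (rule adjI)
      fix x y
      have "cinner x (A (b y)) = cinner (A (b x)) (A (b y))" by (rule b[symmetric])
      also have "\<dots> = cnj (cinner (A (b y)) (A (b x)))" by (rule cinner_commute)
      also have "\<dots> = cinner (A (b x)) y" unfolding b by (rule cinner_commute[symmetric])
      finally show "cinner ((A \<cdot> B) x) y = cinner x ((A \<cdot> B) y)" by (simp add: B)
    qed
    have ker: "cinner (x - B (A x)) (B y) = 0" for x y
      using bS[of y] ABA[of x] by (simp add: S_def orth_complement_ker_def B blinfun.bilinear_simps)
    show "(B \<cdot> A)\<^sup>\<dagger> = B \<cdot> A"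
    proof (rule adjI)
      fix x y
      have "cinner x (B (A y)) = cinner (B (A x)) (B (A y))"
        using ker[of x "A y"] by (simp add: cinner_diff_left)
      also have "\<dots> = cnj (cinner (B (A y)) (B (A x)))" by (rule cinner_commute)
      also have "\<dots> = cnj (cinner y (B (A x)))"
        using ker[of y "A x"] by (simp add: cinner_diff_left)
      also have "\<dots> = cinner (B (A x)) y" by (rule cinner_commute[symmetric])
      finally show "cinner ((B \<cdot> A) x) y = cinner x ((B \<cdot> A) y)" by simp
    qed
  qed
  then show ?thesis by blast
qed

text \<open>The generalised inverse is a left inverse because \<open>A\<close> is injective, and taking adjoints turns
  this into a right inverse.\<close>

lemma inverse_exists:
  fixes A :: "'a::complex_hilbert_space op"
  assumes cl: "clinear_op A" and sa: "A\<^sup>\<dagger> = A" and below: "\<And>x. norm x \<le> norm (A x)"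
  shows "\<exists>B. clinear_op B \<and> A \<cdot> B = id_blinfun \<and> B \<cdot> A = id_blinfun"
proof -
  obtain B where B: "moore_penrose A B"
    using moore_penrose_exists[OF cl, of 1] below by auto
  then have clB: "clinear_op B" and eq: "A \<cdot> (B \<cdot> A) = A"
    by (simp_all add: moore_penrose_def)
  have inj: "x = y" if "A x = A y" for x y
    using below[of "x - y"] that by (simp add: blinfun.bilinear_simps)
  have "B (A x) = x" for x
    by (rule inj) (use eq in \<open>metis op_apply\<close>)
  then have 1: "B \<cdot> A = id_blinfun" by (intro blinfun_eqI) simp
  have "clinear_op (B\<^sup>\<dagger>)" "A \<cdot> B\<^sup>\<dagger> = id_blinfun"
    using arg_cong[OF 1, of adj] cl clB sa by simp_all
  then have "B\<^sup>\<dagger> = B" using 1 by (metis comp_assoc id_comp)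
  then show ?thesis using 1 clB \<open>A \<cdot> B\<^sup>\<dagger> = id_blinfun\<close> by auto
qed

section \<open>Projections and polar decompositions\<close>

lemma orth_projection_apply: "orth_projection P \<Longrightarrow> P (P x) = P x"
  by (metis op_apply orth_projection_def)

lemma orth_projection_fixed: "orth_projection P \<Longrightarrow> x \<in> range P \<longleftrightarrow> P x = x"
  by (metis orth_projection_apply rangeE rangeI)

lemma proj_on_eqI:
  fixes P :: "'a::complex_hilbert_space op"
  assumes P: "orth_projection P" and "range P = H"
  shows "proj_on H = P"
  unfolding proj_on_def
proof (rule the_equality)
  fix R :: "'a op" assume R: "orth_projection R \<and> range R = H"
  have "P (R x) = R x" for x
    using R assms(2) orth_projection_fixed[OF P, of "R x"] by blast
  moreover have "R (P x) = P x" for x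
    using R assms(2) orth_projection_fixed[of R "P x"] by blast
  ultimately have "P \<cdot> R = R" "R \<cdot> P = P"
    by (simp_all add: blinfun_eqI)
  then show "R = P"
    using P R unfolding orth_projection_def by (metis adj_comp)
qed (use assms in auto)

lemma op_abs_eqI: "positive_op R \<Longrightarrow> R \<cdot> R = A\<^sup>\<dagger> \<cdot> A \<Longrightarrow> op_abs A = R"
  unfolding op_abs_def by (rule op_sqrt_eqI)

text \<open>Two partial isometries with the stated properties agree on the range of \<open>R\<close> and on the kernel
  of \<open>A\<close>.  The factorisation of \<open>v\<^sup>\<dagger> v\<close>, the projection onto the orthogonal complement of this
  kernel, through \<open>R\<close> says that these two subspaces span the space without taking a closure.\<close>

lemma polar_isometry_eqI:
  fixes A v R X :: "'a::complex_hilbert_space op"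
  assumes clv: "clinear_op v" and vvv: "v \<cdot> (v\<^sup>\<dagger> \<cdot> v) = v" and abs: "op_abs A = R"
    and A: "A = v \<cdot> R" and ker: "\<And>x. v x = 0 \<longleftrightarrow> A x = 0" and X: "v\<^sup>\<dagger> \<cdot> v = R \<cdot> X"
  shows "polar_isometry A = v"
  unfolding polar_isometry_def abs
proof (rule the_equality)
  have split: "v (x - v\<^sup>\<dagger> (v x)) = 0" for x
    using vvv by (metis blinfun.diff_right op_apply right_minus_eq)
  have "norm (v x) = norm x" if x: "\<And>y. v y = 0 \<Longrightarrow> cinner y x = 0" for x
  proof -
    define z where "z = x - v\<^sup>\<dagger> (v x)"
    have "cinner z (v\<^sup>\<dagger> (v x)) = 0"
      using split[of x] by (simp add: z_def cinner_adj_right[OF clv])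
    moreover have "cinner z x = 0" using split x by (simp add: z_def)
    ultimately have "cinner z z = 0" by (simp add: z_def cinner_diff_right)
    then have "v\<^sup>\<dagger> (v x) = x" by (simp add: z_def)
    then have "complex_of_real ((norm (v x))\<^sup>2) = of_real ((norm x)\<^sup>2)"
      unfolding norm_sq_adj_comp[OF clv] by (simp add: cinner_self)
    then show ?thesis by (simp add: power2_eq_iff_nonneg flip: of_real_power)
  qed
  then show "partial_isometry v \<and> A = v \<cdot> R \<and> (\<forall>x. v x = 0 \<longleftrightarrow> A x = 0)"
    unfolding partial_isometry_def using clv A ker by blast
  fix w :: "'a op" assume w: "partial_isometry w \<and> A = w \<cdot> R \<and> (\<forall>x. w x = 0 \<longleftrightarrow> A x = 0)"
  show "w = v"
  proof (rule blinfun_eqI)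
    fix x
    have "w (x - v\<^sup>\<dagger> (v x)) = 0" using split ker w by blast
    then have "w x = w (R (X x))"
      using X by (metis blinfun.diff_right op_apply right_minus_eq)
    also have "\<dots> = v (R (X x))" using w A by (metis op_apply)
    also have "\<dots> = v x" using X vvv by (metis op_apply)
    finally show "w x = v x" .
  qed
qed

section \<open>Orthonormal systems\<close>

definition orthonormal :: "'a::complex_hilbert_space set \<Rightarrow> bool" where
  "orthonormal E \<longleftrightarrow> (\<forall>e\<in>E. \<forall>f\<in>E. cinner e f = (if e = f then 1 else 0))"

lemma onb_of_iff: "onb_of H E \<longleftrightarrow> orthonormal E \<and> closure (complex_vector.span E) = H"
  by (simp add: onb_of_def orthonormal_def)

lemma orthonormal_subset: "orthonormal E \<Longrightarrow> F \<subseteq> E \<Longrightarrow> orthonormal F"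
  unfolding orthonormal_def by blast

lemma orthonormal_norm:
  assumes "orthonormal E" "e \<in> E"
  shows "norm e = 1"
proof -
  have "cinner e e = 1" using assms by (simp add: orthonormal_def)
  then have "(norm e)\<^sup>2 = 1" unfolding cinner_self using of_real_eq_1_iff by blast
  then show ?thesis using power2_eq_imp_eq[of "norm e" 1] by simp
qed

text \<open>Subtracting the Fourier sum leaves a vector orthogonal to \<open>F\<close>, and Pythagoras applies.\<close>

lemma orthonormal_residual:
  assumes "finite F" "orthonormal F"
  defines "r \<equiv> \<lambda>x. x - (\<Sum>e\<in>F. cinner e x *\<^sub>C e)"
  shows "e \<in> F \<Longrightarrow> cinner e (r x) = 0"
    and "(norm x)\<^sup>2 = (norm (r x))\<^sup>2 + (\<Sum>e\<in>F. (cmod (cinner e x))\<^sup>2)"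
proof -
  have orth: "cinner e (r x) = 0" if "e \<in> F" for e
  proof -
    have "(\<Sum>f\<in>F. cinner f x * cinner e f) = (\<Sum>f\<in>F. if f = e then cinner e x else 0)"
      using assms(2) that by (intro sum.cong) (auto simp: orthonormal_def)
    then show ?thesis using assms(1) that by (simp add: r_def cinner_diff_right cinner_sum_right)
  qed
  then show "e \<in> F \<Longrightarrow> cinner e (r x) = 0" .
  have orth': "cinner (r x) e = 0" if "e \<in> F" for e
    using orth[OF that] cinner_commute[of "r x" e] by simp
  define p where "p = (\<Sum>e\<in>F. cinner e x *\<^sub>C e)"
  have "cinner (r x) p = 0" by (simp add: p_def cinner_sum_right orth')
  then have "(norm (r x + p))\<^sup>2 = (norm (r x))\<^sup>2 + (norm p)\<^sup>2" by (rule norm_add_sq_orthogonal)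
  moreover have "r x + p = x" by (simp add: r_def p_def)
  moreover have "(norm p)\<^sup>2 = (\<Sum>e\<in>F. (cmod (cinner e x))\<^sup>2)"
  proof -
    have ep: "cinner e p = cinner e x" if "e \<in> F" for e
      using orth[OF that] by (simp add: r_def p_def cinner_diff_right)
    have "complex_of_real ((norm p)\<^sup>2) = cinner p p" by (rule cinner_self[symmetric])
    also have "\<dots> = (\<Sum>e\<in>F. cnj (cinner e x) * cinner e p)"
      by (subst (1) p_def) (simp add: cinner_sum_left)
    also have "\<dots> = (\<Sum>e\<in>F. of_real ((cmod (cinner e x))\<^sup>2))"
      by (intro sum.cong refl) (simp only: ep complex_norm_square mult.commute)
    finally show ?thesis by (metis of_real_eq_iff of_real_sum)
  qed
  ultimately show "(norm x)\<^sup>2 = (norm (r x))\<^sup>2 + (\<Sum>e\<in>F. (cmod (cinner e x))\<^sup>2)" by simp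
qed

lemma Bessel_finite:
  assumes "finite F" "orthonormal F"
  shows "(\<Sum>e\<in>F. (cmod (cinner e x))\<^sup>2) \<le> (norm x)\<^sup>2"
  using orthonormal_residual(2)[OF assms, of x] by simp

lemma orthonormal_best_approximation:
  assumes F: "finite F" "orthonormal F" and "z \<in> complex_vector.span F"
  shows "norm (x - (\<Sum>e\<in>F. cinner e x *\<^sub>C e)) \<le> norm (x - z)"
proof -
  define p where "p = (\<Sum>e\<in>F. cinner e x *\<^sub>C e)"
  have "p \<in> complex_vector.span F"
    unfolding p_def by (intro complex_vector.span_sum complex_vector.span_scale complex_vector.span_base)
  then have "p - z \<in> complex_vector.span F" using assms(3) by (rule complex_vector.span_diff)
  then have "cinner (x - p) (p - z) = 0"
  proof (induction rule: complex_vector.span_induct_alt)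
    case (step c e y)
    have "cinner e (x - p) = 0" using orthonormal_residual(1)[OF F step(1)] by (simp add: p_def)
    then have "cinner (x - p) e = 0" using cinner_commute[of "x - p" e] by simp
    then show ?case using step by (simp add: cinner_add_right)
  qed simp
  then have "(norm ((x - p) + (p - z)))\<^sup>2 = (norm (x - p))\<^sup>2 + (norm (p - z))\<^sup>2"
    by (rule norm_add_sq_orthogonal)
  then have "(norm (x - p))\<^sup>2 \<le> (norm (x - z))\<^sup>2" by simp
  then show ?thesis unfolding p_def by (simp add: power2_le_iff_abs_le)
qed

text \<open>By density some element of a finite span approximates \<open>x\<close>, the Fourier sum over that finite set is
  at least as good, and enlarging the finite set improves it further.\<close>

lemma Parseval:
  fixes E :: "'a::complex_hilbert_space set"
  assumes "onb_of UNIV E"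
  shows "((\<lambda>e. (cmod (cinner e x))\<^sup>2) has_sum (norm x)\<^sup>2) E"
  unfolding has_sum_def
proof (rule tendstoI)
  have E: "orthonormal E" "closure (complex_vector.span E) = UNIV"
    using assms by (simp_all add: onb_of_iff)
  fix \<epsilon> :: real assume "\<epsilon> > 0"
  have "x \<in> closure (complex_vector.span E)" using E by simp
  then obtain z where z: "z \<in> complex_vector.span E" "dist z x < sqrt \<epsilon>"
    using \<open>\<epsilon> > 0\<close> unfolding closure_approachable by (metis real_sqrt_gt_zero)
  then obtain F where F: "finite F" "F \<subseteq> E" "z \<in> complex_vector.span F"
    unfolding complex_vector.span_explicit[of E]
    by (auto intro!: that complex_vector.span_sum complex_vector.span_scale intro: complex_vector.span_base)
  have "dist (\<Sum>e\<in>G. (cmod (cinner e x))\<^sup>2) ((norm x)\<^sup>2) < \<epsilon>" if G: "finite G" "F \<subseteq> G" "G \<subseteq> E" for G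
  proof -
    have G': "orthonormal G" using E(1) G(3) by (rule orthonormal_subset)
    have "z \<in> complex_vector.span G" using F(3) G(2) complex_vector.span_mono by blast
    then have "norm (x - (\<Sum>e\<in>G. cinner e x *\<^sub>C e)) < sqrt \<epsilon>"
      using orthonormal_best_approximation[OF G(1) G', of z x] z(2)
      by (simp add: dist_norm norm_minus_commute)
    then have "(norm (x - (\<Sum>e\<in>G. cinner e x *\<^sub>C e)))\<^sup>2 < \<epsilon>"
      using \<open>\<epsilon> > 0\<close> by (metis norm_ge_zero real_less_rsqrt real_sqrt_less_iff real_sqrt_unique)
    then show ?thesis using orthonormal_residual(2)[OF G(1) G', of x] by (simp add: dist_real_def)
  qed
  then show "\<forall>\<^sub>F G in finite_subsets_at_top E. dist (\<Sum>e\<in>G. (cmod (cinner e x))\<^sup>2) ((norm x)\<^sup>2) < \<epsilon>"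
    unfolding eventually_finite_subsets_at_top using F by blast
qed

section \<open>Hilbert-Schmidt operators\<close>

text \<open>Both sums expand, by Parseval, to the double sum of \<open>|\<langle>f, A e\<rangle>|\<^sup>2\<close> over \<open>E \<times> F\<close>.  Applied twice this
  shows that the sum for \<open>A\<close> does not depend on the orthonormal basis; the symmetric form with the
  adjoint also reduces multiplication from the right to multiplication from the left.\<close>

lemma has_sum_norm_sq_adj:
  assumes E: "onb_of UNIV E" and F: "onb_of UNIV F" and cl: "clinear_op A"
    and s: "((\<lambda>e. (norm (A e))\<^sup>2) has_sum s) E"
  shows "((\<lambda>f. (norm (A\<^sup>\<dagger> f))\<^sup>2) has_sum s) F"
proof -
  define g where "g = (\<lambda>(e, f). (cmod (cinner f (A e)))\<^sup>2)"
  have rows: "((\<lambda>f. g (e, f)) has_sum (norm (A e))\<^sup>2) F" for e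
    using Parseval[OF F] by (simp add: g_def)
  have cols: "((\<lambda>e. (\<lambda>(f, e). g (e, f)) (f, e)) has_sum (norm (A\<^sup>\<dagger> f))\<^sup>2) E" for f
  proof -
    have "cmod (cinner f (A e)) = cmod (cinner e (A\<^sup>\<dagger> f))" for e
      using cinner_adj_left[OF cl, of f e] cinner_commute[of "A\<^sup>\<dagger> f" e] by (metis complex_mod_cnj)
    then show ?thesis using Parseval[OF E, of "A\<^sup>\<dagger> f"] by (simp add: g_def)
  qed
  have "g summable_on E \<times> F"
    by (rule summable_on_SigmaI[OF rows]) (use s in \<open>auto simp: summable_on_def g_def\<close>)
  then have "(g has_sum s) (E \<times> F)" by (rule has_sum_SigmaI[OF rows s])
  then have "((\<lambda>(f, e). g (e, f)) has_sum s) (F \<times> E)" by (rule has_sum_swap[THEN iffD1])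
  then show ?thesis by (rule has_sum_SigmaD[OF _ cols])
qed

lemma hilbert_schmidt_clinear: "hilbert_schmidt A \<Longrightarrow> clinear_op A"
  by (simp add: hilbert_schmidt_def)

lemma hilbert_schmidt_summable:
  assumes "hilbert_schmidt A" "onb_of UNIV F"
  shows "(\<lambda>e. (norm (A e))\<^sup>2) summable_on F" "(\<lambda>e. (norm (A\<^sup>\<dagger> e))\<^sup>2) summable_on F"
proof -
  obtain E s where cl: "clinear_op A" and E: "onb_of UNIV E" "((\<lambda>e. (norm (A e))\<^sup>2) has_sum s) E"
    using assms by (auto simp: hilbert_schmidt_def summable_on_def)
  then show "(\<lambda>e. (norm (A\<^sup>\<dagger> e))\<^sup>2) summable_on F"
    using has_sum_norm_sq_adj[OF _ assms(2) cl] by (auto simp: summable_on_def)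
  have "((\<lambda>e. (norm (A\<^sup>\<dagger>\<^sup>\<dagger> e))\<^sup>2) has_sum s) F"
    using has_sum_norm_sq_adj[OF E(1) E(1) cl E(2)] cl
    by (intro has_sum_norm_sq_adj[OF E(1) assms(2)]) auto
  then show "(\<lambda>e. (norm (A e))\<^sup>2) summable_on F" using cl by (auto simp: summable_on_def)
qed

lemma infsum_norm_sq_adj:
  assumes "hilbert_schmidt A" "onb_of UNIV E"
  shows "(\<Sum>\<^sub>\<infinity>e\<in>E. (norm (A\<^sup>\<dagger> e))\<^sup>2) = (\<Sum>\<^sub>\<infinity>e\<in>E. (norm (A e))\<^sup>2)"
  using has_sum_norm_sq_adj[OF assms(2,2) hilbert_schmidt_clinear[OF assms(1)]]
    hilbert_schmidt_summable(1)[OF assms] by (metis has_sum_infsum infsumI)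

lemma hilbert_schmidt_onb: "hilbert_schmidt A \<Longrightarrow> \<exists>E :: 'a set. onb_of UNIV E"
  for A :: "'a::complex_hilbert_space op"
  by (auto simp: hilbert_schmidt_def)

lemma hilbert_schmidt_adj [simp]: "hilbert_schmidt A \<Longrightarrow> hilbert_schmidt (A\<^sup>\<dagger>)"
  using hilbert_schmidt_onb[of A] hilbert_schmidt_summable(2)[of A]
  by (auto simp: hilbert_schmidt_def)

lemma hilbert_schmidt_dominated:
  fixes A B :: "'a::complex_hilbert_space op"
  assumes A: "hilbert_schmidt A" and "clinear_op B" and le: "\<And>x. norm (B x) \<le> K * norm (A x)"
  shows "hilbert_schmidt B"
proof -
  obtain E :: "'a set" where E: "onb_of UNIV E" using hilbert_schmidt_onb[OF A] by blast
  have "(\<lambda>e. (norm (B e))\<^sup>2) summable_on E"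
  proof (rule summable_on_comparison_test)
    show "(\<lambda>e. K\<^sup>2 * (norm (A e))\<^sup>2) summable_on E"
      by (intro summable_on_cmult_right hilbert_schmidt_summable A E)
    show "(norm (B e))\<^sup>2 \<le> K\<^sup>2 * (norm (A e))\<^sup>2" for e
      using power_mono[OF le norm_ge_zero, of e 2] by (simp add: power_mult_distrib)
  qed simp
  then show ?thesis using assms(2) E by (auto simp: hilbert_schmidt_def)
qed

lemma hilbert_schmidt_comp_left [simp]:
  fixes A B :: "'a::complex_hilbert_space op"
  shows "hilbert_schmidt A \<Longrightarrow> clinear_op B \<Longrightarrow> hilbert_schmidt (B \<cdot> A)"
  by (rule hilbert_schmidt_dominated[where A=A and K="norm B"])
    (simp_all add: hilbert_schmidt_clinear norm_blinfun)

lemma hilbert_schmidt_comp_right [simp]: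
  fixes A B :: "'a::complex_hilbert_space op"
  assumes "hilbert_schmidt A" "clinear_op B"
  shows "hilbert_schmidt (A \<cdot> B)"
proof -
  have "hilbert_schmidt ((B\<^sup>\<dagger> \<cdot> A\<^sup>\<dagger>)\<^sup>\<dagger>)" using assms by simp
  then show ?thesis using assms by (simp add: hilbert_schmidt_clinear)
qed

lemma hilbert_schmidt_minus [simp]: "hilbert_schmidt A \<Longrightarrow> hilbert_schmidt (- A)"
  by (rule hilbert_schmidt_dominated[where A=A and K=1])
    (simp_all add: hilbert_schmidt_clinear blinfun.bilinear_simps)

lemma hilbert_schmidt_add [simp]:
  fixes A B :: "'a::complex_hilbert_space op"
  assumes A: "hilbert_schmidt A" and B: "hilbert_schmidt B"
  shows "hilbert_schmidt (A + B)"
proof -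
  obtain E :: "'a set" where E: "onb_of UNIV E" using hilbert_schmidt_onb[OF A] by blast
  have "(\<lambda>e. (norm ((A + B) e))\<^sup>2) summable_on E"
  proof (rule summable_on_comparison_test)
    show "(\<lambda>e. 2 * (norm (A e))\<^sup>2 + 2 * (norm (B e))\<^sup>2) summable_on E"
      by (intro summable_on_add summable_on_cmult_right hilbert_schmidt_summable A B E)
    show "(norm ((A + B) e))\<^sup>2 \<le> 2 * (norm (A e))\<^sup>2 + 2 * (norm (B e))\<^sup>2" for e
    proof -
      have "(norm ((A + B) e))\<^sup>2 \<le> (norm (A e) + norm (B e))\<^sup>2"
        by (intro power_mono) (simp_all add: blinfun.bilinear_simps norm_triangle_ineq)
      also have "\<dots> \<le> 2 * (norm (A e))\<^sup>2 + 2 * (norm (B e))\<^sup>2"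
        using sum_squares_bound[of "norm (A e)" "norm (B e)"] by (simp add: power2_sum)
      finally show ?thesis .
    qed
  qed simp
  then show ?thesis using E A B by (auto simp: hilbert_schmidt_def)
qed

lemma hilbert_schmidt_diff [simp]: "hilbert_schmidt A \<Longrightarrow> hilbert_schmidt B \<Longrightarrow> hilbert_schmidt (A - B)"
  using hilbert_schmidt_add[of A "- B"] by simp

text \<open>A quantitative form of compactness.  The vectors \<open>e\<close> come from an orthonormal basis, and all but
  finitely many terms of the convergent sum of \<open>\<parallel>C\<^sup>\<dagger> e\<parallel>\<^sup>2\<close> are absorbed in \<open>\<epsilon>\<close>.\<close>

lemma hilbert_schmidt_compactness:
  fixes C :: "'a::complex_hilbert_space op"
  assumes C: "hilbert_schmidt C" and "\<epsilon> > 0"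
  obtains F where "finite F"
    "\<And>x. (norm (C x))\<^sup>2 \<le> (\<Sum>e\<in>F. (cmod (cinner e (C x)))\<^sup>2) + \<epsilon> * (norm x)\<^sup>2"
proof -
  have cl: "clinear_op C" using C by (rule hilbert_schmidt_clinear)
  obtain E :: "'a set" where E: "onb_of UNIV E" using hilbert_schmidt_onb[OF C] by blast
  define s where "s = (\<Sum>\<^sub>\<infinity>e\<in>E. (norm (C\<^sup>\<dagger> e))\<^sup>2)"
  have s: "(\<lambda>e. (norm (C\<^sup>\<dagger> e))\<^sup>2) summable_on E"
    using hilbert_schmidt_summable(2)[OF C E] .
  obtain F where F: "finite F" "F \<subseteq> E" "dist (\<Sum>e\<in>F. (norm (C\<^sup>\<dagger> e))\<^sup>2) s \<le> \<epsilon>"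
    using infsum_finite_approximation[OF s \<open>\<epsilon> > 0\<close>] unfolding s_def by blast
  have "(norm (C x))\<^sup>2 \<le> (\<Sum>e\<in>F. (cmod (cinner e (C x)))\<^sup>2) + \<epsilon> * (norm x)\<^sup>2" for x
  proof (rule has_sum_le_finite_sums[OF Parseval[OF E]])
    fix G assume G: "finite G" "G \<subseteq> E"
    have "(\<Sum>e\<in>G. (cmod (cinner e (C x)))\<^sup>2) \<le> (\<Sum>e\<in>F \<union> (G - F). (cmod (cinner e (C x)))\<^sup>2)"
      using F G by (intro sum_mono2) auto
    also have "\<dots> = (\<Sum>e\<in>F. (cmod (cinner e (C x)))\<^sup>2) + (\<Sum>e\<in>G - F. (cmod (cinner e (C x)))\<^sup>2)"
      using F G by (intro sum.union_disjoint) auto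
    also have "(\<Sum>e\<in>G - F. (cmod (cinner e (C x)))\<^sup>2) \<le> (\<Sum>e\<in>G - F. (norm (C\<^sup>\<dagger> e))\<^sup>2 * (norm x)\<^sup>2)"
    proof (rule sum_mono)
      fix e
      have "cmod (cinner e (C x)) \<le> norm (C\<^sup>\<dagger> e) * norm x"
        using Cauchy_Schwarz_cinner[of "C\<^sup>\<dagger> e" x] by (simp add: cinner_adj_left[OF cl])
      then show "(cmod (cinner e (C x)))\<^sup>2 \<le> (norm (C\<^sup>\<dagger> e))\<^sup>2 * (norm x)\<^sup>2"
        using power_mono[of _ "norm (C\<^sup>\<dagger> e) * norm x" 2] by (simp add: power_mult_distrib)
    qed
    also have "\<dots> = (\<Sum>e\<in>G - F. (norm (C\<^sup>\<dagger> e))\<^sup>2) * (norm x)\<^sup>2" by (simp add: sum_distrib_right)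
    also have "\<dots> \<le> \<epsilon> * (norm x)\<^sup>2"
    proof (rule mult_right_mono)
      have "(\<Sum>e\<in>F. (norm (C\<^sup>\<dagger> e))\<^sup>2) + (\<Sum>e\<in>G - F. (norm (C\<^sup>\<dagger> e))\<^sup>2)
          = (\<Sum>e\<in>F \<union> (G - F). (norm (C\<^sup>\<dagger> e))\<^sup>2)"
        using F G by (intro sum.union_disjoint[symmetric]) auto
      also have "\<dots> \<le> s" unfolding s_def
        using F G by (intro finite_sum_le_infsum s) auto
      finally show "(\<Sum>e\<in>G - F. (norm (C\<^sup>\<dagger> e))\<^sup>2) \<le> \<epsilon>"
        using F(3) by (simp add: dist_real_def)
    qed simp
    finally show "(\<Sum>e\<in>G. (cmod (cinner e (C x)))\<^sup>2)
        \<le> (\<Sum>e\<in>F. (cmod (cinner e (C x)))\<^sup>2) + \<epsilon> * (norm x)\<^sup>2" by simp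
  qed
  then show ?thesis using F(1) that by blast
qed

text \<open>Summing the compactness estimate with \<open>\<epsilon> = 1/2\<close> over \<open>n\<close> elements of \<open>G\<close> and using Bessel's
  inequality for the vectors \<open>C\<^sup>\<dagger> e\<close> bounds \<open>n / 2\<close> independently of \<open>n\<close>.\<close>

lemma finite_orthonormal_if_isometric:
  fixes C :: "'a::complex_hilbert_space op"
  assumes C: "hilbert_schmidt C" and G: "orthonormal G" and iso: "\<And>e. e \<in> G \<Longrightarrow> norm (C e) = 1"
  shows "finite G"
proof (rule ccontr)
  assume "infinite G"
  have cl: "clinear_op C" using C by (rule hilbert_schmidt_clinear)
  obtain F where F: "finite F"
    "\<And>x. (norm (C x))\<^sup>2 \<le> (\<Sum>e\<in>F. (cmod (cinner e (C x)))\<^sup>2) + 1/2 * (norm x)\<^sup>2"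
    using hilbert_schmidt_compactness[OF C, of "1/2"] by auto
  define M where "M = (\<Sum>e\<in>F. (norm (C\<^sup>\<dagger> e))\<^sup>2)"
  obtain n :: nat where n: "2 * M < real n" using reals_Archimedean2 by blast
  obtain H where H: "finite H" "H \<subseteq> G" "card H = n"
    using infinite_arbitrarily_large[OF \<open>infinite G\<close>] by metis
  have on: "orthonormal H" using G H(2) by (rule orthonormal_subset)
  have "real n = (\<Sum>g\<in>H. (norm (C g))\<^sup>2)" using iso H by (simp add: subset_iff)
  also have "\<dots> \<le> (\<Sum>g\<in>H. (\<Sum>e\<in>F. (cmod (cinner e (C g)))\<^sup>2) + 1/2)"
  proof (rule sum_mono)
    fix g assume "g \<in> H"
    then have "norm g = 1" by (rule orthonormal_norm[OF on])
    then show "(norm (C g))\<^sup>2 \<le> (\<Sum>e\<in>F. (cmod (cinner e (C g)))\<^sup>2) + 1/2" using F(2)[of g] by simp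
  qed
  also have "\<dots> = (\<Sum>e\<in>F. \<Sum>g\<in>H. (cmod (cinner e (C g)))\<^sup>2) + real n / 2"
    by (simp add: sum.distrib H sum.swap[of _ H])
  also have "(\<Sum>e\<in>F. \<Sum>g\<in>H. (cmod (cinner e (C g)))\<^sup>2) \<le> M"
    unfolding M_def
  proof (rule sum_mono)
    fix e
    have "cmod (cinner e (C g)) = cmod (cinner g (C\<^sup>\<dagger> e))" for g
      using cinner_adj_left[OF cl, of e g] cinner_commute[of "C\<^sup>\<dagger> e" g] by (metis complex_mod_cnj)
    then show "(\<Sum>g\<in>H. (cmod (cinner e (C g)))\<^sup>2) \<le> (norm (C\<^sup>\<dagger> e))\<^sup>2"
      using Bessel_finite[OF H(1) on, of "C\<^sup>\<dagger> e"] by simp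
  qed
  finally show False using n by simp
qed

lemma finite_onb_of_hilbert_schmidt_range:
  assumes "orth_projection p" "hilbert_schmidt p" "onb_of (range p) E"
  shows "finite E"
proof (rule finite_orthonormal_if_isometric[OF assms(2)])
  show on: "orthonormal E" using assms(3) by (simp add: onb_of_iff)
  fix e assume "e \<in> E"
  then have "e \<in> range p"
    using assms(3) closure_subset complex_vector.span_superset unfolding onb_of_iff by blast
  then have "p e = e" using orth_projection_fixed[OF assms(1)] by blast
  then show "norm (p e) = 1" using orthonormal_norm[OF on \<open>e \<in> E\<close>] by simp
qed

lemma common_convergent_subsequence:
  fixes f :: "'b \<Rightarrow> nat \<Rightarrow> complex"
  assumes "finite F" and "\<And>e. e \<in> F \<Longrightarrow> Bseq (f e)"
  shows "\<exists>r. strict_mono r \<and> (\<forall>e\<in>F. convergent (\<lambda>n. f e (r n)))"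
  using assms
proof (induction F)
  case empty
  show ?case using strict_mono_id by auto
next
  case (insert e F)
  then obtain r where r: "strict_mono r" "\<forall>e\<in>F. convergent (\<lambda>n. f e (r n))" by auto
  have "bounded (range (\<lambda>n. f e (r n)))"
    using insert.prems[of e] bounded_subset[of "range (f e)" "range (\<lambda>n. f e (r n))"]
    by (auto simp: Bseq_eq_bounded)
  then obtain l q where q: "strict_mono q" "((\<lambda>n. f e (r n)) \<circ> q) \<longlonglongrightarrow> l"
    using bounded_imp_convergent_subsequence by blast
  have "convergent (\<lambda>n. f e' (r (q n)))" if "e' \<in> insert e F" for e'
  proof (cases "e' = e")
    case True
    then show ?thesis using q(2) by (auto simp: convergent_def o_def)
  next
    case False
    then have "convergent (\<lambda>n. f e' (r n))" using that r(2) by blast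
    from convergent_subseq_convergent[OF this q(1)] show ?thesis by (simp add: o_def)
  qed
  moreover have "strict_mono (r \<circ> q)" using r(1) q(1) by (rule strict_mono_o)
  ultimately show ?case by (intro exI[of _ "r \<circ> q"]) (simp add: o_def)
qed

text \<open>An operator that is bounded below up to a Hilbert-Schmidt operator is bounded below on the
  orthogonal complement of its kernel.  Otherwise there are unit vectors \<open>g\<^sub>n\<close> in this complement with \<open>A g\<^sub>n \<longlonglongrightarrow> 0\<close>.  Along a subsequence the finitely
  many coordinates that control \<open>C\<close> up to a small error converge, so the estimate makes \<open>g\<^sub>n\<close> a
  Cauchy sequence.  Its limit is a unit vector in the kernel and orthogonal to the kernel.\<close>

lemma moore_penrose_exists_mod_hilbert_schmidt:
  fixes A C :: "'a::complex_hilbert_space op"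
  assumes cl: "clinear_op A" and C: "hilbert_schmidt C"
    and below: "\<And>x. x \<in> orth_complement_ker A \<Longrightarrow> norm x \<le> norm (A x) + norm (C x)"
  shows "\<exists>B. moore_penrose A B"
proof (rule ccontr)
  assume neg: "\<nexists>B. moore_penrose A B"
  define S where "S = orth_complement_ker A"
  note S = orth_complement_ker_closed[of A, folded S_def] orth_complement_ker_subspace[of A, folded S_def]
  have "\<exists>g\<in>S. norm g = 1 \<and> norm (A g) < 1 / real (Suc n)" for n
  proof -
    obtain x where x: "x \<in> S" "\<not> (1 / real (Suc n)) * norm x \<le> norm (A x)"
      using moore_penrose_exists[OF cl, of "1 / real (Suc n)"] neg unfolding S_def by fastforce
    then have "x \<noteq> 0" by auto
    with x show ?thesis
      by (intro bexI[of _ "(1 / norm x) *\<^sub>R x"])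
        (auto simp: blinfun.bilinear_simps divide_simps S(2) subspace_scale mult.commute)
  qed
  then obtain g where g: "\<And>n. g n \<in> S" "\<And>n. norm (g n) = 1" "\<And>n. norm (A (g n)) < 1 / real (Suc n)"
    by metis
  obtain F where F: "finite F"
    "\<And>x. (norm (C x))\<^sup>2 \<le> (\<Sum>e\<in>F. (cmod (cinner e (C x)))\<^sup>2) + 1/4 * (norm x)\<^sup>2"
    using hilbert_schmidt_compactness[OF C, of "1/4"] by auto
  have "Bseq (\<lambda>n. cinner e (C (g n)))" for e
  proof (rule BseqI'[where K="norm e * norm C"])
    show "cmod (cinner e (C (g n))) \<le> norm e * norm C" for n
    proof -
      have "norm (C (g n)) \<le> norm C" using norm_blinfun[of C "g n"] g(2)[of n] by simp
      then show ?thesis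
        using Cauchy_Schwarz_cinner[of e "C (g n)"] mult_left_mono[OF _ norm_ge_zero[of e]]
        by (meson order_trans)
    qed
  qed
  then obtain r where r: "strict_mono r" "\<And>e. e \<in> F \<Longrightarrow> convergent (\<lambda>n. cinner e (C (g (r n))))"
    using common_convergent_subsequence[OF F(1), of "\<lambda>e n. cinner e (C (g n))"] by auto
  then obtain \<zeta> where \<zeta>: "\<And>e. e \<in> F \<Longrightarrow> (\<lambda>n. cinner e (C (g (r n)))) \<longlonglongrightarrow> \<zeta> e"
    unfolding convergent_def by metis
  \<comment> \<open>The factors 2 arise from absorbing half of the norm of the difference into the left-hand side.\<close>
  define w where "w n = 2 * (\<Sum>e\<in>F. cmod (cinner e (C (g (r n))) - \<zeta> e)) + 2 * (1 / real (Suc n))" for n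
  have "w \<longlonglongrightarrow> 2 * (\<Sum>e\<in>F. cmod (\<zeta> e - \<zeta> e)) + 2 * 0"
    unfolding w_def by (intro tendsto_intros \<zeta> LIMSEQ_Suc[OF lim_1_over_n])
  then have w: "w \<longlonglongrightarrow> 0" by simp
  have close: "norm (g (r i) - g (r j)) \<le> w i + w j" for i j
  proof -
    define d where "d = g (r i) - g (r j)"
    define t where "t = (\<Sum>e\<in>F. cmod (cinner e (C d)))"
    have "norm d \<le> norm (A d) + norm (C d)"
      using below g(1) S(2) unfolding d_def S_def by (simp add: subspace_diff)
    moreover have "norm (C d) \<le> t + 1/2 * norm d"
    proof (rule power2_le_imp_le)
      have "(\<Sum>e\<in>F. (cmod (cinner e (C d)))\<^sup>2) \<le> t\<^sup>2"
        using L2_set_le_sum[of F "\<lambda>e. cmod (cinner e (C d))"]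
        unfolding L2_set_def t_def by (intro sqrt_le_D) simp
      then have "(norm (C d))\<^sup>2 \<le> t\<^sup>2 + 1/4 * (norm d)\<^sup>2" using F(2)[of d] by linarith
      also have "\<dots> \<le> (t + 1/2 * norm d)\<^sup>2"
        by (simp add: power2_eq_square algebra_simps t_def sum_nonneg)
      finally show "(norm (C d))\<^sup>2 \<le> (t + 1/2 * norm d)\<^sup>2" .
    qed (simp add: t_def sum_nonneg)
    moreover have "norm (A d) \<le> 1 / real (Suc i) + 1 / real (Suc j)"
    proof -
      have small: "norm (A (g (r k))) \<le> 1 / real (Suc k)" for k
      proof -
        have "k \<le> r k" using r(1) by (rule strict_mono_imp_increasing)
        then have "1 / real (Suc (r k)) \<le> 1 / real (Suc k)" by (simp add: frac_le)
        then show ?thesis using g(3)[of "r k"] by linarith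
      qed
      have "norm (A d) \<le> norm (A (g (r i))) + norm (A (g (r j)))"
        unfolding d_def blinfun.bilinear_simps by (rule norm_triangle_ineq4)
      then show ?thesis using small[of i] small[of j] by linarith
    qed
    moreover have "t \<le> (\<Sum>e\<in>F. cmod (cinner e (C (g (r i))) - \<zeta> e)) + (\<Sum>e\<in>F. cmod (cinner e (C (g (r j))) - \<zeta> e))"
      unfolding t_def sum.distrib[symmetric]
    proof (rule sum_mono)
      fix e
      have "cinner e (C d) = (cinner e (C (g (r i))) - \<zeta> e) - (cinner e (C (g (r j))) - \<zeta> e)"
        by (simp add: d_def blinfun.bilinear_simps cinner_diff_right)
      then show "cmod (cinner e (C d))
          \<le> cmod (cinner e (C (g (r i))) - \<zeta> e) + cmod (cinner e (C (g (r j))) - \<zeta> e)"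
        by (metis norm_triangle_ineq4)
    qed
    ultimately show ?thesis unfolding w_def d_def[symmetric] by argo
  qed
  have "Cauchy (\<lambda>n. g (r n))"
  proof (rule metric_CauchyI)
    fix \<epsilon> :: real assume "\<epsilon> > 0"
    then obtain N where N: "\<And>n. n \<ge> N \<Longrightarrow> norm (w n) < \<epsilon> / 2"
      using LIMSEQ_D[OF w, of "\<epsilon> / 2"] by auto
    have "dist (g (r i)) (g (r j)) < \<epsilon>" if "i \<ge> N" "j \<ge> N" for i j
      using N[OF that(1)] N[OF that(2)] close[of i j] by (simp add: dist_norm abs_less_iff)
    then show "\<exists>N. \<forall>i\<ge>N. \<forall>j\<ge>N. dist (g (r i)) (g (r j)) < \<epsilon>" by blast
  qed
  then obtain h where h: "(\<lambda>n. g (r n)) \<longlonglongrightarrow> h" using Cauchy_convergent_iff convergent_def by blast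
  have "h \<in> S" by (rule closed_sequentially[OF S(1) _ h]) (simp add: g(1))
  have "norm h = 1"
    using LIMSEQ_unique[OF tendsto_norm[OF h]] g(2) by simp
  have "(\<lambda>n. A (g n)) \<longlonglongrightarrow> 0"
  proof (rule Lim_null_comparison)
    show "\<forall>\<^sub>F n in sequentially. norm (A (g n)) \<le> 1 / real (Suc n)"
      using g(3) less_imp_le by (intro always_eventually) blast
    show "(\<lambda>n. 1 / real (Suc n)) \<longlonglongrightarrow> 0" by (rule LIMSEQ_Suc[OF lim_1_over_n])
  qed
  then have "(\<lambda>n. A (g (r n))) \<longlonglongrightarrow> 0" using LIMSEQ_subseq_LIMSEQ[OF _ r(1)] by (simp add: o_def)
  moreover have "(\<lambda>n. A (g (r n))) \<longlonglongrightarrow> A h" by (intro tendsto_intros h)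
  ultimately have "A h = 0" using LIMSEQ_unique by blast
  then have "cinner h h = 0" using \<open>h \<in> S\<close> by (simp add: S_def orth_complement_ker_def)
  then show False using \<open>norm h = 1\<close> by simp
qed

text \<open>The squared Hilbert-Schmidt norm is additive along \<open>X = X e\<^sub>1 + X e\<^sub>2\<close>.  The terms of the defining sum
  are not additive for an arbitrary basis, but those of the adjoint are: its values decompose
  orthogonally, and both sums agree.\<close>

lemma hs_norm_corner_mono:
  fixes S T e\<^sub>1 e\<^sub>2 :: "'a::complex_hilbert_space op"
  assumes hs: "hilbert_schmidt S" "hilbert_schmidt T"
    and e: "clinear_op e\<^sub>1" "clinear_op e\<^sub>2" "e\<^sub>1\<^sup>\<dagger> = e\<^sub>1" "e\<^sub>2\<^sup>\<dagger> = e\<^sub>2" "e\<^sub>1 \<cdot> e\<^sub>2 = 0"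
    and S: "S \<cdot> (e\<^sub>1 + e\<^sub>2) = S" and T: "T \<cdot> (e\<^sub>1 + e\<^sub>2) = T"
    and eq: "S \<cdot> e\<^sub>1 = T \<cdot> e\<^sub>1" and le: "\<And>x. norm ((T \<cdot> e\<^sub>2) x) \<le> norm ((S \<cdot> e\<^sub>2) x)"
  shows "hs_norm T \<le> hs_norm S"
proof -
  define E :: "'a set" where "E = (SOME E. onb_of UNIV E)"
  have E: "onb_of UNIV E"
    unfolding E_def by (rule someI_ex[OF hilbert_schmidt_onb[OF hs(1)]])
  have split: "(\<Sum>\<^sub>\<infinity>x\<in>E. (norm (X x))\<^sup>2)
      = (\<Sum>\<^sub>\<infinity>x\<in>E. (norm ((X \<cdot> e\<^sub>1) x))\<^sup>2) + (\<Sum>\<^sub>\<infinity>x\<in>E. (norm ((X \<cdot> e\<^sub>2) x))\<^sup>2)"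
    if X: "hilbert_schmidt X" "X \<cdot> (e\<^sub>1 + e\<^sub>2) = X" for X
  proof -
    have cl: "clinear_op X" using X(1) by (rule hilbert_schmidt_clinear)
    have adj: "X\<^sup>\<dagger> = (X \<cdot> e\<^sub>1)\<^sup>\<dagger> + (X \<cdot> e\<^sub>2)\<^sup>\<dagger>"
      using arg_cong[OF X(2), of adj] cl e by (simp add: op_simps)
    have pt: "(norm (X\<^sup>\<dagger> x))\<^sup>2 = (norm ((X \<cdot> e\<^sub>1)\<^sup>\<dagger> x))\<^sup>2 + (norm ((X \<cdot> e\<^sub>2)\<^sup>\<dagger> x))\<^sup>2" for x
    proof -
      have "cinner ((X \<cdot> e\<^sub>1)\<^sup>\<dagger> x) ((X \<cdot> e\<^sub>2)\<^sup>\<dagger> x) = cinner (X\<^sup>\<dagger> x) (e\<^sub>1 (e\<^sub>2 (X\<^sup>\<dagger> x)))"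
        using cinner_adj_left[OF e(1), of "X\<^sup>\<dagger> x"] e cl by simp
      also have "\<dots> = 0"
        using e(5) by (metis blinfun.zero_left op_apply cinner_zero_right)
      finally show ?thesis
        by (subst adj, subst blinfun.add_left) (rule norm_add_sq_orthogonal)
    qed
    have "(\<Sum>\<^sub>\<infinity>x\<in>E. (norm (X x))\<^sup>2) = (\<Sum>\<^sub>\<infinity>x\<in>E. (norm (X\<^sup>\<dagger> x))\<^sup>2)"
      by (rule infsum_norm_sq_adj[OF X(1) E, symmetric])
    also have "\<dots> = (\<Sum>\<^sub>\<infinity>x\<in>E. (norm ((X \<cdot> e\<^sub>1)\<^sup>\<dagger> x))\<^sup>2) + (\<Sum>\<^sub>\<infinity>x\<in>E. (norm ((X \<cdot> e\<^sub>2)\<^sup>\<dagger> x))\<^sup>2)"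
      unfolding pt by (intro infsum_add hilbert_schmidt_summable(2) E hilbert_schmidt_comp_right X(1) e)
    also have "\<dots> = (\<Sum>\<^sub>\<infinity>x\<in>E. (norm ((X \<cdot> e\<^sub>1) x))\<^sup>2) + (\<Sum>\<^sub>\<infinity>x\<in>E. (norm ((X \<cdot> e\<^sub>2) x))\<^sup>2)"
      by (intro arg_cong2[where f="(+)"] infsum_norm_sq_adj hilbert_schmidt_comp_right X(1) e E)
    finally show ?thesis .
  qed
  have "(\<Sum>\<^sub>\<infinity>x\<in>E. (norm ((T \<cdot> e\<^sub>2) x))\<^sup>2) \<le> (\<Sum>\<^sub>\<infinity>x\<in>E. (norm ((S \<cdot> e\<^sub>2) x))\<^sup>2)"
    by (intro infsum_mono hilbert_schmidt_summable(1) E hilbert_schmidt_comp_right hs e power_mono le norm_ge_zero)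
  then show ?thesis
    unfolding hs_norm_def E_def[symmetric] split[OF hs(1) S] split[OF hs(2) T] eq by simp
qed


section \<open>Conjugations\<close>

locale conjugation =
  fixes J :: "'a::complex_hilbert_space \<Rightarrow> 'a"
  assumes complex_conjugation: "complex_conjugation J"
begin

lemma J_add: "J (f + g) = J f + J g"
  and J_scaleC: "J (c *\<^sub>C f) = cnj c *\<^sub>C J f"
  and cinner_J_J: "cinner (J f) (J g) = cinner g f"
  and J_J [simp]: "J (J f) = f"
  using complex_conjugation unfolding complex_conjugation_def by auto

lemma cinner_J_left: "cinner (J f) g = cinner (J g) f"
  using cinner_J_J[of f "J g"] by simp

lemma norm_J [simp]: "norm (J f) = norm f"
proof -
  have "complex_of_real ((norm (J f))\<^sup>2) = of_real ((norm f)\<^sup>2)"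
    unfolding cinner_self[symmetric] by (rule cinner_J_J)
  then show ?thesis by (simp add: power2_eq_iff_nonneg flip: of_real_power)
qed

lemma J_scaleR: "J (r *\<^sub>R f) = r *\<^sub>R J f"
  using J_scaleC[of "of_real r" f] by (simp add: scaleC_of_real)

lemma bounded_linear_J: "bounded_linear J"
  by (rule bounded_linear_intro[where K=1]) (simp_all add: J_add J_scaleR)

interpretation J: bounded_linear J by (rule bounded_linear_J)

text \<open>The operator \<open>f \<mapsto> (A (f\<^sup>*))\<^sup>*\<close>; it is complex-linear for complex-linear \<open>A\<close>, and \<open>bar\<close> is
  an antilinear automorphism of the operator algebra that commutes with the adjoint.\<close>

abbreviation bar :: "'a op \<Rightarrow> 'a op" where "bar \<equiv> op_conj J"

lemma bar_apply [simp]: "bar A f = J (A (J f))"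
proof -
  have "bounded_linear (\<lambda>f. J (A (J f)))"
    by (rule bounded_linear_compose[OF bounded_linear_J
          bounded_linear_compose[OF blinfun.bounded_linear_right bounded_linear_J]])
  then show ?thesis by (simp add: op_conj_def bounded_linear_Blinfun_apply)
qed

lemma bar_bar [simp]: "bar (bar A) = A"
  and bar_zero [simp]: "bar 0 = 0"
  and bar_id [simp]: "bar id_blinfun = id_blinfun"
  and bar_add [simp]: "bar (A + B) = bar A + bar B"
  and bar_diff [simp]: "bar (A - B) = bar A - bar B"
  and bar_minus [simp]: "bar (- A) = - bar A"
  and bar_comp [simp]: "bar (A \<cdot> B) = bar A \<cdot> bar B"
  by (rule blinfun_eqI; simp add: blinfun.bilinear_simps J.zero J_add J.diff J.neg)+

lemma clinear_op_bar [simp]: "clinear_op A \<Longrightarrow> clinear_op (bar A)"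
  by (simp add: clinear_op_def J_scaleC)

lemma bar_adj:
  assumes "clinear_op A"
  shows "bar (A\<^sup>\<dagger>) = (bar A)\<^sup>\<dagger>"
proof (rule adjI[symmetric])
  fix f g
  have "cinner (J (A\<^sup>\<dagger> (J f))) g = cinner (J g) (A\<^sup>\<dagger> (J f))" by (rule cinner_J_left)
  also have "\<dots> = cinner (A (J g)) (J f)" using assms by (rule cinner_adj_right)
  also have "\<dots> = cinner f (J (A (J g)))" using cinner_J_J[of "J (A (J g))" f] by simp
  finally show "cinner (bar (A\<^sup>\<dagger>) f) g = cinner f (bar A g)" by simp
qed

lemma positive_op_bar:
  assumes "positive_op A"
  shows "positive_op (bar A)"
proof -
  have "cinner f (bar A f) = cnj (cinner (J f) (A (J f)))" for f
    using cinner_J_J[of "J f" "A (J f)"] cinner_commute[of "A (J f)" "J f"] by simp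
  then show ?thesis
    using assms unfolding positive_op_def
    by (simp add: complex_nonneg_Reals_iff clinear_op_bar del: bar_apply)
qed

lemma orth_projection_bar: "orth_projection A \<Longrightarrow> orth_projection (bar A)"
  unfolding orth_projection_def by (metis bar_adj bar_comp clinear_op_bar)

lemma moore_penrose_bar: "moore_penrose A B \<Longrightarrow> moore_penrose (bar A) (bar B)"
  unfolding moore_penrose_def by (metis bar_adj bar_comp clinear_op_bar clinear_op_comp)

lemma onb_of_image_J:
  assumes "onb_of UNIV E"
  shows "onb_of UNIV (J ` E)"
  unfolding onb_of_def
proof (intro conjI ballI)
  fix e f assume "e \<in> J ` E" "f \<in> J ` E"
  then obtain e' f' where *: "e' \<in> E" "f' \<in> E" "e = J e'" "f = J f'" by auto
  have "cinner f' e' = (if f' = e' then 1 else 0)"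
    using assms * by (auto simp: onb_of_def)
  moreover have "J e' = J f' \<longleftrightarrow> f' = e'" by (metis J_J)
  ultimately show "cinner e f = (if e = f then 1 else 0)" by (simp add: * cinner_J_J)
next
  have span: "J y \<in> complex_vector.span (J ` E)" if "y \<in> complex_vector.span E" for y
    using that
  proof (induction rule: complex_vector.span_induct_alt)
    case (step c e y)
    then show ?case
      by (simp add: J_add J_scaleC complex_vector.span_add complex_vector.span_scale complex_vector.span_base)
  qed (simp add: J.zero complex_vector.span_zero)
  have "x \<in> closure (complex_vector.span (J ` E))" for x
    unfolding closure_approachable
  proof (intro allI impI)
    fix \<epsilon> :: real assume "\<epsilon> > 0"
    have "J x \<in> closure (complex_vector.span E)" using assms by (simp add: onb_of_def)
    then obtain y where y: "y \<in> complex_vector.span E" "dist y (J x) < \<epsilon>"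
      using \<open>\<epsilon> > 0\<close> unfolding closure_approachable by blast
    have "dist (J y) x = dist y (J x)"
      using norm_J[of "y - J x"] by (simp add: dist_norm J.diff)
    then show "\<exists>z\<in>complex_vector.span (J ` E). dist z x < \<epsilon>" using span[OF y(1)] y(2) by metis
  qed
  then show "closure (complex_vector.span (J ` E)) = UNIV" by blast
qed

lemma hilbert_schmidt_bar [simp]:
  assumes "hilbert_schmidt A"
  shows "hilbert_schmidt (bar A)"
proof -
  obtain E :: "'a set" where E: "onb_of UNIV E" using hilbert_schmidt_onb[OF assms] by blast
  have "inj_on J E" by (metis J_J inj_onI)
  then have "(\<lambda>e. (norm (bar A e))\<^sup>2) summable_on J ` E"
    using hilbert_schmidt_summable(1)[OF assms E] by (simp add: summable_on_reindex o_def)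
  then show ?thesis
    using onb_of_image_J[OF E] assms by (auto simp: hilbert_schmidt_def)
qed

lemma polar_isometry_bar:
  assumes "clinear_op A" "clinear_op v" and "v \<cdot> (v\<^sup>\<dagger> \<cdot> v) = v" "positive_op R" "R \<cdot> R = A\<^sup>\<dagger> \<cdot> A" "A = v \<cdot> R"
    "\<And>x. v x = 0 \<longleftrightarrow> A x = 0" "v\<^sup>\<dagger> \<cdot> v = R \<cdot> X"
  shows "polar_isometry (bar A) = bar v"
proof (rule polar_isometry_eqI)
  show "bar v \<cdot> ((bar v)\<^sup>\<dagger> \<cdot> bar v) = bar v"
    using assms(2,3) by (metis bar_adj bar_comp)
  show "op_abs (bar A) = bar R"
    by (rule op_abs_eqI) (use assms in \<open>simp_all add: positive_op_bar flip: bar_comp bar_adj\<close>)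
  show "bar A = bar v \<cdot> bar R" using assms(6) by (metis bar_comp)
  show "(bar v)\<^sup>\<dagger> \<cdot> bar v = bar R \<cdot> bar X" using assms(2,8) by (metis bar_adj bar_comp)
  show "bar v f = 0 \<longleftrightarrow> bar A f = 0" for f
    using assms(7)[of "J f"] by (metis J.zero J_J bar_apply)
qed (use assms in simp)

section \<open>The partial isometry of an orthonormal basis\<close>

lemma bounded_linear_cinner_scaleC: "bounded_linear (\<lambda>f. cinner e f *\<^sub>C g)"
  by (rule bounded_linear_intro[where K="norm e * norm g"])
    (simp_all add: cinner_add_right scaleC_add_left scaleC_of_real[symmetric] scaleC_scaleC mult.assoc[symmetric],
      metis Cauchy_Schwarz_cinner mult.commute mult_right_mono norm_ge_zero)

lemma u_of_apply: "u_of J E f = (\<Sum>e\<in>E. cinner e f *\<^sub>C J e)"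
  by (simp add: u_of_def blinfun.sum_left bounded_linear_Blinfun_apply bounded_linear_cinner_scaleC)

lemma clinear_u_of: "clinear_op (u_of J E)"
  by (simp add: clinear_op_def u_of_apply complex_vector.scale_sum_right scaleC_scaleC)

lemma bar_u_of_apply: "bar (u_of J E) f = (\<Sum>e\<in>E. cinner (J e) f *\<^sub>C e)"
proof -
  have "cnj (cinner e (J f)) = cinner (J e) f" for e
    using cinner_commute[of "J f" e] cinner_J_left[of f e] by simp
  then show ?thesis by (simp add: u_of_apply J.sum J_scaleC)
qed

text \<open>\<open>u\<close> equals its transpose; this makes \<open>unitary_h\<close> self-adjoint.\<close>

lemma adj_u_of: "(u_of J E)\<^sup>\<dagger> = bar (u_of J E)"
proof (rule adjI)
  fix f g
  have "cinner (bar (u_of J E) f) g = (\<Sum>e\<in>E. cnj (cinner (J e) f) * cinner e g)"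
    by (simp add: bar_u_of_apply cinner_sum_left del: bar_apply)
  also have "\<dots> = cinner f (u_of J E g)"
    by (simp add: u_of_apply cinner_sum_right cinner_commute[of f] mult.commute)
  finally show "cinner (bar (u_of J E) f) g = cinner f (u_of J E g)" .
qed

lemma
  assumes p: "orth_projection p" and E: "onb_of (range p) E" and fin: "finite E"
  shows u_of_comp_projection: "u_of J E \<cdot> p = u_of J E"
    and adj_u_of_comp: "(u_of J E)\<^sup>\<dagger> \<cdot> u_of J E = p"
proof -
  have clp: "clinear_op p" and sap: "p\<^sup>\<dagger> = p" using p by (simp_all add: orth_projection_def)
  have on: "orthonormal E" and cl: "closure (complex_vector.span E) = range p"
    using E by (simp_all add: onb_of_iff)
  have "E \<subseteq> range p" unfolding cl[symmetric]
    using closure_subset complex_vector.span_superset by blast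
  then have pe: "p e = e" if "e \<in> E" for e using that orth_projection_fixed[OF p] by blast
  have ep: "cinner e (p f) = cinner e f" if "e \<in> E" for e f
    using cinner_adj_left[OF clp, of e f] sap pe[OF that] by simp
  then show "u_of J E \<cdot> p = u_of J E"
    by (intro blinfun_eqI) (simp add: u_of_apply)
  have "bar (u_of J E) (u_of J E f) = p f" for f
  proof -
    have "cinner (J e) (u_of J E f) = cinner e (p f)" if "e \<in> E" for e
    proof -
      have "cinner (J e) (u_of J E f) = (\<Sum>g\<in>E. cinner g f * cinner g e)"
        by (simp add: u_of_apply cinner_sum_right cinner_J_J)
      also have "\<dots> = (\<Sum>g\<in>E. if g = e then cinner e f else 0)"
        using on that by (intro sum.cong) (auto simp: orthonormal_def)
      finally show ?thesis using fin that ep by simp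
    qed
    then have "bar (u_of J E) (u_of J E f) = (\<Sum>e\<in>E. cinner e (p f) *\<^sub>C e)"
      by (simp add: bar_u_of_apply del: bar_apply)
    also have "\<dots> = p f"
    proof -
      have "p f - (\<Sum>e\<in>E. cinner e (p f) *\<^sub>C e) = 0"
      proof (rule ccontr)
        assume ne: "p f - (\<Sum>e\<in>E. cinner e (p f) *\<^sub>C e) \<noteq> 0"
        define \<delta> where "\<delta> = norm (p f - (\<Sum>e\<in>E. cinner e (p f) *\<^sub>C e))"
        have "\<delta> > 0" using ne by (simp add: \<delta>_def)
        moreover have "p f \<in> closure (complex_vector.span E)" unfolding cl by simp
        ultimately obtain z where "z \<in> complex_vector.span E" "dist z (p f) < \<delta>"
          unfolding closure_approachable by blast
        then show False
          using orthonormal_best_approximation[OF fin on, of z "p f"]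
          by (simp add: \<delta>_def dist_norm norm_minus_commute)
      qed
      then show ?thesis by simp
    qed
    finally show ?thesis .
  qed
  then show "(u_of J E)\<^sup>\<dagger> \<cdot> u_of J E = p"
    unfolding adj_u_of by (intro blinfun_eqI) (simp del: bar_apply)
qed

end

section \<open>Projections onto kernels\<close>

lemma projection_onto_ker:
  assumes P: "orth_projection P" and AP: "A \<cdot> P = A" and mp: "moore_penrose A B"
  shows "orth_projection (P - B \<cdot> A)" and "range (P - B \<cdot> A) = {f \<in> range P. A f = 0}"
proof -
  have cl: "clinear_op A" "clinear_op B" and ABA: "A \<cdot> (B \<cdot> A) = A"
    and BA: "(B \<cdot> A)\<^sup>\<dagger> = B \<cdot> A"
    using mp by (simp_all add: moore_penrose_def)
  have clP: "clinear_op P" and PP: "P \<cdot> P = P" and saP: "P\<^sup>\<dagger> = P"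
    using P by (simp_all add: orth_projection_def)
  have BAP: "B \<cdot> (A \<cdot> P) = B \<cdot> A" by (simp add: AP)
  have "((B \<cdot> A) \<cdot> P)\<^sup>\<dagger> = P \<cdot> (B \<cdot> A)" using cl clP saP BA by (subst adj_comp) auto
  then have PBA: "P \<cdot> (B \<cdot> A) = B \<cdot> A" using BA BAP by (simp add: comp_assoc)
  have BABA: "B \<cdot> (A \<cdot> (B \<cdot> A)) = B \<cdot> A" by (simp add: ABA)
  show proj: "orth_projection (P - B \<cdot> A)"
    unfolding orth_projection_def
    using cl clP BA saP by (simp add: op_simps comp_assoc PP BAP PBA BABA del: adj_comp)
  have 0: "A \<cdot> (P - B \<cdot> A) = 0" "P \<cdot> (P - B \<cdot> A) = P - B \<cdot> A"
    by (simp_all add: op_simps AP ABA PP PBA)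
  show "range (P - B \<cdot> A) = {f \<in> range P. A f = 0}"
  proof (intro equalityI subsetI)
    fix f assume "f \<in> range (P - B \<cdot> A)"
    then obtain g where g: "f = (P - B \<cdot> A) g" by blast
    have "A f = 0" unfolding g using 0(1) by (metis blinfun.zero_left op_apply)
    moreover have "P f = f" unfolding g using 0(2) by (metis op_apply)
    ultimately show "f \<in> {f \<in> range P. A f = 0}" by (metis (mono_tags) mem_Collect_eq rangeI)
  next
    fix f assume "f \<in> {f \<in> range P. A f = 0}"
    then have "P f = f" "A f = 0" using orth_projection_fixed[OF P] by auto
    then have "(P - B \<cdot> A) f = f" by (simp add: blinfun.bilinear_simps)
    then show "f \<in> range (P - B \<cdot> A)" by (metis rangeI)
  qed
qed

section \<open>Dimension of the cokernel\<close>

lemma complex_dimension_image: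
  fixes A B :: "'a::complex_hilbert_space op"
  assumes "clinear_op A" "clinear_op B" "B \<cdot> A = id_blinfun"
  shows "complex_dimension (A ` S) = complex_dimension S"
proof -
  have lin: "Vector_Spaces.linear scaleC scaleC (blinfun_apply C)" if "clinear_op C" for C :: "'a op"
    using that by unfold_locales (simp_all add: blinfun.bilinear_simps clinear_opD)
  have BA: "B (A x) = x" for x using assms(3) by (metis op_apply blinfun_apply_id_blinfun)
  interpret pair: vector_space_pair "scaleC :: complex \<Rightarrow> 'a \<Rightarrow> 'a" "scaleC :: complex \<Rightarrow> 'a \<Rightarrow> 'a"
    by unfold_locales
  have bounded: "\<exists>E. finite E \<and> C ` R \<subseteq> complex_vector.span E"
    if C: "clinear_op C" and R: "\<exists>E. finite E \<and> R \<subseteq> complex_vector.span E" for C :: "'a op" and R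
  proof -
    obtain E where E: "finite E" "R \<subseteq> complex_vector.span E" using R by blast
    then have "C ` R \<subseteq> complex_vector.span (C ` E)"
      unfolding pair.linear_span_image[OF lin[OF C]] by blast
    then show ?thesis using E(1) by blast
  qed
  have "B ` A ` S = S" by (simp add: image_image BA)
  then have "(\<exists>E. finite E \<and> A ` S \<subseteq> complex_vector.span E) \<longleftrightarrow> (\<exists>E. finite E \<and> S \<subseteq> complex_vector.span E)"
    using bounded[OF assms(1), of S] bounded[OF assms(2), of "A ` S"] by metis
  moreover have "complex_vector.dim (A ` S) = complex_vector.dim S"
  proof -
    obtain B' where B': "B' \<subseteq> S" "complex_vector.independent B'" "S \<subseteq> complex_vector.span B'"
        "card B' = complex_vector.dim S"
      using complex_vector.basis_exists by blast
    have inj: "inj_on A R" for R by (metis BA inj_onI)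
    have "complex_vector.span B' = complex_vector.span S"
      using B'(1,3) by (metis complex_vector.span_mono complex_vector.span_span subset_antisym)
    then have "complex_vector.span (A ` B') = complex_vector.span (A ` S)"
      by (simp add: pair.linear_span_image[OF lin[OF assms(1)]])
    moreover have "complex_vector.independent (A ` B')"
      by (rule pair.linear_independent_injective_image[OF lin[OF assms(1)] B'(2) inj])
    ultimately have "complex_vector.dim (A ` S) = card (A ` B')"
      by (rule complex_vector.dim_eq_card)
    then show ?thesis using B'(4) card_image[OF inj] by simp
  qed
  ultimately show ?thesis by (simp add: complex_dimension_def)
qed

text \<open>The bound by a finite span excludes the default value of the dimension of a space without finite
  basis.\<close>

lemma complex_dimension_eq_0_iff:
  assumes "0 \<in> S"
  shows "complex_dimension S = 0 \<longleftrightarrow> S = {0}"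
proof
  assume "complex_dimension S = 0"
  then obtain E where E: "finite E" "S \<subseteq> complex_vector.span E" and dim: "complex_vector.dim S = 0"
    by (auto simp: complex_dimension_def zero_enat_def split: if_splits)
  obtain B where B: "B \<subseteq> S" "complex_vector.independent B" "S \<subseteq> complex_vector.span B"
      "card B = complex_vector.dim S"
    using complex_vector.basis_exists by blast
  have "finite B" using complex_vector.independent_span_bound[OF E(1) B(2)] B(1) E(2) by blast
  then have "B = {}" using B(4) dim by simp
  then show "S = {0}" using B(3) assms by auto
next
  assume "S = {0}"
  moreover have "\<exists>E :: 'a set. finite E \<and> {0} \<subseteq> complex_vector.span E"
    using complex_vector.span_zero by blast
  moreover have "complex_vector.dim {0 :: 'a} = card ({} :: 'a set)"
    by (rule complex_vector.dim_eq_card) (simp_all add: complex_vector.independent_empty)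
  ultimately show "complex_dimension S = 0"
    by (auto simp: complex_dimension_def zero_enat_def)
qed

lemma M_of_eq_0_iff:
  fixes V :: "'a::complex_hilbert_space op"
  shows "M_of V = 0 \<longleftrightarrow> (\<forall>f. V\<^sup>\<dagger> f = 0 \<longrightarrow> f = 0)"
proof -
  have "M_of V = 0 \<longleftrightarrow> complex_dimension {f. V\<^sup>\<dagger> f = 0} = 0"
    by (cases "complex_dimension {f. V\<^sup>\<dagger> f = 0}")
      (auto simp: M_of_def ennreal_divide_eq_0_iff zero_enat_def)
  also have "\<dots> \<longleftrightarrow> (\<forall>f. V\<^sup>\<dagger> f = 0 \<longrightarrow> f = 0)"
    by (subst complex_dimension_eq_0_iff) (auto simp: blinfun.bilinear_simps)
  finally show ?thesis .
qed

section \<open>Components with respect to a basis projection\<close>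

locale basis_conjugation = conjugation J for J :: "'a::complex_hilbert_space \<Rightarrow> 'a" +
  fixes P :: "'a op"
  assumes basis_P: "basis_projection J P"
begin

abbreviation Q :: "'a op" where "Q \<equiv> compl_proj P"

lemma proj_P: "orth_projection P"
  and clinear_P [simp]: "clinear_op P"
  and adj_P [simp]: "P\<^sup>\<dagger> = P"
  and bar_P [simp]: "bar P = Q"
  using basis_P by (auto simp: basis_projection_def orth_projection_def compl_proj_def eq_diff_eq add.commute)

lemma bar_Q [simp]: "bar Q = P"
  by (metis bar_P bar_bar)

lemma proj_Q: "orth_projection Q"
  using orth_projection_bar[OF proj_P] by simp

lemma clinear_Q [simp]: "clinear_op Q"
  and adj_Q [simp]: "Q\<^sup>\<dagger> = Q"
  using proj_Q by (simp_all add: orth_projection_def)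

lemma PQ_sum: "P + Q = id_blinfun" by (simp add: compl_proj_def)

lemma PQ_rules: "P \<cdot> P = P" "Q \<cdot> Q = Q" "P \<cdot> Q = 0" "Q \<cdot> P = 0"
proof -
  show "P \<cdot> P = P" "Q \<cdot> Q = Q" using proj_P proj_Q by (simp_all add: orth_projection_def)
  then show "P \<cdot> Q = 0" "Q \<cdot> P = 0" by (simp_all add: compl_proj_def op_simps)
qed

lemma Q_comp: "Q \<cdot> A = A - P \<cdot> A" "A \<cdot> Q = A - A \<cdot> P"
  by (simp_all add: compl_proj_def op_simps)

text \<open>Operators on \<open>K\<^sub>1\<close> are extended by zero, so their kernels contain \<open>K\<^sub>2\<close>.\<close>

lemma orth_complement_ker_in_range_P:
  assumes "A \<cdot> Q = 0" and f: "f \<in> orth_complement_ker A"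
  shows "P f = f"
proof -
  have "A (Q f) = 0" using assms(1) by (metis blinfun.zero_left op_apply)
  then have "cinner (Q f) f = 0" using f by (simp add: orth_complement_ker_def)
  moreover have "cinner (Q f) f = cinner (Q f) (Q f)"
    using cinner_adj_left[OF clinear_Q, of "Q f" f] orth_projection_apply[OF proj_Q] by simp
  ultimately have "Q f = 0" by simp
  then show ?thesis by (simp add: compl_proj_def blinfun.bilinear_simps)
qed

lemma T_of_eq:
  assumes A: "moore_penrose (op11 P V) A" and B: "moore_penrose (op22 P V) B"
  shows "T_of P V = op21 P V \<cdot> A - B\<^sup>\<dagger> \<cdot> (op12 P V)\<^sup>\<dagger> \<cdot> (P - op11 P V \<cdot> A)"
proof -
  have cl: "clinear_op (op11 P V)" "clinear_op A" and AA: "(op11 P V \<cdot> A)\<^sup>\<dagger> = op11 P V \<cdot> A"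
    using A by (simp_all add: moore_penrose_def)
  have "P \<cdot> op11 P V = op11 P V"
    by (simp add: op11_def comp_assoc PQ_rules[THEN comp_extend])
  from arg_cong[OF this, of adj] have P: "(op11 P V)\<^sup>\<dagger> \<cdot> P = (op11 P V)\<^sup>\<dagger>" using cl by simp
  have "(op11 P V \<cdot> A) = A\<^sup>\<dagger> \<cdot> (op11 P V)\<^sup>\<dagger>" using AA cl by simp
  then have "proj_on (ker1 P ((op11 P V)\<^sup>\<dagger>)) = P - op11 P V \<cdot> A"
    unfolding ker1_def
    using projection_onto_ker[OF proj_P P moore_penrose_adj[OF A]] by (intro proj_on_eqI) auto
  then show ?thesis by (simp add: T_of_def gen_inv_eq[OF A] gen_inv_eq[OF B])
qed

lemma h_of_eq:
  assumes "moore_penrose (op22 P V) B"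
  shows "h_of P V = range (op12 P V \<cdot> (Q - B \<cdot> op22 P V))"
proof -
  have "op22 P V \<cdot> Q = op22 P V" by (simp add: op22_def comp_assoc PQ_rules)
  from projection_onto_ker(2)[OF proj_Q this assms]
  have "ker2 P (op22 P V) = range (Q - B \<cdot> op22 P V)" by (simp add: ker2_def)
  then show ?thesis by (simp add: h_of_def image_image)
qed

end

section \<open>Basis projections from antisymmetric operators\<close>

text \<open>The parameters of a basis projection near \<open>P\<close>: an antisymmetric Hilbert-Schmidt operator
  \<open>T\<close> from \<open>K\<^sub>1\<close> to \<open>K\<^sub>2\<close>, and the projection \<open>p\<close> onto a finite-dimensional subspace of the kernel of \<open>T\<close>
  in \<open>K\<^sub>1\<close>.\<close>

locale graph_data = basis_conjugation J P for J :: "'a::complex_hilbert_space \<Rightarrow> 'a" and P +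
  fixes T p :: "'a op"
  assumes hs_T [simp]: "hilbert_schmidt T" and T_P: "T \<cdot> P = T" and P_T: "P \<cdot> T = 0"
    and bar_T [simp]: "bar T = - T\<^sup>\<dagger>"
    and proj_p: "orth_projection p" and hs_p [simp]: "hilbert_schmidt p"
    and P_p: "P \<cdot> p = p" and T_p: "T \<cdot> p = 0"
begin

abbreviation p' :: "'a op" where "p' \<equiv> bar p"

lemma clinear_T [simp]: "clinear_op T" by (rule hilbert_schmidt_clinear) simp

lemma clinear_p [simp]: "clinear_op p" and adj_p [simp]: "p\<^sup>\<dagger> = p" and pp: "p \<cdot> p = p"
  using proj_p by (simp_all add: orth_projection_def)

lemma adj_p' [simp]: "p'\<^sup>\<dagger> = p'" using bar_adj[of p] by simp

lemma bar_adj_T [simp]: "bar (T\<^sup>\<dagger>) = - T" by (simp add: bar_adj)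

text \<open>Multiplication tables for \<open>P\<close>, \<open>Q\<close>, \<open>T\<close>, \<open>p\<close> and their conjugates.  Only the products of \<open>T\<close> and
  its adjoint remain irreducible.\<close>

lemma T_rules0: "T \<cdot> P = T" "P \<cdot> T = 0" "T \<cdot> Q = 0" "Q \<cdot> T = T"
  "T\<^sup>\<dagger> \<cdot> P = 0" "P \<cdot> T\<^sup>\<dagger> = T\<^sup>\<dagger>" "T\<^sup>\<dagger> \<cdot> Q = T\<^sup>\<dagger>" "Q \<cdot> T\<^sup>\<dagger> = 0"
proof -
  have "T\<^sup>\<dagger> \<cdot> P = 0" "P \<cdot> T\<^sup>\<dagger> = T\<^sup>\<dagger>"
    using arg_cong[OF P_T, of adj] arg_cong[OF T_P, of adj] by simp_all
  then show "T\<^sup>\<dagger> \<cdot> P = 0" "P \<cdot> T\<^sup>\<dagger> = T\<^sup>\<dagger>" "T\<^sup>\<dagger> \<cdot> Q = T\<^sup>\<dagger>"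
    "Q \<cdot> T\<^sup>\<dagger> = 0"
     "T \<cdot> P = T" "P \<cdot> T = 0" "T \<cdot> Q = 0" "Q \<cdot> T = T"
    by (simp_all add: T_P P_T Q_comp)
qed

lemma TT_rules: "T \<cdot> T = 0" "T\<^sup>\<dagger> \<cdot> T\<^sup>\<dagger> = 0"
  by (metis T_rules0 comp_assoc blinfun_compose_zero)+

lemma p_rules: "p \<cdot> p = p" "p' \<cdot> p' = p'" "P \<cdot> p = p" "p \<cdot> P = p" "Q \<cdot> p = 0" "p \<cdot> Q = 0"
  "P \<cdot> p' = 0" "p' \<cdot> P = 0" "Q \<cdot> p' = p'" "p' \<cdot> Q = p'" "p \<cdot> p' = 0" "p' \<cdot> p = 0"
proof -
  show 1: "p \<cdot> p = p" "p' \<cdot> p' = p'" "P \<cdot> p = p"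
    using pp P_p by (simp_all flip: bar_comp)
  show 2: "p \<cdot> P = p" using arg_cong[OF P_p, of adj] by simp
  show 3: "Q \<cdot> p = 0" "p \<cdot> Q = 0" using 1 2 by (simp_all add: Q_comp)
  show 4: "P \<cdot> p' = 0" "p' \<cdot> P = 0" "Q \<cdot> p' = p'" "p' \<cdot> Q = p'"
    using arg_cong[OF 3(1), of bar] arg_cong[OF 3(2), of bar] arg_cong[OF 1(3), of bar] arg_cong[OF 2, of bar]
    by simp_all
  show "p \<cdot> p' = 0" "p' \<cdot> p = 0"
    by (metis 1 2 4 comp_assoc blinfun_compose_zero)+
qed

lemma Tp_rules: "T \<cdot> p = 0" "p \<cdot> T = 0" "T \<cdot> p' = 0" "p' \<cdot> T = 0"
  "T\<^sup>\<dagger> \<cdot> p = 0" "p \<cdot> T\<^sup>\<dagger> = 0" "T\<^sup>\<dagger> \<cdot> p' = 0" "p' \<cdot> T\<^sup>\<dagger> = 0"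
proof -
  show 1: "T \<cdot> p = 0" by (rule T_p)
  show 2: "p \<cdot> T\<^sup>\<dagger> = 0" using arg_cong[OF 1, of adj] by simp
  show 3: "T\<^sup>\<dagger> \<cdot> p' = 0" using arg_cong[OF 1, of bar] by (simp add: op_simps)
  show 4: "p' \<cdot> T = 0" using arg_cong[OF 3, of adj] by simp
  show "p \<cdot> T = 0" "T \<cdot> p' = 0" "T\<^sup>\<dagger> \<cdot> p = 0" "p' \<cdot> T\<^sup>\<dagger> = 0"
    by (metis T_rules0 p_rules comp_assoc blinfun_compose_zero)+
qed

lemmas rules0 = PQ_rules T_rules0 TT_rules p_rules Tp_rules
lemmas rules1 = rules0 rules0[THEN comp_extend]

text \<open>\<open>gram\<close> restricts to \<open>1 + T\<^sup>\<dagger>T\<close> on \<open>K\<^sub>1\<close> and to \<open>1 + TT\<^sup>\<dagger>\<close> on \<open>K\<^sub>2\<close>.  Taking the root of both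
  at once makes \<open>T (1 + T\<^sup>\<dagger>T)\<^sup>1\<^sup>/\<^sup>2 = (1 + TT\<^sup>\<dagger>)\<^sup>1\<^sup>/\<^sup>2 T\<close> an instance of the fact that \<open>T\<close> commutes with
  \<open>root\<close>.\<close>

definition gram :: "'a op" where "gram = id_blinfun + T\<^sup>\<dagger> \<cdot> T + T \<cdot> T\<^sup>\<dagger>"
definition root :: "'a op" where "root = op_sqrt gram"

lemma positive_gram: "positive_op gram"
  unfolding gram_def using positive_op_gram[of T] positive_op_gram[of "T\<^sup>\<dagger>"] by simp

lemma positive_root: "positive_op root"
  and root_square: "root \<cdot> root = gram"
  and root_commute: "C \<cdot> gram = gram \<cdot> C \<Longrightarrow> C \<cdot> root = root \<cdot> C"
  unfolding root_def
  by (rule positive_op_sqrt[OF positive_gram] op_sqrt_square[OF positive_gram]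
      op_sqrt_commute[OF positive_gram], assumption?)+

lemma clinear_root [simp]: "clinear_op root" and adj_root [simp]: "root\<^sup>\<dagger> = root"
  using positive_root by (simp_all add: positive_op_clinear positive_op_self_adjoint)

lemma norm_le_root: "norm x \<le> norm (root x)"
proof -
  have "cinner x (gram x) = of_real ((norm (root x))\<^sup>2)"
    by (simp only: norm_sq_adj_comp[OF clinear_root] adj_root root_square)
  moreover have "cinner x (gram x) = of_real ((norm x)\<^sup>2 + (norm (T x))\<^sup>2 + (norm (T\<^sup>\<dagger> x))\<^sup>2)"
    using norm_sq_adj_comp[of T x] norm_sq_adj_comp[of "T\<^sup>\<dagger>" x]
    by (simp add: gram_def blinfun.bilinear_simps cinner_add_right cinner_self)
  ultimately have "(norm (root x))\<^sup>2 = (norm x)\<^sup>2 + (norm (T x))\<^sup>2 + (norm (T\<^sup>\<dagger> x))\<^sup>2"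
    by (metis of_real_eq_iff)
  then have "(norm x)\<^sup>2 \<le> (norm (root x))\<^sup>2" by simp
  then show ?thesis by (simp add: power2_le_iff_abs_le)
qed

definition iroot :: "'a op" where
  "iroot = (SOME B. clinear_op B \<and> root \<cdot> B = id_blinfun \<and> B \<cdot> root = id_blinfun)"

lemma clinear_iroot [simp]: "clinear_op iroot"
  and root_iroot: "root \<cdot> iroot = id_blinfun" and iroot_root: "iroot \<cdot> root = id_blinfun"
  using someI_ex[OF inverse_exists[OF clinear_root adj_root norm_le_root]]
  unfolding iroot_def by auto

lemma iroot_commute:
  assumes "C \<cdot> gram = gram \<cdot> C"
  shows "C \<cdot> iroot = iroot \<cdot> C"
proof -
  have "C \<cdot> iroot = iroot \<cdot> (root \<cdot> C) \<cdot> iroot"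
    by (simp add: iroot_root comp_assoc[symmetric])
  also have "\<dots> = iroot \<cdot> (C \<cdot> root) \<cdot> iroot" by (simp add: root_commute[OF assms])
  also have "\<dots> = iroot \<cdot> C" by (simp add: root_iroot comp_assoc)
  finally show ?thesis .
qed

lemma adj_iroot [simp]: "iroot\<^sup>\<dagger> = iroot"
proof -
  have "root \<cdot> iroot\<^sup>\<dagger> = id_blinfun" using arg_cong[OF iroot_root, of adj] by simp
  then show ?thesis by (metis comp_assoc id_comp iroot_root)
qed

text \<open>Antisymmetry of \<open>T\<close> exchanges the summands \<open>T\<^sup>\<dagger>T\<close> and \<open>TT\<^sup>\<dagger>\<close> of \<open>gram\<close>, and the positive root is
  unique.\<close>

lemma bar_root [simp]: "bar root = root"
proof -
  have "bar gram = gram" by (simp add: gram_def op_simps)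
  then have "bar root \<cdot> bar root = gram" by (metis bar_comp root_square)
  then have "op_sqrt gram = bar root" by (intro op_sqrt_eqI positive_op_bar positive_root)
  then show ?thesis by (simp add: root_def)
qed

lemma bar_iroot [simp]: "bar iroot = iroot"
proof -
  have "root \<cdot> bar iroot = id_blinfun" by (metis bar_comp bar_id bar_root root_iroot)
  then show ?thesis by (metis comp_assoc id_comp iroot_root)
qed

lemma gram_commute: "P \<cdot> gram = gram \<cdot> P" "Q \<cdot> gram = gram \<cdot> Q" "T \<cdot> gram = gram \<cdot> T"
  "T\<^sup>\<dagger> \<cdot> gram = gram \<cdot> T\<^sup>\<dagger>"
  by (simp_all add: gram_def op_simps comp_assoc rules1)

text \<open>\<open>D = root \<cdot> C - C\<close> satisfies \<open>D + root \<cdot> D = gram \<cdot> C - C = 0\<close>, and \<open>1 + root\<close> is injective.\<close>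

lemma gram_fixed:
  assumes "T \<cdot> C = 0" "T\<^sup>\<dagger> \<cdot> C = 0"
  shows "root \<cdot> C = C" "iroot \<cdot> C = C"
proof -
  define D where "D = root \<cdot> C - C"
  have "D x + root (D x) = 0" for x
  proof -
    have "D + root \<cdot> D = gram \<cdot> C - C"
      by (simp add: D_def op_simps comp_assoc root_square[THEN comp_extend])
    also have "\<dots> = 0" by (simp add: gram_def op_simps comp_assoc assms)
    finally show ?thesis by (metis blinfun.add_left blinfun.zero_left op_apply)
  qed
  then have "D x = 0" for x
    using norm_le_add_positive[OF positive_root, of "D x"] by simp
  then have "D = 0" by (intro blinfun_eqI) simp
  then show 1: "root \<cdot> C = C" by (simp add: D_def)
  show "iroot \<cdot> C = C" using iroot_root by (metis 1 comp_assoc id_comp(1))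
qed

lemma root_rules:
  "root \<cdot> iroot = id_blinfun" "iroot \<cdot> root = id_blinfun"
  "P \<cdot> root = root \<cdot> P" "Q \<cdot> root = root \<cdot> Q" "T \<cdot> root = root \<cdot> T" "T\<^sup>\<dagger> \<cdot> root = root \<cdot> T\<^sup>\<dagger>"
  "P \<cdot> iroot = iroot \<cdot> P" "Q \<cdot> iroot = iroot \<cdot> Q" "T \<cdot> iroot = iroot \<cdot> T"
    "T\<^sup>\<dagger> \<cdot> iroot = iroot \<cdot> T\<^sup>\<dagger>"
  "root \<cdot> p = p" "root \<cdot> p' = p'" "iroot \<cdot> p = p" "iroot \<cdot> p' = p'"
  "p \<cdot> root = p" "p' \<cdot> root = p'" "p \<cdot> iroot = p" "p' \<cdot> iroot = p'"
proof -
  show 1: "root \<cdot> p = p" "root \<cdot> p' = p'" "iroot \<cdot> p = p" "iroot \<cdot> p' = p'"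
    by (intro gram_fixed Tp_rules)+
  show "p \<cdot> root = p" "p' \<cdot> root = p'" "p \<cdot> iroot = p" "p' \<cdot> iroot = p'"
    using 1[THEN arg_cong, of adj] by simp_all
qed (intro root_iroot iroot_root root_commute iroot_commute gram_commute)+

text \<open>In normal forms \<open>root\<close> and \<open>iroot\<close> stand on the left.  The identity \<open>root \<cdot> root = gram\<close> is left
  out of the list, so that powers of \<open>root\<close> and \<open>iroot\<close> cancel before \<open>gram\<close> is expanded; where
  \<open>P + T\<^sup>\<dagger>T\<close> occurs it is folded by \<open>PT_rules\<close> instead.\<close>

lemmas rules2 = rules1 root_rules(1-2,11-18) root_rules(3-10) root_rules[THEN comp_extend]

lemma PT_rules: "P + T\<^sup>\<dagger> \<cdot> T = root \<cdot> (root \<cdot> P)" "Q + T \<cdot> T\<^sup>\<dagger> = root \<cdot> (root \<cdot> Q)"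
  by (simp_all add: root_square[THEN comp_extend] gram_def op_simps comp_assoc rules1)

lemma op_sqrt_P: "op_sqrt (P + T\<^sup>\<dagger> \<cdot> T) = root \<cdot> P"
proof (rule op_sqrt_eqI)
  have "positive_op (P\<^sup>\<dagger> \<cdot> root \<cdot> P)" by (rule positive_op_sandwich[OF positive_root]) simp
  then show "positive_op (root \<cdot> P)" by (simp add: comp_assoc rules2)
qed (simp add: PT_rules comp_assoc rules2)

lemma op_sqrt_Q: "op_sqrt (Q + T \<cdot> T\<^sup>\<dagger>) = root \<cdot> Q"
proof (rule op_sqrt_eqI)
  have "positive_op (Q\<^sup>\<dagger> \<cdot> root \<cdot> Q)" by (rule positive_op_sandwich[OF positive_root]) simp
  then show "positive_op (root \<cdot> Q)" by (simp add: comp_assoc rules2)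
qed (simp add: PT_rules comp_assoc rules2)

lemma gen_inv_rules:
  "gen_inv (P + T\<^sup>\<dagger> \<cdot> T) = iroot \<cdot> (iroot \<cdot> P)"
  "gen_inv (root \<cdot> P) = iroot \<cdot> P" "gen_inv (root \<cdot> Q) = iroot \<cdot> Q"
  by (rule gen_inv_eq, simp add: moore_penrose_def PT_rules comp_assoc rules2)+

lemma proj_T_eq: "proj_T P T = iroot \<cdot> (iroot \<cdot> (P + T + T\<^sup>\<dagger> + T \<cdot> T\<^sup>\<dagger>))"
  by (simp add: proj_T_def gen_inv_rules op_simps comp_assoc rules2)

lemma unitary_T_eq: "unitary_T P T = iroot \<cdot> (id_blinfun + T - T\<^sup>\<dagger>)"
proof -
  have "unitary_T P T = iroot \<cdot> (P + Q + T - T\<^sup>\<dagger>)"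
    unfolding unitary_T_def op_sqrt_P op_sqrt_Q gen_inv_rules
    by (simp add: op_simps comp_assoc rules2)
  then show ?thesis by (simp add: PQ_sum)
qed

text \<open>Because \<open>T\<^sup>2 = 0\<close>, the factor \<open>1 + T - T\<^sup>\<dagger>\<close> times its adjoint is \<open>gram\<close> in either order.\<close>

lemma unitary_T_unitary:
  "unitary_T P T \<cdot> (unitary_T P T)\<^sup>\<dagger> = id_blinfun" "(unitary_T P T)\<^sup>\<dagger> \<cdot> unitary_T P T = id_blinfun"
proof -
  have gram: "(id_blinfun + T - T\<^sup>\<dagger>) \<cdot> (id_blinfun + T\<^sup>\<dagger> - T) = root \<cdot> root"
    "(id_blinfun + T\<^sup>\<dagger> - T) \<cdot> (id_blinfun + T - T\<^sup>\<dagger>) = root \<cdot> root"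
    by (simp_all add: root_square gram_def op_simps comp_assoc rules1)
  have comm: "(id_blinfun + T\<^sup>\<dagger> - T) \<cdot> iroot = iroot \<cdot> (id_blinfun + T\<^sup>\<dagger> - T)"
    "(id_blinfun + T - T\<^sup>\<dagger>) \<cdot> iroot = iroot \<cdot> (id_blinfun + T - T\<^sup>\<dagger>)"
    by (simp_all add: op_simps rules2)
  have adj: "(unitary_T P T)\<^sup>\<dagger> = (id_blinfun + T\<^sup>\<dagger> - T) \<cdot> iroot"
    by (simp add: unitary_T_eq)
  have "unitary_T P T \<cdot> (unitary_T P T)\<^sup>\<dagger>
      = iroot \<cdot> ((id_blinfun + T - T\<^sup>\<dagger>) \<cdot> (id_blinfun + T\<^sup>\<dagger> - T)) \<cdot> iroot"
    unfolding adj unfolding unitary_T_eq by (simp only: comp_assoc)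
  then show "unitary_T P T \<cdot> (unitary_T P T)\<^sup>\<dagger> = id_blinfun"
    unfolding gram by (simp add: comp_assoc rules2)
  have "(unitary_T P T)\<^sup>\<dagger> \<cdot> unitary_T P T
      = iroot \<cdot> ((id_blinfun + T\<^sup>\<dagger> - T) \<cdot> (id_blinfun + T - T\<^sup>\<dagger>)) \<cdot> iroot"
    unfolding adj comm unfolding unitary_T_eq by (simp only: comp_assoc comm)
  then show "(unitary_T P T)\<^sup>\<dagger> \<cdot> unitary_T P T = id_blinfun"
    unfolding gram by (simp add: comp_assoc rules2)
qed

lemma clinear_unitary_T [simp]: "clinear_op (unitary_T P T)"
  by (simp add: unitary_T_eq)

lemma bar_unitary_T [simp]: "bar (unitary_T P T) = unitary_T P T"
  by (simp add: unitary_T_eq algebra_simps)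

lemma unitary_T_conj_P: "unitary_T P T \<cdot> (P \<cdot> (unitary_T P T)\<^sup>\<dagger>) = proj_T P T"
  by (simp add: unitary_T_eq proj_T_eq op_simps comp_assoc rules2)

definition graph_proj :: "'a op" where "graph_proj = proj_T P T - p + p'"

lemma graph_proj_eq: "graph_proj = iroot \<cdot> (iroot \<cdot> (P + T + T\<^sup>\<dagger> + T \<cdot> T\<^sup>\<dagger>)) - p + p'"
  by (simp add: graph_proj_def proj_T_eq)

text \<open>The range of \<open>graph_proj\<close> contains the graph of \<open>T\<close> over the orthogonal complement of the range
  of \<open>p\<close>.\<close>

lemma graph_proj_graph: "graph_proj \<cdot> (P + T) = P + T - p"
proof -
  have "(P + T + T\<^sup>\<dagger> + T \<cdot> T\<^sup>\<dagger>) \<cdot> (P + T) = (P + T) \<cdot> (P + T\<^sup>\<dagger> \<cdot> T)"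
    by (simp add: op_simps comp_assoc rules1 algebra_simps)
  also have "\<dots> = root \<cdot> (root \<cdot> (P + T))"
    unfolding PT_rules by (simp add: op_simps comp_assoc rules2)
  finally have "proj_T P T \<cdot> (P + T) = P + T"
    unfolding proj_T_eq by (simp only: comp_assoc) (simp add: rules2)
  moreover have "p \<cdot> (P + T) = p" "p' \<cdot> (P + T) = 0" by (simp_all add: op_simps rules1)
  ultimately show ?thesis
    unfolding graph_proj_def op_comp.add_left op_comp.diff_left by simp
qed

text \<open>\<open>proj_T P T\<close> is the image of \<open>P\<close> under a unitary that commutes with the conjugation, hence a basis
  projection; replacing \<open>p\<close>, which it dominates, by the conjugate of \<open>p\<close>, to which it is orthogonal,
  preserves this.\<close>

lemma basis_projection_graph_proj: "basis_projection J graph_proj"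
proof -
  let ?W = "unitary_T P T" and ?E = "proj_T P T"
  have E: "?E = ?W \<cdot> (P \<cdot> ?W\<^sup>\<dagger>)" by (simp only: unitary_T_conj_P)
  have adj: "?E\<^sup>\<dagger> = ?E" unfolding E by (simp add: comp_assoc)
  have "?E \<cdot> ?E = ?W \<cdot> (P \<cdot> ((?W\<^sup>\<dagger> \<cdot> ?W) \<cdot> (P \<cdot> ?W\<^sup>\<dagger>)))" unfolding E by (simp add: comp_assoc)
  also have "\<dots> = ?E" unfolding unitary_T_unitary by (simp add: rules1 E)
  finally have EE: "?E \<cdot> ?E = ?E" .
  have Ep: "?E \<cdot> p = p" "p \<cdot> ?E = p" "?E \<cdot> p' = 0" "p' \<cdot> ?E = 0"
    by (simp_all add: proj_T_eq op_simps comp_assoc rules2)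
  have bar_adj_W: "bar (?W\<^sup>\<dagger>) = ?W\<^sup>\<dagger>" by (simp add: bar_adj)
  have "?E + bar ?E = ?W \<cdot> ((P + Q) \<cdot> ?W\<^sup>\<dagger>)"
    unfolding E by (simp add: bar_adj_W op_simps)
  then have sum: "?E + bar ?E = id_blinfun" by (simp add: PQ_sum unitary_T_unitary)
  show ?thesis
    unfolding basis_projection_def orth_projection_def
    using sum by (simp add: graph_proj_def op_simps EE Ep rules1 adj proj_T_eq[THEN arg_cong, of clinear_op])
qed

lemma hs_P_graph_proj: "hilbert_schmidt (P - graph_proj)"
proof -
  have "iroot \<cdot> (iroot \<cdot> (P + T\<^sup>\<dagger> \<cdot> T)) = P" by (simp add: PT_rules rules2)
  then have "iroot \<cdot> (iroot \<cdot> P) = P - iroot \<cdot> (iroot \<cdot> (T\<^sup>\<dagger> \<cdot> T))"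
    by (simp add: op_simps eq_diff_eq)
  then have "P - graph_proj = iroot \<cdot> (iroot \<cdot> (T\<^sup>\<dagger> \<cdot> T - T - T\<^sup>\<dagger> - T \<cdot> T\<^sup>\<dagger>)) + p - p'"
    by (simp add: graph_proj_eq op_simps algebra_simps)
  then show ?thesis by simp
qed

lemma graph_proj_components:
  "op11 P graph_proj = iroot \<cdot> (iroot \<cdot> P) - p" "op21 P graph_proj = iroot \<cdot> (iroot \<cdot> T)"
  by (simp_all add: op11_def op21_def graph_proj_eq op_simps comp_assoc rules2)

lemma ker_graph_proj: "ker1 P (op11 P graph_proj) = range p"
proof (intro equalityI subsetI)
  fix f assume "f \<in> ker1 P (op11 P graph_proj)"
  then have f: "P f = f" "(iroot \<cdot> (iroot \<cdot> P) - p) f = 0"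
    using orth_projection_fixed[OF proj_P] by (auto simp: ker1_def graph_proj_components)
  have "P - p = root \<cdot> (root \<cdot> (iroot \<cdot> (iroot \<cdot> P) - p))" by (simp add: op_simps rules2)
  then have "(P - p) f = 0" using f(2) by (metis blinfun.zero_right op_apply)
  then show "f \<in> range p" using f(1) by (simp add: blinfun.bilinear_simps)
next
  fix f assume "f \<in> range p"
  then obtain g where g: "f = p g" by blast
  have "P \<cdot> p = p" "(iroot \<cdot> (iroot \<cdot> P) - p) \<cdot> p = 0" by (simp_all add: op_simps comp_assoc rules2)
  then show "f \<in> ker1 P (op11 P graph_proj)"
    unfolding ker1_def graph_proj_components g
    by (metis (mono_tags, lifting) blinfun.zero_left op_apply mem_Collect_eq rangeI)
qed

lemma graph_proj_quotient: "op21 P graph_proj \<cdot> gen_inv (op11 P graph_proj) = T"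
proof -
  have "gen_inv (op11 P graph_proj) = root \<cdot> (root \<cdot> P) - p"
    unfolding graph_proj_components
    by (rule gen_inv_eq) (simp add: moore_penrose_def op_simps comp_assoc rules2)
  then show ?thesis by (simp add: graph_proj_components op_simps comp_assoc rules2)
qed

end

section \<open>The unitary attached to an antisymmetric operator\<close>

locale graph_unitary = graph_data J P T p for J :: "'a::complex_hilbert_space \<Rightarrow> 'a" and P T p +
  fixes u :: "'a op"
  assumes clinear_u [simp]: "clinear_op u" and bar_u: "bar u = u\<^sup>\<dagger>"
    and adj_u_u: "u\<^sup>\<dagger> \<cdot> u = p" and u_p: "u \<cdot> p = u"
begin

lemma bar_adj_u: "bar (u\<^sup>\<dagger>) = u" by (metis bar_u bar_bar)

lemma u_rules1: "u\<^sup>\<dagger> \<cdot> u = p" "u \<cdot> u\<^sup>\<dagger> = p'" "u \<cdot> p = u" "p' \<cdot> u = u"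
  "p \<cdot> u\<^sup>\<dagger> = u\<^sup>\<dagger>" "u\<^sup>\<dagger> \<cdot> p' = u\<^sup>\<dagger>"
proof -
  show 1: "u\<^sup>\<dagger> \<cdot> u = p" "u \<cdot> p = u" by (rule adj_u_u u_p)+
  show 2: "u \<cdot> u\<^sup>\<dagger> = p'" using arg_cong[OF 1(1), of bar] by (simp add: bar_u bar_adj_u)
  show 3: "p \<cdot> u\<^sup>\<dagger> = u\<^sup>\<dagger>" using arg_cong[OF 1(2), of adj] by simp
  show 4: "p' \<cdot> u = u" by (metis 1 2 comp_assoc)
  show "u\<^sup>\<dagger> \<cdot> p' = u\<^sup>\<dagger>" using arg_cong[OF 4, of adj] by simp
qed

text \<open>Products of \<open>u\<close> with other operators are computed by inserting the projections onto its initial and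
  final spaces.\<close>

lemma u_comp:
  "u \<cdot> A = u \<cdot> (p \<cdot> A)" "A \<cdot> u = A \<cdot> p' \<cdot> u" "u\<^sup>\<dagger> \<cdot> A = u\<^sup>\<dagger> \<cdot> (p' \<cdot> A)"
    "A \<cdot> u\<^sup>\<dagger> = A \<cdot> p \<cdot> u\<^sup>\<dagger>"
  by (simp_all add: comp_assoc u_rules1 u_rules1[THEN comp_extend])

lemma u_rules2:
  "P \<cdot> u = 0" "u \<cdot> Q = 0" "Q \<cdot> u\<^sup>\<dagger> = 0" "u\<^sup>\<dagger> \<cdot> P = 0" "T \<cdot> u = 0" "u \<cdot> T = 0"
  "T\<^sup>\<dagger> \<cdot> u = 0" "u \<cdot> T\<^sup>\<dagger> = 0" "T \<cdot> u\<^sup>\<dagger> = 0" "u\<^sup>\<dagger> \<cdot> T = 0"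
  "T\<^sup>\<dagger> \<cdot> u\<^sup>\<dagger> = 0" "u\<^sup>\<dagger> \<cdot> T\<^sup>\<dagger> = 0" "u \<cdot> p' = 0" "p \<cdot> u = 0"
    "p' \<cdot> u\<^sup>\<dagger> = 0" "u\<^sup>\<dagger> \<cdot> p = 0"
  by (subst u_comp; simp add: rules2)+

lemma u_rules3:
  "Q \<cdot> u = u" "u \<cdot> P = u" "P \<cdot> u\<^sup>\<dagger> = u\<^sup>\<dagger>" "u\<^sup>\<dagger> \<cdot> Q = u\<^sup>\<dagger>"
  "root \<cdot> u = u" "u \<cdot> root = u" "root \<cdot> u\<^sup>\<dagger> = u\<^sup>\<dagger>" "u\<^sup>\<dagger> \<cdot> root = u\<^sup>\<dagger>"
  "iroot \<cdot> u = u" "u \<cdot> iroot = u" "iroot \<cdot> u\<^sup>\<dagger> = u\<^sup>\<dagger>" "u\<^sup>\<dagger> \<cdot> iroot = u\<^sup>\<dagger>"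
  by (subst u_comp, simp add: rules2 u_rules1)+

lemma u_rules4: "u \<cdot> u = 0" "u\<^sup>\<dagger> \<cdot> u\<^sup>\<dagger> = 0"
  by (metis u_rules1 u_rules2 comp_assoc blinfun_compose_zero)+

lemmas u_rules = u_rules1 u_rules2 u_rules3 u_rules4
lemmas rules3 = rules2 u_rules u_rules[THEN comp_extend]

lemma hs_u [simp]: "hilbert_schmidt u"
  using hilbert_schmidt_comp_left[OF hs_p clinear_u] by (simp add: u_p)

text \<open>\<open>U\<^sub>V\<close> in terms of the parameters alone.\<close>

definition graph_U :: "'a op" where
  "graph_U = unitary_T P T \<cdot> (id_blinfun - (p + u\<^sup>\<dagger> + u + p'))"

lemma graph_U_eq: "graph_U = iroot \<cdot> (id_blinfun + T - T\<^sup>\<dagger>) - (p + u\<^sup>\<dagger> + u + p')"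
  by (simp add: graph_U_def unitary_T_eq op_simps comp_assoc rules3)

lemma clinear_graph_U [simp]: "clinear_op graph_U" by (simp add: graph_U_eq)

lemma graph_U_unitary: "graph_U \<cdot> graph_U\<^sup>\<dagger> = id_blinfun" "graph_U\<^sup>\<dagger> \<cdot> graph_U = id_blinfun"
proof -
  define F where "F = id_blinfun - (p + u\<^sup>\<dagger> + u + p')"
  have F: "F\<^sup>\<dagger> = F" "clinear_op F" by (simp_all add: F_def algebra_simps)
  have FF: "F \<cdot> F = id_blinfun" by (simp add: F_def op_simps rules3)
  show "graph_U \<cdot> graph_U\<^sup>\<dagger> = id_blinfun"
    unfolding graph_U_def F_def[symmetric] using F FF unitary_T_unitary(1)
    by (simp add: comp_assoc FF[THEN comp_extend])
  show "graph_U\<^sup>\<dagger> \<cdot> graph_U = id_blinfun"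
    unfolding graph_U_def F_def[symmetric] using F FF unitary_T_unitary(2)
    by (simp add: comp_assoc unitary_T_unitary(2)[THEN comp_extend])
qed

lemma bar_graph_U [simp]: "bar graph_U = graph_U"
  by (simp add: graph_U_eq bar_u bar_adj_u op_simps algebra_simps)

text \<open>\<open>root - 1\<close> is dominated by \<open>(root + 1) (root - 1) = gram - 1\<close>, a Hilbert-Schmidt operator.\<close>

lemma hs_graph_U: "hilbert_schmidt (graph_U - id_blinfun)"
proof -
  have "hilbert_schmidt (root - id_blinfun)"
  proof (rule hilbert_schmidt_dominated[where K=1])
    show "hilbert_schmidt (T\<^sup>\<dagger> \<cdot> T + T \<cdot> T\<^sup>\<dagger>)" by simp
    show "norm ((root - id_blinfun) x) \<le> 1 * norm ((T\<^sup>\<dagger> \<cdot> T + T \<cdot> T\<^sup>\<dagger>) x)" for x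
    proof -
      define z where "z = (root - id_blinfun) x"
      have "(root + id_blinfun) \<cdot> (root - id_blinfun) = T\<^sup>\<dagger> \<cdot> T + T \<cdot> T\<^sup>\<dagger>"
        by (simp add: op_simps root_square gram_def)
      then have eq: "(T\<^sup>\<dagger> \<cdot> T + T \<cdot> T\<^sup>\<dagger>) x = root z + z"
        unfolding z_def by (metis blinfun.add_left op_apply blinfun_apply_id_blinfun)
      have "norm z \<le> norm (root z + z)"
        using norm_le_add_positive[OF positive_root, of z] by (simp add: add.commute)
      then show ?thesis unfolding eq z_def by simp
    qed
  qed simp
  moreover have "graph_U - id_blinfun = iroot \<cdot> (T - T\<^sup>\<dagger>) - iroot \<cdot> (root - id_blinfun) - (p + u\<^sup>\<dagger> + u + p')"
    by (simp add: graph_U_eq op_simps rules3)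
  ultimately show ?thesis by simp
qed

lemma graph_U_components:
  "op11 P graph_U = iroot \<cdot> P - p" "op12 P graph_U = - (iroot \<cdot> T\<^sup>\<dagger>) - u\<^sup>\<dagger>"
  "op21 P graph_U = iroot \<cdot> T - u" "op22 P graph_U = iroot \<cdot> Q - p'"
  by (simp_all add: op11_def op12_def op21_def op22_def graph_U_eq op_simps comp_assoc rules3)

lemma moore_penrose_graph_U:
  "moore_penrose (op11 P graph_U) (root \<cdot> P - p)" "moore_penrose (op22 P graph_U) (root \<cdot> Q - p')"
  by (simp_all add: graph_U_components moore_penrose_def op_simps comp_assoc rules3)

text \<open>The first term of \<open>T\<^sub>U\<close> is \<open>(iroot \<cdot> T - u) (root \<cdot> P - p) = T\<close>; the second term vanishes
  because \<open>U\<^sub>1\<^sub>2\<^sup>\<dagger> p = - u\<close> has values in the kernel of \<open>U\<^sub>2\<^sub>2\<close>.\<close>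

lemma T_of_graph_U: "T_of P graph_U = T"
  unfolding T_of_eq[OF moore_penrose_graph_U]
  by (simp add: graph_U_components op_simps comp_assoc rules3)

lemma h_of_graph_U: "h_of P graph_U = range p"
proof -
  have "op12 P graph_U \<cdot> (Q - (root \<cdot> Q - p') \<cdot> op22 P graph_U) = - u\<^sup>\<dagger>"
    by (simp add: graph_U_components op_simps comp_assoc rules3)
  then have "h_of P graph_U = range (- u\<^sup>\<dagger>)"
    using h_of_eq[OF moore_penrose_graph_U(2)] by simp
  also have "\<dots> = range p"
  proof (intro equalityI subsetI)
    fix f assume "f \<in> range (- u\<^sup>\<dagger>)"
    then obtain g where "f = (- u\<^sup>\<dagger>) g" by blast
    also have "- u\<^sup>\<dagger> = p \<cdot> (- u\<^sup>\<dagger>)" by (simp add: op_simps rules3)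
    finally show "f \<in> range p" by simp
  next
    fix f assume "f \<in> range p"
    then obtain g where "f = p g" by blast
    also have "p = (- u\<^sup>\<dagger>) \<cdot> (- u)" by (simp add: op_simps rules3)
    finally show "f \<in> range (- u\<^sup>\<dagger>)" by (metis op_apply rangeI)
  qed
  finally show ?thesis .
qed

lemma graph_U_conj_P: "graph_U \<cdot> (P \<cdot> graph_U\<^sup>\<dagger>) = graph_proj"
  by (simp add: graph_U_eq graph_proj_eq op_simps comp_assoc rules3)

end

section \<open>Bogoliubov operators\<close>

locale bogoliubov = basis_conjugation J P for J :: "'a::complex_hilbert_space \<Rightarrow> 'a" and P +
  fixes V :: "'a op"
  assumes V: "V \<in> Bogoliubov_P1 J P"
begin

abbreviation "a \<equiv> op11 P V"
abbreviation "b \<equiv> op12 P V"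
abbreviation "c \<equiv> op21 P V"
abbreviation "d \<equiv> op22 P V"

lemma clinear_V [simp]: "clinear_op V" and V_V: "V\<^sup>\<dagger> \<cdot> V = id_blinfun" and bar_V [simp]: "bar V = V"
  and hs_b [simp]: "hilbert_schmidt b"
  using V by (simp_all add: Bogoliubov_P1_def Bogoliubov_def)

lemma clinear_abcd [simp]: "clinear_op a" "clinear_op b" "clinear_op c" "clinear_op d"
  by (simp_all add: op11_def op12_def op21_def op22_def)

lemma bar_abcd [simp]: "bar a = d" "bar b = c" "bar c = b" "bar d = a"
  by (simp_all add: op11_def op12_def op21_def op22_def)

lemma hs_c [simp]: "hilbert_schmidt c"
  using hilbert_schmidt_bar[OF hs_b] by simp

lemma abcd_corners:
  "P \<cdot> a = a" "a \<cdot> P = a" "Q \<cdot> a = 0" "a \<cdot> Q = 0" "P \<cdot> b = b" "b \<cdot> Q = b" "Q \<cdot> b = 0" "b \<cdot> P = 0"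
  "Q \<cdot> c = c" "c \<cdot> P = c" "P \<cdot> c = 0" "c \<cdot> Q = 0" "Q \<cdot> d = d" "d \<cdot> Q = d" "P \<cdot> d = 0" "d \<cdot> P = 0"
  by (simp_all add: op11_def op12_def op21_def op22_def comp_assoc PQ_rules PQ_rules[THEN comp_extend])

lemma abcd_adj_corners:
  "P \<cdot> a\<^sup>\<dagger> = a\<^sup>\<dagger>" "a\<^sup>\<dagger> \<cdot> P = a\<^sup>\<dagger>" "Q \<cdot> a\<^sup>\<dagger> = 0"
    "a\<^sup>\<dagger> \<cdot> Q = 0" "b\<^sup>\<dagger> \<cdot> P = b\<^sup>\<dagger>" "Q \<cdot> b\<^sup>\<dagger> = b\<^sup>\<dagger>"
    "b\<^sup>\<dagger> \<cdot> Q = 0" "P \<cdot> b\<^sup>\<dagger> = 0"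
  "c\<^sup>\<dagger> \<cdot> Q = c\<^sup>\<dagger>" "P \<cdot> c\<^sup>\<dagger> = c\<^sup>\<dagger>" "c\<^sup>\<dagger> \<cdot> P = 0"
    "Q \<cdot> c\<^sup>\<dagger> = 0" "Q \<cdot> d\<^sup>\<dagger> = d\<^sup>\<dagger>" "d\<^sup>\<dagger> \<cdot> Q = d\<^sup>\<dagger>"
    "P \<cdot> d\<^sup>\<dagger> = 0" "d\<^sup>\<dagger> \<cdot> P = 0"
  using abcd_corners[THEN arg_cong, of adj] by simp_all

lemma isometry_components:
  "c\<^sup>\<dagger> \<cdot> c = P - a\<^sup>\<dagger> \<cdot> a" "b\<^sup>\<dagger> \<cdot> b = Q - d\<^sup>\<dagger> \<cdot> d"
    "a\<^sup>\<dagger> \<cdot> b = - (c\<^sup>\<dagger> \<cdot> d)" "b\<^sup>\<dagger> \<cdot> a = - (d\<^sup>\<dagger> \<cdot> c)"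
  using PQ_rules(1)
  by (simp_all add: op11_def op12_def op21_def op22_def compl_proj_def op_simps comp_assoc
      V_V V_V[THEN comp_extend] comp_extend[OF PQ_rules(1)])

lemma V_P: "V \<cdot> P = a + c" and V_Q: "V \<cdot> Q = b + d"
  by (simp_all add: op11_def op12_def op21_def op22_def compl_proj_def op_simps comp_assoc)

text \<open>On \<open>K\<^sub>1\<close> the isometry reads \<open>\<parallel>f\<parallel>\<^sup>2 = \<parallel>a f\<parallel>\<^sup>2 + \<parallel>c f\<parallel>\<^sup>2\<close> with \<open>c\<close> Hilbert-Schmidt.\<close>

lemma moore_penrose_a_exists: "\<exists>A. moore_penrose a A"
proof (rule moore_penrose_exists_mod_hilbert_schmidt[OF _ hs_c])
  fix f assume f: "f \<in> orth_complement_ker a"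
  have "P f = f" by (rule orth_complement_ker_in_range_P[OF abcd_corners(4) f])
  then have "V f = a f + c f" using V_P by (metis blinfun.add_left op_apply)
  moreover have "norm (V f) = norm f"
    using norm_sq_adj_comp[OF clinear_V, of f] V_V
    by (simp add: cinner_self power2_eq_iff_nonneg flip: of_real_power)
  ultimately show "norm f \<le> norm (a f) + norm (c f)" by (metis norm_triangle_ineq)
qed simp

definition a_inv :: "'a op" where "a_inv = (SOME A. moore_penrose a A)"
abbreviation d_inv :: "'a op" where "d_inv \<equiv> bar a_inv"

lemma moore_penrose_a: "moore_penrose a a_inv"
  unfolding a_inv_def by (rule someI_ex[OF moore_penrose_a_exists])

lemma moore_penrose_d: "moore_penrose d d_inv"
  using moore_penrose_bar[OF moore_penrose_a] by simp

lemma clinear_a_inv [simp]: "clinear_op a_inv" using moore_penrose_a by (simp add: moore_penrose_def)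

lemma a_inv_rules: "a \<cdot> (a_inv \<cdot> a) = a" "a_inv \<cdot> (a \<cdot> a_inv) = a_inv"
  "a_inv\<^sup>\<dagger> \<cdot> a\<^sup>\<dagger> = a \<cdot> a_inv" "a\<^sup>\<dagger> \<cdot> a_inv\<^sup>\<dagger> = a_inv \<cdot> a"
  using moore_penrose_a by (simp_all add: moore_penrose_def)

lemma a_inv_corners: "P \<cdot> a_inv = a_inv" "a_inv \<cdot> P = a_inv" "Q \<cdot> a_inv = 0" "a_inv \<cdot> Q = 0"
proof -
  show 1: "P \<cdot> a_inv = a_inv"
    by (metis a_inv_rules(2,4) comp_assoc abcd_adj_corners(1))
  show 2: "a_inv \<cdot> P = a_inv"
    by (metis a_inv_rules(2,3) comp_assoc abcd_adj_corners(2))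
  show "Q \<cdot> a_inv = 0" "a_inv \<cdot> Q = 0" by (simp_all add: Q_comp 1 2)
qed

text \<open>The orthogonal projections onto the kernels of \<open>a\<^sup>\<dagger>\<close> and \<open>a\<close> in \<open>K\<^sub>1\<close>; the conjugates are those
  for \<open>d\<close> in \<open>K\<^sub>2\<close>.\<close>

definition coker_a :: "'a op" where "coker_a = P - a \<cdot> a_inv"
definition ker_a :: "'a op" where "ker_a = P - a_inv \<cdot> a"
abbreviation coker_d :: "'a op" where "coker_d \<equiv> bar coker_a"
abbreviation ker_d :: "'a op" where "ker_d \<equiv> bar ker_a"

lemma ker_clinear [simp]: "clinear_op coker_a" "clinear_op ker_a" by (simp_all add: coker_a_def ker_a_def)

lemma ker_adj [simp]: "coker_a\<^sup>\<dagger> = coker_a" "ker_a\<^sup>\<dagger> = ker_a" "coker_d\<^sup>\<dagger> = coker_d" "ker_d\<^sup>\<dagger> = ker_d"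
proof -
  show 1: "coker_a\<^sup>\<dagger> = coker_a" "ker_a\<^sup>\<dagger> = ker_a" by (simp_all add: coker_a_def ker_a_def a_inv_rules)
  show "coker_d\<^sup>\<dagger> = coker_d" "ker_d\<^sup>\<dagger> = ker_d" using 1 bar_adj[of coker_a] bar_adj[of ker_a] by simp_all
qed

lemma ker_rules1: "coker_a \<cdot> a = 0" "a \<cdot> ker_a = 0" "a_inv \<cdot> coker_a = 0" "ker_a \<cdot> a_inv = 0" "coker_a \<cdot> coker_a = coker_a"
  "ker_a \<cdot> ker_a = ker_a"
  "P \<cdot> coker_a = coker_a" "coker_a \<cdot> P = coker_a" "P \<cdot> ker_a = ker_a" "ker_a \<cdot> P = ker_a"
  by (simp_all add: coker_a_def ker_a_def op_simps comp_assoc a_inv_rules a_inv_corners abcd_corners PQ_rules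
     a_inv_rules[THEN comp_extend] a_inv_corners[THEN comp_extend] abcd_corners[THEN comp_extend])

lemma ker_rules2: "coker_d \<cdot> d = 0" "d \<cdot> ker_d = 0" "d_inv \<cdot> coker_d = 0" "ker_d \<cdot> d_inv = 0" "coker_d \<cdot> coker_d = coker_d"
  "ker_d \<cdot> ker_d = ker_d"
  "Q \<cdot> coker_d = coker_d" "coker_d \<cdot> Q = coker_d" "Q \<cdot> ker_d = ker_d" "ker_d \<cdot> Q = ker_d"
  using ker_rules1[THEN arg_cong, of bar] by simp_all

lemma ker_rules3: "a\<^sup>\<dagger> \<cdot> coker_a = 0" "ker_a \<cdot> a\<^sup>\<dagger> = 0" "coker_a \<cdot> a_inv\<^sup>\<dagger> = 0"
  "a_inv\<^sup>\<dagger> \<cdot> ker_a = 0"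
  "d\<^sup>\<dagger> \<cdot> coker_d = 0" "ker_d \<cdot> d\<^sup>\<dagger> = 0" "coker_d \<cdot> d_inv\<^sup>\<dagger> = 0" "d_inv\<^sup>\<dagger> \<cdot> ker_d = 0"
  using ker_rules1(1-4)[THEN arg_cong, of adj] ker_rules2(1-4)[THEN arg_cong, of adj] by simp_all

lemmas ker_rules = ker_rules1 ker_rules2 ker_rules3

lemma P_split: "a \<cdot> a_inv + coker_a = P" "a_inv \<cdot> a + ker_a = P"
  by (simp_all add: coker_a_def ker_a_def)

lemma Q_split: "d \<cdot> d_inv + coker_d = Q" "d_inv \<cdot> d + ker_d = Q"
  using P_split[THEN arg_cong, of bar] by simp_all

text \<open>\<open>b\<close> maps the kernel of \<open>d\<close> into the kernel of \<open>a\<^sup>\<dagger>\<close>, since \<open>a\<^sup>\<dagger> b = - c\<^sup>\<dagger> d\<close>.\<close>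

lemma a_inv_b_ker_d: "a_inv \<cdot> (b \<cdot> ker_d) = 0"
proof -
  have "a_inv \<cdot> (b \<cdot> ker_d) = a_inv \<cdot> (a_inv\<^sup>\<dagger> \<cdot> ((a\<^sup>\<dagger> \<cdot> b) \<cdot> ker_d))"
    by (metis comp_assoc a_inv_rules(2,3))
  also have "\<dots> = 0" by (simp add: isometry_components op_simps comp_assoc ker_rules)
  finally show ?thesis .
qed

abbreviation T :: "'a op" where "T \<equiv> T_of P V"

lemma T_eq: "T = c \<cdot> a_inv - d_inv\<^sup>\<dagger> \<cdot> (b\<^sup>\<dagger> \<cdot> coker_a)"
  by (simp add: T_of_eq[OF moore_penrose_a moore_penrose_d] coker_a_def comp_assoc)

text \<open>\<open>b\<close> is isometric on the kernel of \<open>d\<close>, so this is the projection onto \<open>h\<^sub>V\<close>; in this form it is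
  visibly Hilbert-Schmidt.\<close>

definition p :: "'a op" where "p = b \<cdot> (ker_d \<cdot> b\<^sup>\<dagger>)"

lemma adj_b_b_ker_d: "b\<^sup>\<dagger> \<cdot> (b \<cdot> ker_d) = ker_d"
  by (simp add: isometry_components[THEN comp_extend] op_simps comp_assoc ker_rules)

lemma orth_projection_p: "orth_projection p"
proof -
  have "p \<cdot> p = b \<cdot> (ker_d \<cdot> ((b\<^sup>\<dagger> \<cdot> (b \<cdot> ker_d)) \<cdot> b\<^sup>\<dagger>))" by (simp add: p_def comp_assoc)
  also have "\<dots> = p" unfolding adj_b_b_ker_d by (simp add: p_def ker_rules[THEN comp_extend])
  finally show ?thesis unfolding orth_projection_def by (simp add: p_def comp_assoc)
qed

lemma range_p: "range p = h_of P V"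
proof -
  have h: "h_of P V = range (b \<cdot> ker_d)"
    using h_of_eq[OF moore_penrose_d] Q_split by (simp add: eq_diff_eq[symmetric] add.commute flip: diff_eq_eq)
  have "p = (b \<cdot> ker_d) \<cdot> b\<^sup>\<dagger>" "b \<cdot> ker_d = p \<cdot> (b \<cdot> ker_d)"
    by (simp_all add: p_def comp_assoc adj_b_b_ker_d ker_rules)
  then show ?thesis unfolding h by (rule range_eq_of_factors)
qed

text \<open>The second term of \<open>T\<^sub>V\<close> extends \<open>c a\<^sup>-\<^sup>1\<close> from the range of \<open>a\<close> antisymmetrically to \<open>K\<^sub>1\<close>.  The
  relation behind this is the vanishing of the off-diagonal component of \<open>V\<^sup>\<dagger> V\<close>.\<close>

lemma bar_T_of: "bar T = - T\<^sup>\<dagger>"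
proof -
  have barT: "bar T = b \<cdot> d_inv - a_inv\<^sup>\<dagger> \<cdot> (c\<^sup>\<dagger> \<cdot> coker_d)" by (simp add: T_eq bar_adj)
  have adjT: "T\<^sup>\<dagger> = a_inv\<^sup>\<dagger> \<cdot> c\<^sup>\<dagger> - coker_a \<cdot> (b \<cdot> d_inv)" by (simp add: T_eq comp_assoc)
  have "bar T + T\<^sup>\<dagger> = (P - coker_a) \<cdot> (b \<cdot> d_inv) + a_inv\<^sup>\<dagger> \<cdot> (c\<^sup>\<dagger> \<cdot> (Q - coker_d))"
    unfolding barT adjT
    by (simp add: op_simps comp_assoc abcd_corners[THEN comp_extend] abcd_adj_corners algebra_simps)
  also have "P - coker_a = a_inv\<^sup>\<dagger> \<cdot> a\<^sup>\<dagger>" by (simp add: coker_a_def a_inv_rules)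
  also have "Q - coker_d = d \<cdot> d_inv" by (simp add: Q_split(1)[symmetric])
  also have "(a_inv\<^sup>\<dagger> \<cdot> a\<^sup>\<dagger>) \<cdot> (b \<cdot> d_inv) + a_inv\<^sup>\<dagger> \<cdot> (c\<^sup>\<dagger> \<cdot> (d \<cdot> d_inv)) = a_inv\<^sup>\<dagger> \<cdot> ((a\<^sup>\<dagger> \<cdot> b + c\<^sup>\<dagger> \<cdot> d) \<cdot> d_inv)"
    by (simp add: op_simps comp_assoc)
  also have "\<dots> = 0" by (simp add: isometry_components)
  finally show ?thesis by (simp add: eq_neg_iff_add_eq_0)
qed

lemma T_of_comp_p: "T \<cdot> p = 0"
proof -
  have "T \<cdot> p = c \<cdot> ((a_inv \<cdot> (b \<cdot> ker_d)) \<cdot> b\<^sup>\<dagger>) - d_inv\<^sup>\<dagger> \<cdot> (b\<^sup>\<dagger> \<cdot> ((coker_a \<cdot> (b \<cdot> ker_d)) \<cdot> b\<^sup>\<dagger>))"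
    by (simp add: T_eq p_def op_simps comp_assoc)
  also have "coker_a \<cdot> (b \<cdot> ker_d) = b \<cdot> ker_d"
    by (simp add: coker_a_def op_simps comp_assoc a_inv_b_ker_d abcd_corners[THEN comp_extend])
  also have "b\<^sup>\<dagger> \<cdot> ((b \<cdot> ker_d) \<cdot> b\<^sup>\<dagger>) = ker_d \<cdot> b\<^sup>\<dagger>"
    using adj_b_b_ker_d by (metis comp_assoc)
  finally show ?thesis by (simp add: a_inv_b_ker_d ker_rules[THEN comp_extend])
qed

sublocale graph_data J P T p
proof
  show "hilbert_schmidt T" by (simp add: T_eq)
  show "T \<cdot> P = T" by (simp add: T_eq op_simps comp_assoc a_inv_corners ker_rules)
  have "P \<cdot> d_inv\<^sup>\<dagger> = 0"
    using a_inv_corners(4)[THEN arg_cong, of bar, THEN arg_cong, of adj] by simp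
  then show "P \<cdot> T = 0"
    by (simp add: T_eq op_simps comp_assoc abcd_corners[THEN comp_extend] comp_extend[of P "d_inv\<^sup>\<dagger>"])
  show "hilbert_schmidt p" by (simp add: p_def)
  show "P \<cdot> p = p" by (simp add: p_def abcd_corners[THEN comp_extend])
qed (rule bar_T_of orth_projection_p T_of_comp_p)+

lemma proj_on_h: "proj_on (h_of P V) = p"
  using proj_on_eqI[OF proj_p range_p] .

lemma P_of_eq: "P_of J P V = graph_proj"
  by (simp add: P_of_def proj_on_h graph_proj_def)

lemma p_a: "p \<cdot> a = 0"
  by (simp add: p_def comp_assoc isometry_components op_simps ker_rules[THEN comp_extend])

lemma p'_eq: "p' = c \<cdot> (ker_a \<cdot> c\<^sup>\<dagger>)"
  by (simp add: p_def bar_adj)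

text \<open>\<open>c\<close> maps the kernel of \<open>a\<close> isometrically onto the conjugate of \<open>h\<^sub>V\<close>, and its orthogonal complement
  into the orthogonal complement.\<close>

lemma p'_c: "p' \<cdot> c = c \<cdot> ker_a"
  by (simp add: p'_eq comp_assoc isometry_components op_simps ker_rules ker_rules[THEN comp_extend])

lemma T_a: "T \<cdot> a = c - c \<cdot> ker_a"
  by (simp add: T_eq op_simps comp_assoc ker_rules ker_a_def abcd_corners)

text \<open>A vector \<open>V f\<close> with \<open>f \<in> K\<^sub>1\<close> is the sum of \<open>a f + T (a f)\<close> in the graph of \<open>T\<close> and of the image under
  \<open>c\<close> of the component of \<open>f\<close> in the kernel of \<open>a\<close>, which lies in the conjugate of \<open>h\<^sub>V\<close>.\<close>

lemma graph_proj_V_P: "graph_proj \<cdot> (V \<cdot> P) = V \<cdot> P"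
proof -
  have "V \<cdot> P = (P + T) \<cdot> a + c \<cdot> ker_a" by (simp add: V_P op_simps abcd_corners T_a)
  moreover have "graph_proj \<cdot> ((P + T) \<cdot> a) = (P + T) \<cdot> a"
    unfolding comp_extend[OF graph_proj_graph] by (simp add: op_simps p_a)
  moreover have "graph_proj \<cdot> (c \<cdot> ker_a) = c \<cdot> ker_a"
  proof -
    have "graph_proj \<cdot> p' = p'" by (simp add: graph_proj_eq op_simps comp_assoc rules2)
    then show ?thesis using p'_c by (metis comp_assoc ker_rules(6))
  qed
  ultimately show ?thesis by (simp add: op_simps)
qed

text \<open>The conjugate of the previous identity describes \<open>V\<close> on \<open>K\<^sub>2\<close>.\<close>

lemma graph_proj_V: "graph_proj \<cdot> V = V \<cdot> P"
proof -
  have "bar graph_proj = id_blinfun - graph_proj"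
    using basis_projection_graph_proj by (auto simp: basis_projection_def eq_diff_eq add.commute)
  then have "(id_blinfun - graph_proj) \<cdot> (V \<cdot> Q) = V \<cdot> Q"
    using graph_proj_V_P[THEN arg_cong, of bar] by simp
  then have "graph_proj \<cdot> (V \<cdot> Q) = 0" by (simp add: op_simps)
  moreover have "V = V \<cdot> P + V \<cdot> Q" by (simp add: PQ_sum flip: op_comp.add_right)
  ultimately show ?thesis using graph_proj_V_P by (metis add.right_neutral op_comp.add_right)
qed

section \<open>Minimality of the graph operator\<close>

text \<open>\<open>\<parallel>R V f\<parallel>\<^sup>2 = \<langle>f, P f\<rangle>\<close> is \<open>\<parallel>V f\<parallel>\<^sup>2\<close> for \<open>f \<in> K\<^sub>1\<close> and \<open>0\<close> for \<open>f \<in> K\<^sub>2\<close>; so \<open>R\<close> fixes the first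
  kind of vectors \<open>V f\<close> and annihilates the second.\<close>

lemma intertwining:
  assumes R: "basis_projection J R" and VRV: "V\<^sup>\<dagger> \<cdot> R \<cdot> V = P"
  shows "R \<cdot> V = V \<cdot> P"
proof -
  have clR: "clinear_op R" and RR: "R \<cdot> R = R" and saR: "R\<^sup>\<dagger> = R"
    using R by (simp_all add: basis_projection_def orth_projection_def)
  have VRV': "V\<^sup>\<dagger> \<cdot> (R \<cdot> V) = P" using VRV by (simp add: comp_assoc)
  define D where "D = V \<cdot> P - R \<cdot> (V \<cdot> P)"
  define F where "F = R \<cdot> (V \<cdot> Q)"
  have "D\<^sup>\<dagger> \<cdot> D = 0"
    by (simp add: D_def clR saR op_simps comp_assoc RR RR[THEN comp_extend] V_V[THEN comp_extend]
        VRV'[THEN comp_extend, unfolded comp_assoc] PQ_rules)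
  then have "D = 0" using adj_comp_self_eq_0_iff[of D] by (simp add: D_def clR)
  have "F\<^sup>\<dagger> \<cdot> F = 0"
    by (simp add: F_def clR saR comp_assoc RR[THEN comp_extend]
        VRV'[THEN comp_extend, unfolded comp_assoc] PQ_rules)
  then have "F = 0" using adj_comp_self_eq_0_iff[of F] by (simp add: F_def clR)
  have "R \<cdot> V = R \<cdot> (V \<cdot> P) + R \<cdot> (V \<cdot> Q)" by (simp add: PQ_sum flip: op_comp.add_right)
  then show ?thesis using \<open>D = 0\<close> \<open>F = 0\<close> by (simp add: D_def F_def)
qed

text \<open>\<open>h\<^sub>V\<close> consists of vectors \<open>V f\<close> with \<open>f \<in> K\<^sub>2\<close>.\<close>

lemma intertwining_p:
  assumes "R \<cdot> V = V \<cdot> P"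
  shows "R \<cdot> p = 0"
proof -
  have "b \<cdot> ker_d = V \<cdot> ker_d"
    using V_Q[THEN arg_cong, of "\<lambda>A. A \<cdot> ker_d"] by (simp add: op_simps comp_assoc ker_rules)
  then have "R \<cdot> (b \<cdot> ker_d) = V \<cdot> (P \<cdot> ker_d)" using assms by (metis comp_assoc)
  also have "P \<cdot> ker_d = 0" using comp_extend[OF PQ_rules(3), of ker_d] by (simp add: ker_rules)
  finally show ?thesis by (simp add: p_def flip: comp_assoc)
qed

lemma h_subset_ker:
  assumes "R \<cdot> V = V \<cdot> P"
  shows "h_of P V \<subseteq> ker1 P (op11 P R)"
proof
  fix f assume "f \<in> h_of P V"
  then obtain g where g: "f = p g" using range_p by blast
  have "P f = f" using p_rules(3) g by (metis op_apply)
  moreover have "op11 P R \<cdot> p = 0"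
    by (simp add: op11_def comp_assoc p_rules intertwining_p[OF assms])
  then have "op11 P R f = 0" unfolding g by (metis blinfun.zero_left op_apply)
  ultimately show "f \<in> ker1 P (op11 P R)" unfolding ker1_def by (metis (mono_tags) mem_Collect_eq rangeI)
qed

text \<open>Let \<open>S\<close> be the graph operator of \<open>R\<close>.  It agrees with \<open>T\<close> on the range of \<open>a\<close>, so \<open>D = S - T\<close> factors
  through \<open>coker_a\<close>; as both operators are antisymmetric, the values of \<open>D\<close> lie in the range of
  \<open>coker_d\<close>.  \<open>T \<cdot> coker_a\<close> has no component there, hence \<open>\<parallel>S f\<parallel>\<^sup>2 = \<parallel>T f\<parallel>\<^sup>2 + \<parallel>D f\<parallel>\<^sup>2\<close> for
  \<open>f \<in> ker a\<^sup>\<dagger>\<close>.\<close>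

lemma hs_norm_minimal:
  assumes R: "basis_projection J R" "hilbert_schmidt (P - R)" and RV: "R \<cdot> V = V \<cdot> P"
    and ker: "ker1 P (op11 P R) = h_of P V"
  shows "hs_norm T \<le> hs_norm (op21 P R \<cdot> gen_inv (op11 P R))"
proof -
  have clR [simp]: "clinear_op R" and RR: "R \<cdot> R = R" and saR [simp]: "R\<^sup>\<dagger> = R"
    and barR: "bar R = id_blinfun - R"
    using R by (auto simp: basis_projection_def orth_projection_def eq_diff_eq add.commute)
  define A where "A = op11 P R"
  define C where "C = op21 P R"
  have cl [simp]: "clinear_op A" "clinear_op C" by (simp_all add: A_def C_def op11_def op21_def)
  have saA: "A\<^sup>\<dagger> = A" by (simp add: A_def op11_def comp_assoc)
  have barA: "bar A = Q - Q \<cdot> (R \<cdot> Q)"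
    by (simp add: A_def op11_def barR op_simps comp_assoc PQ_rules)
  have A_P: "A \<cdot> P = A" "P \<cdot> A = A" and C_P: "C \<cdot> P = C" "Q \<cdot> C = C"
    by (simp_all add: A_def C_def op11_def op21_def comp_assoc PQ_rules PQ_rules[THEN comp_extend])
  have "\<exists>B. moore_penrose A B"
  proof (rule moore_penrose_exists_mod_hilbert_schmidt)
    show "hilbert_schmidt (P \<cdot> ((P - R) \<cdot> P))" using R(2) by simp
    fix f assume f: "f \<in> orth_complement_ker A"
    have "A \<cdot> Q = 0" by (simp add: Q_comp A_P)
    then have "P f = f" using f by (rule orth_complement_ker_in_range_P)
    moreover have "P = A + P \<cdot> ((P - R) \<cdot> P)"
      by (simp add: A_def op11_def op_simps comp_assoc PQ_rules)
    ultimately have "f = A f + (P \<cdot> ((P - R) \<cdot> P)) f" by (metis blinfun.add_left)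
    then show "norm f \<le> norm (A f) + norm ((P \<cdot> ((P - R) \<cdot> P)) f)" by (metis norm_triangle_ineq)
  qed simp
  then obtain B where B: "moore_penrose A B" by blast
  then have clB [simp]: "clinear_op B" and BAB: "B \<cdot> (A \<cdot> B) = B" and AB: "(A \<cdot> B)\<^sup>\<dagger> = A \<cdot> B"
    by (simp_all add: moore_penrose_def)
  have saB: "B\<^sup>\<dagger> = B"
    using gen_inv_eq[OF B] gen_inv_eq[OF moore_penrose_adj[OF B]] saA by simp
  have comm: "A \<cdot> B = B \<cdot> A" using AB by (simp add: saA saB)
  have "P - B \<cdot> A = p"
  proof -
    have "range (P - B \<cdot> A) = h_of P V"
      using projection_onto_ker(2)[OF proj_P A_P(1) B] ker by (simp add: ker1_def A_def)
    from proj_on_eqI[OF projection_onto_ker(1)[OF proj_P A_P(1) B] this]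
    show ?thesis by (simp add: proj_on_h)
  qed
  then have BA: "B \<cdot> A = P - p" by (metis add_diff_cancel_left' diff_add_cancel)
  have Rp: "R \<cdot> p = 0" by (rule intertwining_p[OF RV])
  have pR: "p' \<cdot> R = p'"
  proof -
    have "p \<cdot> R = 0" using arg_cong[OF Rp, of adj] by simp
    from arg_cong[OF this, of bar] show ?thesis by (simp add: barR op_simps)
  qed
  have C_p: "C \<cdot> p = 0" and p'_C: "p' \<cdot> C = 0"
    by (simp_all add: C_def op21_def comp_assoc p_rules p_rules[THEN comp_extend] Rp pR[THEN comp_extend])
  \<comment> \<open>A component of the idempotence of R, together with the conjugate of R being its complement.\<close>
  have CA: "C \<cdot> A = bar A \<cdot> C"
    unfolding barA
    by (simp add: A_def C_def op11_def op21_def compl_proj_def op_simps comp_assoc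
        PQ_rules(1) comp_extend[OF PQ_rules(1)] RR RR[THEN comp_extend])
  have barBA: "bar B \<cdot> bar A = Q - p'" using arg_cong[OF BA, of bar] by simp
  \<comment> \<open>Inverting A in the previous identity; this is the antisymmetry of the graph operator.\<close>
  have CB: "C \<cdot> B = bar B \<cdot> C"
  proof -
    have "bar B \<cdot> (C \<cdot> (A \<cdot> B)) = bar B \<cdot> C"
      unfolding comm BA by (simp add: op_simps C_P C_p)
    moreover have "bar B \<cdot> (C \<cdot> (A \<cdot> B)) = (bar B \<cdot> bar A) \<cdot> (C \<cdot> B)"
      using CA by (metis comp_assoc)
    ultimately show ?thesis
      unfolding barBA by (simp add: op_simps C_P[THEN comp_extend] p'_C[THEN comp_extend])
  qed
  define S where "S = C \<cdot> B"
  \<comment> \<open>The component in the second subspace of R fixing the vectors V f, f in the first subspace.\<close>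
  have S_a: "S \<cdot> a = T \<cdot> a"
  proof -
    have "Q \<cdot> (R \<cdot> (V \<cdot> P)) = Q \<cdot> (V \<cdot> P)"
      using RV by (metis comp_assoc PQ_rules(1))
    then have "C \<cdot> a = bar A \<cdot> c"
      unfolding barA C_def op21_def
      by (simp add: V_P op_simps comp_assoc abcd_corners eq_diff_eq)
    then have "S \<cdot> a = (bar B \<cdot> bar A) \<cdot> c"
      unfolding S_def CB by (simp add: comp_assoc)
    then show ?thesis unfolding barBA by (simp add: op_simps abcd_corners p'_c T_a)
  qed
  have barS: "bar S = - S\<^sup>\<dagger>"
  proof -
    have "bar C = - C\<^sup>\<dagger>"
      by (simp add: C_def op21_def barR op_simps comp_assoc PQ_rules)
    then show ?thesis
      unfolding S_def using arg_cong[OF CB, of adj] saB bar_adj[OF clB]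
      by (simp add: op_simps)
  qed
  have S_P: "S \<cdot> P = S"
    unfolding S_def using BAB comm A_P by (metis comp_assoc)
  define D where "D = S - T"
  have clD [simp]: "clinear_op D" by (simp add: D_def S_def)
  have D_coker: "D \<cdot> coker_a = D"
    by (simp add: D_def coker_a_def op_simps S_P T_rules0 S_a T_a[symmetric] flip: comp_assoc)
  have coker_D: "coker_d \<cdot> D = D"
  proof -
    have "clinear_op S" by (simp add: S_def)
    have "bar D = bar S - bar T" by (simp add: D_def)
    also have "\<dots> = - D\<^sup>\<dagger>"
      unfolding barS bar_T D_def using \<open>clinear_op S\<close> by simp
    finally have "bar D = - D\<^sup>\<dagger>" .
    then have "D\<^sup>\<dagger> \<cdot> coker_d = D\<^sup>\<dagger>"
      using arg_cong[OF D_coker, of bar] by (simp add: op_simps)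
    from arg_cong[OF this, of adj] show ?thesis by simp
  qed
  have coker_T_coker: "coker_d \<cdot> (T \<cdot> coker_a) = 0"
    by (simp add: T_eq op_simps comp_assoc ker_rules ker_rules[THEN comp_extend])
  show ?thesis
    unfolding A_def[symmetric] C_def[symmetric] gen_inv_eq[OF B] S_def[symmetric]
  proof (rule hs_norm_corner_mono[where e\<^sub>1="a \<cdot> a_inv" and e\<^sub>2=coker_a])
    have "C = - (Q \<cdot> ((P - R) \<cdot> P))"
      by (simp add: C_def op21_def op_simps comp_assoc PQ_rules)
    then show "hilbert_schmidt S" using R(2) by (simp add: S_def)
    show "hilbert_schmidt T" by simp
    show "(a \<cdot> a_inv)\<^sup>\<dagger> = a \<cdot> a_inv" by (simp add: a_inv_rules)
    show "a \<cdot> a_inv \<cdot> coker_a = 0" by (simp add: comp_assoc ker_rules)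
    show "S \<cdot> (a \<cdot> a_inv + coker_a) = S" "T \<cdot> (a \<cdot> a_inv + coker_a) = T" by (simp_all only: P_split S_P T_rules0)
    show "S \<cdot> (a \<cdot> a_inv) = T \<cdot> (a \<cdot> a_inv)" using S_a by (metis comp_assoc)
    show "norm ((T \<cdot> coker_a) f) \<le> norm ((S \<cdot> coker_a) f)" for f
    proof -
      have "S \<cdot> coker_a = T \<cdot> coker_a + D"
      proof -
        have "S \<cdot> coker_a = T \<cdot> coker_a + D \<cdot> coker_a" by (simp add: D_def op_simps)
        then show ?thesis by (simp only: D_coker)
      qed
      moreover have "cinner ((T \<cdot> coker_a) f) (D f) = 0"
      proof -
        have "cinner ((T \<cdot> coker_a) f) (D f) = cinner ((T \<cdot> coker_a) f) (coker_d (D f))"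
          using coker_D by (metis op_apply)
        also have "\<dots> = cinner ((coker_d \<cdot> (T \<cdot> coker_a)) f) (D f)"
          using cinner_adj_left[of coker_d "(T \<cdot> coker_a) f" "D f"] by simp
        finally show ?thesis unfolding coker_T_coker by simp
      qed
      ultimately have "(norm ((S \<cdot> coker_a) f))\<^sup>2 = (norm ((T \<cdot> coker_a) f))\<^sup>2 + (norm (D f))\<^sup>2"
        using norm_add_sq_orthogonal[of "(T \<cdot> coker_a) f" "D f"] by (simp add: blinfun.add_left)
      then have "(norm ((T \<cdot> coker_a) f))\<^sup>2 \<le> (norm ((S \<cdot> coker_a) f))\<^sup>2" by simp
      then show ?thesis by (rule power2_le_imp_le) simp
    qed
  qed simp_all
qed

end

section \<open>The decomposition of a Bogoliubov operator\<close>

locale bogoliubov_onb = bogoliubov J P V for J :: "'a::complex_hilbert_space \<Rightarrow> 'a" and P V +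
  fixes E :: "'a set"
  assumes onb_E: "onb_of (h_of P V) E"
begin

lemma finite_E: "finite E"
  using finite_onb_of_hilbert_schmidt_range[OF proj_p hs_p] onb_E range_p by simp

abbreviation u :: "'a op" where "u \<equiv> u_of J E"

sublocale graph_unitary J P T p u
proof
  note onb = onb_E[folded range_p]
  show "clinear_op u" by (rule clinear_u_of)
  show "bar u = u\<^sup>\<dagger>" by (rule adj_u_of[symmetric])
  show "u\<^sup>\<dagger> \<cdot> u = p" by (rule adj_u_of_comp[OF proj_p onb finite_E])
  show "u \<cdot> p = u" by (rule u_of_comp_projection[OF proj_p onb finite_E])
qed

lemma U_of_eq: "U_of J P E V = graph_U"
  by (simp add: U_of_def unitary_h_def op_matrix_def proj_on_h graph_U_def bar_u)

definition W :: "'a op" where "W = graph_U\<^sup>\<dagger> \<cdot> V"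

lemma W_of_eq: "W_of J P E V = W"
  by (simp add: W_of_def U_of_eq W_def)

lemma clinear_W [simp]: "clinear_op W" by (simp add: W_def)

lemma V_eq_UW: "V = graph_U \<cdot> W"
  by (simp add: W_def graph_U_unitary[THEN comp_extend])

text \<open>Conjugation by \<open>graph_U\<close> carries \<open>P\<close> to \<open>graph_proj\<close>, and \<open>V\<close> intertwines \<open>P\<close> with \<open>graph_proj\<close>.\<close>

lemma P_W: "P \<cdot> W = W \<cdot> P"
proof -
  have "P \<cdot> graph_U\<^sup>\<dagger> = graph_U\<^sup>\<dagger> \<cdot> graph_proj"
    unfolding graph_U_conj_P[symmetric] by (simp add: graph_U_unitary[THEN comp_extend])
  then have "P \<cdot> W = graph_U\<^sup>\<dagger> \<cdot> graph_proj \<cdot> V" by (simp only: W_def comp_assoc[symmetric])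
  also have "\<dots> = W \<cdot> P" by (simp only: W_def comp_assoc graph_proj_V)
  finally show ?thesis .
qed

lemma W_diag: "W \<in> Bogoliubov_diag J P"
proof -
  have "W\<^sup>\<dagger> \<cdot> W = id_blinfun"
    by (simp add: W_def comp_assoc graph_U_unitary[THEN comp_extend] V_V)
  moreover have "bar W = W" by (simp add: W_def bar_adj)
  ultimately show ?thesis by (simp add: Bogoliubov_diag_def Bogoliubov_def P_W)
qed

lemma U_HS: "graph_U \<in> Bogoliubov_HS J"
  by (simp add: Bogoliubov_HS_def Bogoliubov_def graph_U_unitary hs_graph_U)

lemma M_of_U: "M_of graph_U = 0"
  unfolding M_of_eq_0_iff
  using graph_U_unitary(1) by (metis blinfun.zero_right op_apply blinfun_apply_id_blinfun)

lemma P_of_U: "P_of J P graph_U = P_of J P V"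
  by (simp add: P_of_def T_of_graph_U h_of_graph_U range_p)

lemma M_of_W: "M_of W = M_of V"
proof -
  have "{f. W\<^sup>\<dagger> f = 0} = graph_U\<^sup>\<dagger> ` {f. V\<^sup>\<dagger> f = 0}"
  proof (intro equalityI subsetI)
    fix f assume "f \<in> {f. W\<^sup>\<dagger> f = 0}"
    then have "V\<^sup>\<dagger> (graph_U f) = 0" by (simp add: W_def)
    moreover have "f = graph_U\<^sup>\<dagger> (graph_U f)"
      using graph_U_unitary(2) by (metis op_apply blinfun_apply_id_blinfun)
    ultimately show "f \<in> graph_U\<^sup>\<dagger> ` {f. V\<^sup>\<dagger> f = 0}" by blast
  next
    fix f assume "f \<in> graph_U\<^sup>\<dagger> ` {f. V\<^sup>\<dagger> f = 0}"
    then obtain g where g: "V\<^sup>\<dagger> g = 0" "f = graph_U\<^sup>\<dagger> g" by blast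
    have "graph_U (graph_U\<^sup>\<dagger> g) = g"
      using graph_U_unitary(1) by (metis op_apply blinfun_apply_id_blinfun)
    then show "f \<in> {f. W\<^sup>\<dagger> f = 0}" using g by (simp add: W_def)
  qed
  then show ?thesis
    using complex_dimension_image[of "graph_U\<^sup>\<dagger>" graph_U] graph_U_unitary(1) by (simp add: M_of_def)
qed

lemma W_off_diagonal: "op12 P W = 0" "op21 P W = 0"
proof -
  show "op12 P W = 0" by (simp add: op12_def P_W comp_assoc PQ_rules)
  have "op21 P W = Q \<cdot> (P \<cdot> W)" by (simp only: op21_def P_W comp_assoc)
  then show "op21 P W = 0" by (simp add: PQ_rules[THEN comp_extend])
qed

lemma T_of_W: "T_of P W = 0"
  by (simp add: T_of_def W_off_diagonal)

lemma h_of_W: "h_of P W = {0}"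
proof -
  have "0 \<in> ker2 P (op22 P W)" by (simp add: ker2_def) (metis blinfun.zero_right rangeI)
  then show ?thesis by (auto simp: h_of_def W_off_diagonal)
qed

lemma P_of_W: "P_of J P W = P"
proof -
  have "gen_inv P = P" by (rule gen_inv_eq) (simp add: moore_penrose_def PQ_rules)
  moreover have "proj_on {0 :: 'a} = 0"
    by (rule proj_on_eqI) (auto simp: orth_projection_def)
  ultimately show ?thesis
    by (simp add: P_of_def T_of_W h_of_W proj_T_def PQ_rules)
qed

text \<open>The direct computation yields \<open>iroot (a + T\<^sup>\<dagger> c) - u\<^sup>\<dagger> c\<close>.  Since \<open>T\<^sup>\<dagger>\<close> does not see the difference
  between \<open>c\<close> and \<open>T a\<close>, the bracket is \<open>gram \<cdot> a\<close>.\<close>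

lemma W_P: "P \<cdot> (W \<cdot> P) = root \<cdot> a - u\<^sup>\<dagger> \<cdot> c"
proof -
  have adjT_c: "T\<^sup>\<dagger> \<cdot> c = T\<^sup>\<dagger> \<cdot> (T \<cdot> a)"
  proof -
    have "T\<^sup>\<dagger> \<cdot> (c \<cdot> ker_a) = (T\<^sup>\<dagger> \<cdot> p') \<cdot> c" by (simp add: comp_assoc p'_c)
    then show ?thesis by (simp add: T_a op_simps Tp_rules)
  qed
  have "root \<cdot> (root \<cdot> a) = a + T\<^sup>\<dagger> \<cdot> (T \<cdot> a) + T \<cdot> ((T\<^sup>\<dagger> \<cdot> P) \<cdot> a)"
    by (simp add: root_square[THEN comp_extend] gram_def op_simps comp_assoc abcd_corners)
  then have rra: "root \<cdot> (root \<cdot> a) = a + T\<^sup>\<dagger> \<cdot> c"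
    by (simp add: adjT_c T_rules0)
  have "P \<cdot> graph_U\<^sup>\<dagger> = (iroot \<cdot> (P + T\<^sup>\<dagger>)) - p - u\<^sup>\<dagger>"
    by (simp add: graph_U_eq op_simps comp_assoc rules3)
  moreover have "P \<cdot> (W \<cdot> P) = (P \<cdot> graph_U\<^sup>\<dagger>) \<cdot> (V \<cdot> P)" by (simp only: W_def comp_assoc)
  ultimately have "P \<cdot> (W \<cdot> P) = ((iroot \<cdot> (P + T\<^sup>\<dagger>)) - p - u\<^sup>\<dagger>) \<cdot> (V \<cdot> P)"
    by (simp only:)
  also have "\<dots> = iroot \<cdot> (a + T\<^sup>\<dagger> \<cdot> c) - u\<^sup>\<dagger> \<cdot> c"
  proof -
    have "T\<^sup>\<dagger> \<cdot> a = 0" using comp_extend[OF T_rules0(5), of a] by (simp add: abcd_corners)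
    moreover have "u\<^sup>\<dagger> \<cdot> a = 0" using comp_extend[OF u_rules2(4), of a] by (simp add: abcd_corners)
    moreover have "p \<cdot> c = 0" using comp_extend[OF p_rules(4), of c] by (simp add: abcd_corners)
    ultimately show ?thesis by (simp add: V_P op_simps comp_assoc abcd_corners p_a)
  qed
  also have "iroot \<cdot> (a + T\<^sup>\<dagger> \<cdot> c) = root \<cdot> a"
    unfolding rra[symmetric] by (simp add: rules2)
  finally show ?thesis .
qed

lemma W_matrix: "W = (root \<cdot> a - u\<^sup>\<dagger> \<cdot> c) + (root \<cdot> d - u \<cdot> b)"
proof -
  have "bar W = W" using W_diag by (simp add: Bogoliubov_diag_def Bogoliubov_def)
  then have "Q \<cdot> (W \<cdot> Q) = bar (P \<cdot> (W \<cdot> P))" by simp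
  also have "\<dots> = root \<cdot> d - u \<cdot> b" unfolding W_P by (simp add: bar_adj_u)
  finally have Q: "Q \<cdot> (W \<cdot> Q) = root \<cdot> d - u \<cdot> b" .
  have "P \<cdot> (W \<cdot> P) = P \<cdot> W" by (simp add: P_W[symmetric] PQ_rules[THEN comp_extend])
  moreover have "W \<cdot> Q = Q \<cdot> W" by (simp add: Q_comp P_W)
  then have "Q \<cdot> (W \<cdot> Q) = Q \<cdot> W" by (simp add: PQ_rules[THEN comp_extend])
  ultimately have "W = P \<cdot> (W \<cdot> P) + Q \<cdot> (W \<cdot> Q)"
    by (simp add: PQ_sum flip: op_comp.add_left)
  then show ?thesis unfolding Q W_P .
qed

lemma W_eq_op_matrix:
  "W = op_matrix (op_sqrt (P + T\<^sup>\<dagger> \<cdot> T) \<cdot> a - u\<^sup>\<dagger> \<cdot> c) 0 0 (op_sqrt (Q + T \<cdot> T\<^sup>\<dagger>) \<cdot> d - u \<cdot> b)"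
  by (subst W_matrix) (simp add: op_matrix_def op_sqrt_P op_sqrt_Q comp_assoc abcd_corners)

context
  assumes M0: "M_of V = 0"
begin

lemma V_unitary: "V \<cdot> V\<^sup>\<dagger> = id_blinfun"
proof (rule blinfun_eqI)
  fix f
  have "V\<^sup>\<dagger> (V (V\<^sup>\<dagger> f)) = V\<^sup>\<dagger> f"
    using V_V by (metis op_apply blinfun_apply_id_blinfun)
  then have "V\<^sup>\<dagger> (V (V\<^sup>\<dagger> f) - f) = 0" by (simp add: blinfun.diff_right)
  then have "V (V\<^sup>\<dagger> f) - f = 0" using M0 unfolding M_of_eq_0_iff by blast
  then show "(V \<cdot> V\<^sup>\<dagger>) f = id_blinfun f" by simp
qed

text \<open>For unitary \<open>V\<close> the identity \<open>P\<^sub>V V = V P\<close> becomes \<open>P\<^sub>V = V P V\<^sup>\<dagger>\<close>; these are its components.\<close>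

lemma a_comp_adj_a: "a \<cdot> a\<^sup>\<dagger> = iroot \<cdot> (iroot \<cdot> P) - p" and c_comp_adj_a: "c \<cdot> a\<^sup>\<dagger> = iroot \<cdot> (iroot \<cdot> T)"
proof -
  have "graph_proj = graph_proj \<cdot> (V \<cdot> V\<^sup>\<dagger>)" by (simp add: V_unitary)
  then have "graph_proj = V \<cdot> (P \<cdot> V\<^sup>\<dagger>)" by (metis comp_assoc graph_proj_V)
  then have "op11 P graph_proj = a \<cdot> a\<^sup>\<dagger>" "op21 P graph_proj = c \<cdot> a\<^sup>\<dagger>"
    by (simp_all add: op11_def op21_def comp_assoc PQ_rules PQ_rules[THEN comp_extend])
  then show "a \<cdot> a\<^sup>\<dagger> = iroot \<cdot> (iroot \<cdot> P) - p" "c \<cdot> a\<^sup>\<dagger> = iroot \<cdot> (iroot \<cdot> T)"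
    by (simp_all add: graph_proj_components)
qed

lemma b_comp_adj_d: "b \<cdot> d\<^sup>\<dagger> = - (iroot \<cdot> (iroot \<cdot> T\<^sup>\<dagger>))"
  using c_comp_adj_a[THEN arg_cong, of bar] by (simp add: bar_adj op_simps)

lemma positive_iroot_P: "positive_op (iroot \<cdot> P - p)"
proof -
  have "positive_op (iroot\<^sup>\<dagger> \<cdot> root \<cdot> iroot)" by (rule positive_op_sandwich[OF positive_root]) simp
  then have "positive_op iroot" by (simp add: comp_assoc rules2)
  then have "positive_op ((P - p)\<^sup>\<dagger> \<cdot> iroot \<cdot> (P - p))" by (rule positive_op_sandwich) simp
  then show ?thesis by (simp add: op_simps comp_assoc rules2)
qed

lemma op_abs_adj: "op_abs (a\<^sup>\<dagger>) = iroot \<cdot> P - p" "op_abs (d\<^sup>\<dagger>) = iroot \<cdot> Q - p'"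
proof -
  have sq: "(iroot \<cdot> P - p) \<cdot> (iroot \<cdot> P - p) = a \<cdot> a\<^sup>\<dagger>"
    by (simp add: a_comp_adj_a op_simps comp_assoc rules2)
  show "op_abs (a\<^sup>\<dagger>) = iroot \<cdot> P - p"
    by (rule op_abs_eqI[OF positive_iroot_P]) (simp add: sq)
  have "(iroot \<cdot> Q - p') \<cdot> (iroot \<cdot> Q - p') = d \<cdot> d\<^sup>\<dagger>"
    using sq[THEN arg_cong, of bar] by (simp add: bar_adj)
  then show "op_abs (d\<^sup>\<dagger>) = iroot \<cdot> Q - p'"
    using positive_op_bar[OF positive_iroot_P] by (intro op_abs_eqI) simp_all
qed

text \<open>From \<open>a a\<^sup>\<dagger> = root\<^sup>-\<^sup>2 P - p\<close> and \<open>p a = 0\<close> it follows that \<open>v = root \<cdot> a\<close> satisfies \<open>v v\<^sup>\<dagger> = P - p\<close>, hence is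
  a partial isometry, and \<open>|a| = v\<^sup>\<dagger> |a\<^sup>\<dagger>| v = a\<^sup>\<dagger> root a\<close>.\<close>

lemma polar_isometry_ad: "polar_isometry a = root \<cdot> a" "polar_isometry d = root \<cdot> d"
proof -
  define R where "R = a\<^sup>\<dagger> \<cdot> (root \<cdot> a)"
  define X where "X = a\<^sup>\<dagger> \<cdot> (root \<cdot> (root \<cdot> (root \<cdot> a)))"
  have pa: "p \<cdot> a = 0" by (rule p_a)
  have a_adj_a: "a \<cdot> (a\<^sup>\<dagger> \<cdot> Y) = iroot \<cdot> (iroot \<cdot> (P \<cdot> Y)) - p \<cdot> Y" for Y :: "'a op"
    using comp_extend[OF a_comp_adj_a, of Y] by (simp add: op_simps comp_assoc)
  have paC: "p \<cdot> (a \<cdot> Y) = 0" for Y :: "'a op" using comp_extend[OF pa] by simp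
  note rs = R_def X_def op_simps comp_assoc a_adj_a rules2 pa abcd_corners abcd_adj_corners
  have 1: "root \<cdot> a \<cdot> ((root \<cdot> a)\<^sup>\<dagger> \<cdot> (root \<cdot> a)) = root \<cdot> a" by (simp add: rs)
  have 2: "positive_op R"
    unfolding R_def comp_assoc[symmetric] by (rule positive_op_sandwich[OF positive_root]) simp
  have 3: "R \<cdot> R = a\<^sup>\<dagger> \<cdot> a" by (simp add: rs)
  have 4: "a = root \<cdot> a \<cdot> R" by (simp add: rs)
  have 5: "(root \<cdot> a) f = 0 \<longleftrightarrow> a f = 0" for f
    using norm_le_root[of "a f"] by auto
  have 6: "(root \<cdot> a)\<^sup>\<dagger> \<cdot> (root \<cdot> a) = R \<cdot> X" by (simp add: rs)
  show "polar_isometry a = root \<cdot> a"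
    by (rule polar_isometry_eqI[OF _ 1 op_abs_eqI[OF 2 3] 4 5 6]) simp
  have "polar_isometry (bar a) = bar (root \<cdot> a)"
    by (rule polar_isometry_bar[OF _ _ 1 2 3 4 5 6]) simp_all
  then show "polar_isometry d = root \<cdot> d" by simp
qed

lemma U_polar:
  "graph_U = op_matrix (op_abs (a\<^sup>\<dagger>)) (b \<cdot> (polar_isometry d)\<^sup>\<dagger> - u\<^sup>\<dagger>) (c \<cdot> (polar_isometry a)\<^sup>\<dagger> - u) (op_abs (d\<^sup>\<dagger>))"
proof -
  have "b \<cdot> (d\<^sup>\<dagger> \<cdot> root) = - (iroot \<cdot> T\<^sup>\<dagger>)" "c \<cdot> (a\<^sup>\<dagger> \<cdot> root) = iroot \<cdot> T"
    by (simp_all add: b_comp_adj_d[THEN comp_extend] c_comp_adj_a[THEN comp_extend] op_simps comp_assoc rules2)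
  moreover have "iroot = iroot \<cdot> P + iroot \<cdot> Q" by (simp add: PQ_sum flip: op_comp.add_right)
  ultimately show ?thesis
    by (simp add: op_matrix_def polar_isometry_ad op_abs_adj graph_U_eq op_simps)
qed

lemma W_polar: "W = op_matrix (polar_isometry a - u\<^sup>\<dagger> \<cdot> c) 0 0 (polar_isometry d - u \<cdot> b)"
  by (subst W_matrix) (simp add: op_matrix_def polar_isometry_ad)

end

text \<open>Here \<open>b\<close> and \<open>c\<close> vanish, so all parameters are zero.\<close>

lemma U_of_diag:
  assumes "V \<in> Bogoliubov_diag J P"
  shows "graph_U = id_blinfun" "W = V"
proof -
  have "P \<cdot> V = V \<cdot> P" using assms by (simp add: Bogoliubov_diag_def)
  then have "b = V \<cdot> (P \<cdot> Q)" by (simp add: op12_def flip: comp_assoc)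
  then have b0: "b = 0" by (simp add: PQ_rules)
  then have "c = 0" using bar_abcd(2) by simp
  with b0 have "T = 0" "p = 0" by (simp_all add: T_eq p_def)
  then have "u = 0" using u_p by simp
  have "iroot \<cdot> id_blinfun = id_blinfun" by (rule gram_fixed) (simp_all add: \<open>T = 0\<close>)
  then show U: "graph_U = id_blinfun"
    unfolding graph_U_eq by (simp add: \<open>T = 0\<close> \<open>p = 0\<close> \<open>u = 0\<close>)
  show "W = V" by (simp add: W_def U)
qed

end

theorem proposition2p12:
  fixes J :: "'a::complex_hilbert_space \<Rightarrow> 'a" and P1 V :: "'a op"
  assumes "separable_space (euclidean :: 'a topology)"
    and "complex_dimension (UNIV :: 'a set) = \<infinity>"
    and "complex_conjugation J"
    and "basis_projection J P1"
    and "V \<in> Bogoliubov_P1 J P1"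
  shows
    "(P_of J P1 V \<in> basis_projections_HS J P1 \<and>
      V\<^sup>\<dagger> \<cdot> P_of J P1 V \<cdot> V = P1 \<and>
      (\<forall>P \<in> basis_projections_HS J P1. V\<^sup>\<dagger> \<cdot> P \<cdot> V = P1 \<longrightarrow>
         ker1 P1 (op11 P1 (P_of J P1 V)) = h_of P1 V \<and> h_of P1 V \<subseteq> ker1 P1 (op11 P1 P)) \<and>
      (\<forall>P \<in> basis_projections_HS J P1. V\<^sup>\<dagger> \<cdot> P \<cdot> V = P1 \<and> ker1 P1 (op11 P1 P) = h_of P1 V \<longrightarrow>
         hs_norm (op21 P1 (P_of J P1 V) \<cdot> gen_inv (op11 P1 (P_of J P1 V)))
           \<le> hs_norm (op21 P1 P \<cdot> gen_inv (op11 P1 P))))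
     \<and>
     (\<forall>E. onb_of (h_of P1 V) E \<longrightarrow>
       (let U = U_of J P1 E V; W = W_of J P1 E V; T = T_of P1 V; P2 = compl_proj P1;
            u = u_of J E; u' = op_conj J u;
            V11 = op11 P1 V; V12 = op12 P1 V; V21 = op21 P1 V; V22 = op22 P1 V;
            v11 = polar_isometry V11; v22 = polar_isometry V22
        in
        (U \<in> Bogoliubov_HS J \<and> W \<in> Bogoliubov_diag J P1 \<and>
         M_of U = 0 \<and> T_of P1 U = T \<and> h_of P1 U = h_of P1 V \<and> P_of J P1 U = P_of J P1 V \<and>
         M_of W = M_of V \<and> T_of P1 W = 0 \<and> h_of P1 W = {0} \<and> P_of J P1 W = P1 \<and>
         W = op_matrix (op_sqrt (P1 + T\<^sup>\<dagger> \<cdot> T) \<cdot> V11 - u' \<cdot> V21) 0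
                       0 (op_sqrt (P2 + T \<cdot> T\<^sup>\<dagger>) \<cdot> V22 - u \<cdot> V12) \<and>
         V = U \<cdot> W) \<and>
        (M_of V = 0 \<longrightarrow>
         U = op_matrix (op_abs (V11\<^sup>\<dagger>)) (V12 \<cdot> v22\<^sup>\<dagger> - u')
                       (V21 \<cdot> v11\<^sup>\<dagger> - u) (op_abs (V22\<^sup>\<dagger>)) \<and>
         W = op_matrix (v11 - u' \<cdot> V21) 0
                       0 (v22 - u \<cdot> V12)) \<and>
        (V \<in> Bogoliubov_diag J P1 \<longrightarrow> U = id_blinfun \<and> W = V)))"
proof -
  interpret bogoliubov J P1 V
    using assms by unfold_locales
  have P_V: "P_of J P1 V \<in> basis_projections_HS J P1"
    by (simp add: P_of_eq basis_projections_HS_def basis_projection_graph_proj hs_P_graph_proj)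
  have VPV: "V\<^sup>\<dagger> \<cdot> P_of J P1 V \<cdot> V = P1"
    by (simp add: P_of_eq comp_assoc graph_proj_V V_V[THEN comp_extend])
  have ker: "ker1 P1 (op11 P1 (P_of J P1 V)) = h_of P1 V"
    by (simp only: P_of_eq ker_graph_proj range_p)
  have sub: "h_of P1 V \<subseteq> ker1 P1 (op11 P1 P)"
    if "P \<in> basis_projections_HS J P1" "V\<^sup>\<dagger> \<cdot> P \<cdot> V = P1" for P
    using that h_subset_ker[OF intertwining] by (simp add: basis_projections_HS_def)
  have min: "hs_norm (op21 P1 (P_of J P1 V) \<cdot> gen_inv (op11 P1 (P_of J P1 V)))
           \<le> hs_norm (op21 P1 P \<cdot> gen_inv (op11 P1 P))"
    if "P \<in> basis_projections_HS J P1" "V\<^sup>\<dagger> \<cdot> P \<cdot> V = P1" "ker1 P1 (op11 P1 P) = h_of P1 V" for P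
    unfolding P_of_eq graph_proj_quotient
    using that hs_norm_minimal[OF _ _ intertwining] by (simp add: basis_projections_HS_def)
  show ?thesis
  proof (rule conjI, goal_cases)
    case 1
    show ?case using P_V VPV ker sub min by blast
  next
    case 2
    show ?case
    proof (intro allI impI, goal_cases)
      case E: (1 E)
      interpret bogoliubov_onb J P1 V E
        using E by unfold_locales
      have "h_of P1 graph_U = h_of P1 V" using h_of_graph_U range_p by simp
      note facts = this U_HS W_diag M_of_U T_of_graph_U P_of_U M_of_W T_of_W h_of_W P_of_W
        W_eq_op_matrix V_eq_UW
      show ?case
        unfolding Let_def U_of_eq W_of_eq bar_u
        by (intro conjI impI; (rule facts | (rule U_polar W_polar U_of_diag, assumption)))
    qed
  qed
qed

end
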